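(* Let $0<\epsilon<\frac12$, $z\in\mathbb{R}^m$, $R>0$, $M>0$. Assume that $V_l$, $l=0,1,\dots,d$, are analytic on the closed ball $B_{2R}(z):=\{y\in\mathbb{C}^m:\|y-z\|\le2R\}$ with $\|V_l(y)\|\le M$ for all $y\in B_{2R}(z)$. Let $Y^h_1$ be defined by the one-step $s$-stage Runge--Kutta method with truncated increments $$Y^h_{1,i}=z+\sum_{j=1}^sa_{ij}\Big(V_0(Y^h_{1,j})h+\sum_{l=1}^dV_l(Y^h_{1,j})\Delta_{1,l}\Big),\qquad Y^h_1=z+\sum_{i=1}^sb_i\Big(V_0(Y^h_{1,i})h+\sum_{l=1}^dV_l(Y^h_{1,i})\Delta_{1,l}\Big),$$ and let $\tilde y^{\tilde N}$ be the solution of the associated $\tilde N$-truncated modified equation on $[0,t_1]$, $t_1=h$. Then there exist constants $C,h_0>0$, independent of $h$, such that for all sufficiently small $h$ there exists $\tilde N=\tilde N(h)$ with $$\|\tilde y^{\tilde N}_{t_1}-Y^h_1\|\le C\,h\,e^{-h_0/h^{\frac12-\epsilon}}.$$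
   Context: $\mathbb{N}=\{0,1,2,\dots\}$; for $\alpha=(\alpha_0,\dots,\alpha_d)\in\mathbb{N}^{d+1}$, $|\alpha|:=\alpha_0+\cdots+\alpha_d$; sums $\sum_{|\alpha|=1}^{K}$ run over multi-indices with $1\le|\alpha|\le K$. $\|\cdot\|$ is the Euclidean norm. The driving noises are independent standard Brownian motions $X^1,\dots,X^d$, and their increments are replaced by truncated increments: $\Delta_{1,l}:=\zeta_{1,l}\sqrt h$, where $\xi_{1,1},\dots,\xi_{1,d}$ are i.i.d. standard normal random variables, $A_h=\sqrt{k|\ln h|}$ with a fixed sufficiently large constant $k\ge1$, and $\zeta_{1,l}=\xi_{1,l}$ if $|\xi_{1,l}|\le A_h$, $\zeta_{1,l}=A_h$ if $\xi_{1,l}>A_h$, $\zeta_{1,l}=-A_h$ if $\xi_{1,l}<-A_h$. $a_{ij},b_i$ ($i,j=1,\dots,s$) are the real coefficients of the method. The $d_\alpha$ are the coefficients of the expansion of the one-step map, $Y^h_1(y)=y+\sum_{|\alpha|=1}^\infty d_\alpha(y)h^{\alpha_0}\Delta_{1,1}^{\alpha_1}\cdots\Delta_{1,d}^{\alpha_d}$, where $Y^h_1(y)$ is the one-step solution from initial value $y$. The $\tilde N$-truncated modified equation ($\tilde N\ge1$) is $$\dot{\tilde y}^{\tilde N}_t=\sum_{|\alpha|=1}^{\tilde N}f_\alpha(\tilde y^{\tilde N}_t)h^{\alpha_0-1}\Delta_{1,1}^{\alpha_1}\cdots\Delta_{1,d}^{\alpha_d},\quad t\in[0,h],\qquad\tilde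 y^{\tilde N}_0=z,$$ where $$f_\alpha=d_\alpha\ (|\alpha|=1),\qquad f_\alpha=d_\alpha-\sum_{i=2}^{|\alpha|}\frac1{i!}\sum_{(k^{i,1},\dots,k^{i,i})\in O_i}D_{k^{i,1}}\cdots D_{k^{i,i-1}}f_{k^{i,i}}\ (|\alpha|\ge2),$$ $(D_kg)(y):=g'(y)f_k(y)$, the $D$'s are composed, and $O_i$ is the set of $i$-tuples $(k^{i,1},\dots,k^{i,i})$ of multi-indices in $\mathbb{N}^{d+1}$ with $|k^{i,j}|\ge1$ and $k^{i,1}_l+\cdots+k^{i,i}_l=\alpha_l$ for $l=0,\dots,d$. *)

theory Defs
  imports "HOL-Probability.Probability"
begin

subsection \<open>Analytic vector fields\<close>

text \<open>Several-variable counterpart of the library's \<open>analytic_on\<close>: complex differentiable (real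
  derivative that is complex linear) on a neighbourhood of every point of \<open>S\<close>.\<close>

definition complex_differentiable_at ::
    "(complex ^ 'm \<Rightarrow> complex ^ 'm) \<Rightarrow> complex ^ 'm \<Rightarrow> bool" where
  "complex_differentiable_at f y \<longleftrightarrow>
     (\<exists>f'. (f has_derivative f') (at y) \<and> (\<forall>c v. f' (c *s v) = c *s f' v))"

definition vec_analytic_on ::
    "(complex ^ 'm \<Rightarrow> complex ^ 'm) \<Rightarrow> (complex ^ 'm) set \<Rightarrow> bool" where
  "vec_analytic_on f S \<longleftrightarrow> (\<forall>x\<in>S. \<exists>e>0. \<forall>y\<in>ball x e. complex_differentiable_at f y)"

definition complexify :: "real ^ 'm \<Rightarrow> complex ^ 'm" where
  "complexify z = (\<chi> i. complex_of_real (z $ i))"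


subsection \<open>Truncated increments\<close>

definition trunc_level :: "real \<Rightarrow> real \<Rightarrow> real" where
  "trunc_level k h = sqrt (k * \<bar>ln h\<bar>)"

definition truncate_at :: "real \<Rightarrow> real \<Rightarrow> real" where
  "truncate_at A x = (if x > A then A else if x < - A then - A else x)"

definition trunc_increment :: "real \<Rightarrow> real \<Rightarrow> real \<Rightarrow> real" where
  "trunc_increment k h x = truncate_at (trunc_level k h) x * sqrt h"


subsection \<open>Multi-indices\<close>

text \<open>A multi-index \<open>(\<alpha>\<^sub>0, \<dots>, \<alpha>\<^sub>d)\<close> is a function on the naturals vanishing beyond \<open>d\<close>.\<close>

type_synonym multi_index = "nat \<Rightarrow> nat"

definition multi_indices :: "nat \<Rightarrow> multi_index set" where
  "multi_indices d = {\<alpha>. \<forall>l>d. \<alpha> l = 0}"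

definition mi_order :: "nat \<Rightarrow> multi_index \<Rightarrow> nat" where
  "mi_order d \<alpha> = (\<Sum>l\<le>d. \<alpha> l)"

text \<open>The set \<open>O\<^sub>i\<close> of \<open>i\<close>-tuples of nonzero multi-indices with sum \<open>\<alpha>\<close>.\<close>

definition splittings :: "nat \<Rightarrow> multi_index \<Rightarrow> nat \<Rightarrow> multi_index list set" where
  "splittings d \<alpha> i =
     {ks. length ks = i \<and> (\<forall>k\<in>set ks. k \<in> multi_indices d \<and> mi_order d k \<ge> 1)
        \<and> (\<forall>l\<le>d. (\<Sum>j<i. (ks ! j) l) = \<alpha> l)}"


subsection \<open>One step of the Runge--Kutta method\<close>

text \<open>The method is implicit, so a step is a relation. \<open>B\<close> is the set on which the vector fields are
  given; all stages are required to lie in it. The increments \<open>h\<close> and \<open>\<Delta> l\<close> are independent real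
  variables here.\<close>

definition rk_increment ::
    "nat \<Rightarrow> (nat \<Rightarrow> 'a \<Rightarrow> 'a) \<Rightarrow> real \<Rightarrow> (nat \<Rightarrow> real) \<Rightarrow> 'a \<Rightarrow> 'a::real_normed_vector" where
  "rk_increment d V h \<Delta> x = h *\<^sub>R V 0 x + (\<Sum>l=1..d. \<Delta> l *\<^sub>R V l x)"

definition rk_step ::
    "nat \<Rightarrow> nat \<Rightarrow> (nat \<Rightarrow> nat \<Rightarrow> real) \<Rightarrow> (nat \<Rightarrow> real) \<Rightarrow> (nat \<Rightarrow> 'a \<Rightarrow> 'a) \<Rightarrow> 'a set
      \<Rightarrow> real \<Rightarrow> (nat \<Rightarrow> real) \<Rightarrow> 'a \<Rightarrow> 'a::real_normed_vector \<Rightarrow> bool" where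
  "rk_step d s a b V B h \<Delta> y Y \<longleftrightarrow>
     (\<exists>K. (\<forall>i\<in>{1..s}. K i \<in> B \<and> K i = y + (\<Sum>j=1..s. a i j *\<^sub>R rk_increment d V h \<Delta> (K j)))
        \<and> Y = y + (\<Sum>i=1..s. b i *\<^sub>R rk_increment d V h \<Delta> (K i)))"

text \<open>\<open>c\<close> is a coefficient family of the expansion
  \<open>Y = y + (\<Sum>|\<alpha>|\<ge>1. c \<alpha> h^\<alpha>\<^sub>0 \<Delta>\<^sub>1^\<alpha>\<^sub>1 \<cdots> \<Delta>\<^sub>d^\<alpha>\<^sub>d)\<close> of the one-step map started at \<open>y\<close>, valid for all
  small \<open>h, \<Delta>\<^sub>1, \<dots>, \<Delta>\<^sub>d\<close>.\<close>

definition rk_expansion ::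
    "nat \<Rightarrow> nat \<Rightarrow> (nat \<Rightarrow> nat \<Rightarrow> real) \<Rightarrow> (nat \<Rightarrow> real) \<Rightarrow> (nat \<Rightarrow> 'a \<Rightarrow> 'a) \<Rightarrow> 'a set
      \<Rightarrow> 'a \<Rightarrow> (multi_index \<Rightarrow> 'a::real_normed_vector) \<Rightarrow> bool" where
  "rk_expansion d s a b V B y c \<longleftrightarrow>
     (\<exists>\<rho>>0. \<forall>h \<Delta>. \<bar>h\<bar> < \<rho> \<and> (\<forall>l\<in>{1..d}. \<bar>\<Delta> l\<bar> < \<rho>) \<longrightarrow>
        (\<exists>Y. rk_step d s a b V B h \<Delta> y Y \<and>
             ((\<lambda>\<alpha>. (h ^ \<alpha> 0 * (\<Prod>l=1..d. \<Delta> l ^ \<alpha> l)) *\<^sub>R c \<alpha>) has_sum (Y - y))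
               {\<alpha> \<in> multi_indices d. mi_order d \<alpha> \<ge> 1}))"

text \<open>The coefficients \<open>d\<^sub>\<alpha>(y)\<close>. The description is meaningful for \<open>y\<close> in the interior of \<open>B\<close> and
  multi-indices \<open>\<alpha>\<close> with \<open>|\<alpha>| \<ge> 1\<close>, where the expansion determines the value.\<close>

definition rk_coeff ::
    "nat \<Rightarrow> nat \<Rightarrow> (nat \<Rightarrow> nat \<Rightarrow> real) \<Rightarrow> (nat \<Rightarrow> real) \<Rightarrow> (nat \<Rightarrow> 'a \<Rightarrow> 'a) \<Rightarrow> 'a set
      \<Rightarrow> multi_index \<Rightarrow> 'a \<Rightarrow> 'a::real_normed_vector" where
  "rk_coeff d s a b V B \<alpha> y = (THE v. \<exists>c. rk_expansion d s a b V B y c \<and> v = c \<alpha>)"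


subsection \<open>The truncated modified equation\<close>

text \<open>\<open>lie_deriv (f k) g\<close> is \<open>D\<^sub>k g\<close>. For complex differentiable \<open>g\<close> the real Frechet derivative is the
  complex one.\<close>

definition lie_deriv :: "('a \<Rightarrow> 'a) \<Rightarrow> ('a \<Rightarrow> 'a) \<Rightarrow> 'a \<Rightarrow> 'a::real_normed_vector" where
  "lie_deriv fk g = (\<lambda>y. frechet_derivative g (at y) (fk y))"

lemma mi_order_less:
  assumes "ks \<in> splittings d \<alpha> i" "2 \<le> i" "k \<in> set ks"
  shows "mi_order d k < mi_order d \<alpha>"
proof -
  from assms obtain j where j: "j < i" "ks ! j = k"
    by (auto simp: splittings_def in_set_conv_nth)
  define j' where "j' = (if j = 0 then 1 else 0::nat)"
  have j': "j' < i" "j' \<noteq> j"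
    using assms(2) by (auto simp: j'_def)
  have pos: "mi_order d (ks ! j') \<ge> 1"
    using assms(1) j'(1) by (auto simp: splittings_def)
  have "mi_order d k + mi_order d (ks ! j') = (\<Sum>n\<in>{j, j'}. mi_order d (ks ! n))"
    using j j' by simp
  also have "\<dots> \<le> (\<Sum>n<i. mi_order d (ks ! n))"
    by (rule sum_mono2) (use j j' in auto)
  also have "\<dots> = (\<Sum>l\<le>d. \<Sum>n<i. (ks ! n) l)"
    unfolding mi_order_def by (rule sum.swap)
  also have "\<dots> = mi_order d \<alpha>"
    using assms(1) unfolding mi_order_def by (intro sum.cong) (auto simp: splittings_def)
  finally show ?thesis using pos by linarith
qed

text \<open>The coefficients \<open>f\<^sub>\<alpha>\<close> built from a family \<open>c\<close> of coefficients \<open>d\<^sub>\<alpha>\<close>; for \<open>|\<alpha>| = 1\<close> the sum is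
  empty, so \<open>f\<^sub>\<alpha> = d\<^sub>\<alpha>\<close>.\<close>

function modified_coeff ::
    "nat \<Rightarrow> (multi_index \<Rightarrow> 'a \<Rightarrow> 'a) \<Rightarrow> multi_index \<Rightarrow> 'a \<Rightarrow> 'a::real_normed_vector" where
  "modified_coeff d c \<alpha> = (\<lambda>y. c \<alpha> y -
     (\<Sum>i=2..mi_order d \<alpha>. (1 / fact i) *\<^sub>R
        (\<Sum>ks\<in>splittings d \<alpha> i.
           foldr (\<lambda>k g. lie_deriv (modified_coeff d c k) g)
             (butlast ks) (modified_coeff d c (last ks)) y)))"
  by pat_completeness auto
termination
proof (relation "Wellfounded.measure (\<lambda>(d, c, \<alpha>). mi_order d \<alpha>)", goal_cases)
  case 1
  show ?case by simp
next
  case (2 d c \<alpha> y i ks)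
  then have "ks \<noteq> []"
    by (auto simp: splittings_def)
  with 2 show ?case
    by (auto intro: mi_order_less)
next
  case (3 d c \<alpha> y i ks k)
  then show ?case
    by (auto intro: mi_order_less dest: in_set_butlastD)
qed

declare modified_coeff.simps [simp del]

definition modified_field ::
    "nat \<Rightarrow> (multi_index \<Rightarrow> 'a \<Rightarrow> 'a) \<Rightarrow> nat \<Rightarrow> real \<Rightarrow> (nat \<Rightarrow> real) \<Rightarrow> 'a \<Rightarrow> 'a::real_normed_vector"
  where
  "modified_field d c N h \<Delta> y =
     (\<Sum>\<alpha> | \<alpha> \<in> multi_indices d \<and> 1 \<le> mi_order d \<alpha> \<and> mi_order d \<alpha> \<le> N.
        (h powi (int (\<alpha> 0) - 1) * (\<Prod>l=1..d. \<Delta> l ^ \<alpha> l)) *\<^sub>R modified_coeff d c \<alpha> y)"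

definition ode_solution_on ::
    "('a \<Rightarrow> 'a) \<Rightarrow> 'a set \<Rightarrow> real \<Rightarrow> 'a \<Rightarrow> (real \<Rightarrow> 'a::real_normed_vector) \<Rightarrow> bool" where
  "ode_solution_on F D T y0 y \<longleftrightarrow> y 0 = y0 \<and>
     (\<forall>t\<in>{0..T}. y t \<in> D \<and> (y has_vector_derivative F (y t)) (at t within {0..T}))"

end

theory Submission
  imports Defs "HOL-Complex_Analysis.Cauchy_Integral_Formula" "HOL-Real_Asymp.Real_Asymp"
begin

text \<open>
  Truncation bounds every increment by \<open>\<delta> = sqrt (k * \<bar>ln h\<bar>) * sqrt h\<close>, uniformly in \<open>\<omega>\<close>, and
  \<open>h \<le> \<delta>\<close> for small \<open>h\<close>. The theorem is therefore a deterministic estimate: there are \<open>w\<close> and \<open>C\<close>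
  depending only on the method and the vector fields such that, with \<open>N\<close> the integer part of
  \<open>w / \<delta>\<close>, the error is at most \<open>C * exp (- (w / \<delta>))\<close> whenever \<open>h\<close> and all \<open>\<bar>\<Delta> l\<bar>\<close> are at most
  \<open>\<delta>\<close>. As \<open>\<delta>\<close> is smaller than \<open>h powr (1/2 - \<epsilon>)\<close> by a factor \<open>h powr \<epsilon>\<close>, up to a logarithm, this beats
  \<open>h * exp (- 1 / h powr (1/2 - \<epsilon>))\<close>; the choice \<open>h\<^sub>0 = 1\<close> is one of many.

  The exponential comes from optimal truncation. The time-\<open>h\<close> flow of the modified field is a Lie
  series: its \<open>i\<close>-th Taylor term is a sum over words \<open>k\<^sub>1, \<dots>, k\<^sub>i\<close> of multi-indices of the iterated
  Lie derivatives of the \<open>f\<^sub>k\<close>, weighted by the monomial with exponent \<open>k\<^sub>1 + \<dots> + k\<^sub>i\<close>. The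
  recursion defining \<open>f\<^sub>\<alpha>\<close> says precisely that the words with sum \<open>\<alpha>\<close> add up to \<open>d\<^sub>\<alpha>\<close>, so up to order
  \<open>N\<close> flow and step agree (\<open>low_order_terms\<close>). What is left, namely the words of order above \<open>N\<close>, the
  Taylor remainder and the tail of the step expansion, contains at least \<open>N\<close> factors of size \<open>\<delta>\<close>.
  If the majorant series still converges for increments \<open>e\<close> times larger, each of these
  contributes a factor \<open>exp (- N)\<close>.

  It remains to see how large the increments may be. By Cauchy's estimate a Lie derivative costs a
  constant times \<open>1 / \<delta>'\<close> when the ball on which one works shrinks by \<open>\<delta>'\<close>; with at most \<open>N\<close>
  differentiations one can afford \<open>\<delta>'\<close> of order \<open>R / N\<close>. In these units the sum \<open>S\<close> of the
  majorants of all \<open>f\<^sub>\<alpha>\<close> with \<open>\<bar>\<alpha>\<bar> \<le> n\<close>, evaluated at increments of size \<open>reach N\<close> (a constant over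
  \<open>N\<close>), is at most \<open>1/4 + (exp S' - 1 - S')\<close>, where \<open>S'\<close> belongs to \<open>n - 1\<close>. Hence \<open>S \<le> 1/2\<close> for all
  \<open>n \<le> N\<close>, by induction (\<open>weight_sum_le\<close>), and \<open>N\<close> of order \<open>1 / \<delta>\<close> is allowed
  (\<open>truncation_error\<close>).

  Two ingredients are needed beforehand. First, the \<open>d\<^sub>\<alpha>\<close> must exist, be holomorphic and
  grow at most geometrically (\<open>rk_coeff_analytic\<close>): the implicit stages are uniform limits of Picard iterates,
  hence holomorphic in the starting point and in each increment; bounded functions of this kind have
  a power series in the increments (\<open>multivariate_power_series\<close>), and its coefficients are determined
  by real increments (\<open>multivariate_power_series_unique\<close>). Secondly, the modified equation must have
  a solution, and every solution must stay where the \<open>f\<^sub>\<alpha>\<close> are under control; both follow from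
  the smallness of \<open>h\<close> times the modified field (\<open>picard_existence\<close>, \<open>solution_stays\<close>).
\<close>

section \<open>Holomorphic maps of several complex variables\<close>

lemma holomorphic_coeff_bound:
  fixes \<phi> :: "complex \<Rightarrow> complex"
  assumes "\<phi> holomorphic_on ball 0 \<sigma>" "\<sigma> > 0" "\<And>s. norm s < \<sigma> \<Longrightarrow> norm (\<phi> s) \<le> K"
  shows "norm ((deriv ^^ n) \<phi> 0 / fact n) \<le> K / \<sigma> ^ n"
proof -
  have K: "0 \<le> K" using assms(3)[of 0] assms(2) norm_ge_zero[of "\<phi> 0"] by (auto simp del: norm_ge_zero)
  \<comment> \<open>Cauchy's inequality wants a closed disc, so the radius \<open>\<sigma>\<close> is reached as a limit from below.\<close>
  have le: "norm ((deriv ^^ n) \<phi> 0 / fact n) \<le> K / r ^ n" if r: "0 < r" "r < \<sigma>" for r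
  proof -
    have "norm ((deriv ^^ n) \<phi> 0) \<le> fact n * K / r ^ n"
    proof (rule Cauchy_inequality)
      show "\<phi> holomorphic_on ball 0 r"
        using assms(1) r by (auto intro: holomorphic_on_subset)
      show "continuous_on (cball 0 r) \<phi>"
        using r by (intro holomorphic_on_imp_continuous_on holomorphic_on_subset[OF assms(1)]) auto
    qed (use r assms(3) in auto)
    then show ?thesis
      by (simp add: norm_divide field_simps)
  qed
  have "((\<lambda>r. K / r ^ n) \<longlongrightarrow> K / \<sigma> ^ n) (at_left \<sigma>)"
    using assms(2) by (auto intro!: tendsto_eq_intros)
  moreover have "eventually (\<lambda>r. 0 < r \<and> r < \<sigma>) (at_left \<sigma>)"
    using assms(2) eventually_at_left_real[of 0 \<sigma>] by (auto elim: eventually_mono)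
  ultimately show ?thesis
    by (intro tendsto_lowerbound) (auto elim!: eventually_mono intro: le)
qed

text \<open>The Taylor coefficients are dominated by \<open>K / \<sigma> ^ p\<close>, so the tail is a geometric series whose ratio is
  at most \<open>1/2\<close> on the half disc.\<close>

lemma holomorphic_taylor_tail:
  fixes \<phi> :: "complex \<Rightarrow> complex"
  assumes hol: "\<phi> holomorphic_on ball 0 \<sigma>" and \<sigma>: "\<sigma> > 0"
    and K: "\<And>s. norm s < \<sigma> \<Longrightarrow> norm (\<phi> s) \<le> K" and s: "norm s \<le> \<sigma> / 2"
  shows "norm (\<phi> s - (\<Sum>p<n. (deriv ^^ p) \<phi> 0 / fact p * s ^ p)) \<le> 2 * K * (norm s / \<sigma>) ^ n"
proof -
  define t where "t p = (deriv ^^ p) \<phi> 0 / fact p * s ^ p" for p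
  define q where "q = norm s / \<sigma>"
  have q: "0 \<le> q" "q \<le> 1/2"
    using s \<sigma> by (auto simp: q_def field_simps)
  have K0: "0 \<le> K" using K[of 0] \<sigma> norm_ge_zero[of "\<phi> 0"] by (auto simp del: norm_ge_zero)
  have tq: "norm (t p) \<le> K * q ^ p" for p
  proof -
    have "norm (t p) \<le> K / \<sigma> ^ p * norm s ^ p"
      unfolding t_def norm_mult norm_power
      by (intro mult_right_mono holomorphic_coeff_bound[OF hol \<sigma> K]) auto
    then show ?thesis by (simp add: q_def power_divide)
  qed
  have "t sums \<phi> s"
    using holomorphic_power_series[OF hol, of s] s \<sigma> by (simp add: t_def[abs_def])
  then have *: "(\<lambda>p. t (p + n)) sums (\<phi> s - (\<Sum>p<n. t p))"
    by (subst sums_iff_shift) auto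
  have g: "(\<lambda>p. K * q ^ n * q ^ p) sums (K * q ^ n * (1 / (1 - q)))"
    using q by (intro sums_mult geometric_sums) auto
  have le: "norm (t (p + n)) \<le> K * q ^ n * q ^ p" for p
    using tq[of "p + n"] by (simp add: power_add mult_ac)
  have "norm (\<phi> s - (\<Sum>p<n. t p)) = norm (\<Sum>p. t (p + n))"
    using * by (simp add: sums_iff)
  also have "\<dots> \<le> K * q ^ n * (1 / (1 - q))"
    using g le by (metis suminf_le summable_norm_comparison_test sums_iff norm_suminf_le)
  also have "\<dots> \<le> K * q ^ n * 2"
    using q K0 by (intro mult_left_mono) (auto simp: field_simps)
  finally show ?thesis by (simp add: t_def q_def mult_ac)
qed

abbreviation "cdiff \<equiv> complex_differentiable_at"

text \<open>Several-variable holomorphy on a set. Its properties are obtained from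
  one-variable complex analysis by restricting to complex lines.\<close>

definition vholo :: "(complex ^ 'm) set \<Rightarrow> (complex ^ 'm \<Rightarrow> complex ^ 'm) \<Rightarrow> bool" where
  "vholo U g \<longleftrightarrow> (\<forall>y\<in>U. cdiff g y)"

lemma vholoD: "vholo U g \<Longrightarrow> y \<in> U \<Longrightarrow> cdiff g y"
  by (simp add: vholo_def)

lemma vholo_subset: "vholo U g \<Longrightarrow> T \<subseteq> U \<Longrightarrow> vholo T g"
  by (auto simp: vholo_def)

lemma norm_vector_smult: "norm (c *s v) = norm c * norm (v :: complex ^ 'm)"
  by (simp add: norm_vec_def norm_mult L2_set_right_distrib)

lemma norm_le_card_component:
  fixes v :: "complex ^ 'm"
  assumes "\<And>i. norm (v $ i) \<le> K"
  shows "norm v \<le> real CARD('m) * K"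
proof -
  have "norm v \<le> (\<Sum>i\<in>UNIV. norm (v $ i))"
    unfolding norm_vec_def by (rule L2_set_le_sum) auto
  also have "\<dots> \<le> of_nat (card (UNIV :: 'm set)) * K"
    using assms by (intro sum_bounded_above) auto
  finally show ?thesis by simp
qed

lemma bounded_linear_smult_left: "bounded_linear (\<lambda>c. c *s (v :: complex ^ 'm))"
  by (rule linear_conv_bounded_linear[THEN iffD1], rule linearI)
     (auto simp: vec_eq_iff algebra_simps)

lemma bounded_linear_smult_right: "bounded_linear (\<lambda>v :: complex ^ 'm. c *s v)"
  by (rule linear_conv_bounded_linear[THEN iffD1], rule linearI)
     (auto simp: vec_eq_iff algebra_simps)

lemma scaleR_eq_smult: "r *\<^sub>R (v :: complex ^ 'm) = complex_of_real r *s v"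
  by (auto simp: vec_eq_iff complex_eq_iff)

lemma cdiff_frechet:
  assumes "cdiff g y"
  shows "(g has_derivative frechet_derivative g (at y)) (at y)"
    and "frechet_derivative g (at y) (c *s v) = c *s frechet_derivative g (at y) v"
  using assms frechet_derivative_at unfolding complex_differentiable_at_def by (metis)+

lemma cdiff_continuous: "cdiff g y \<Longrightarrow> isCont g y"
  using cdiff_frechet(1) has_derivative_continuous by blast

lemma vholo_continuous_on: "vholo U g \<Longrightarrow> continuous_on U g"
  by (meson cdiff_continuous continuous_at_imp_continuous_on vholoD)

lemma cdiff_const: "cdiff (\<lambda>y. v) y"
  unfolding complex_differentiable_at_def
  by (intro exI[of _ "\<lambda>_. 0"]) auto

lemma cdiff_id: "cdiff (\<lambda>y. y) y"
  unfolding complex_differentiable_at_def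
  by (intro exI[of _ "\<lambda>x. x"]) auto

lemma cdiff_add:
  assumes "cdiff f y" "cdiff g y"
  shows "cdiff (\<lambda>y. f y + g y) y"
proof -
  from assms obtain f' g' where "(f has_derivative f') (at y)" "\<forall>c v. f' (c *s v) = c *s f' v"
    "(g has_derivative g') (at y)" "\<forall>c v. g' (c *s v) = c *s g' v"
    unfolding complex_differentiable_at_def by blast
  then show ?thesis unfolding complex_differentiable_at_def
    by (intro exI[of _ "\<lambda>v. f' v + g' v"]) (auto intro: has_derivative_add simp: vector_add_ldistrib)
qed

lemma cdiff_smult:
  assumes "cdiff f y"
  shows "cdiff (\<lambda>y. a *s f y) y"
proof -
  from assms obtain f' where "(f has_derivative f') (at y)" "\<forall>c v. f' (c *s v) = c *s f' v"
    unfolding complex_differentiable_at_def by blast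
  then show ?thesis unfolding complex_differentiable_at_def
    by (intro exI[of _ "\<lambda>v. a *s f' v"])
       (auto intro: bounded_linear.has_derivative[OF bounded_linear_smult_right] simp: vec_eq_iff)
qed

lemma cdiff_scaleR:
  "cdiff f y \<Longrightarrow> cdiff (\<lambda>y. r *\<^sub>R f y) y"
  unfolding scaleR_eq_smult by (rule cdiff_smult)

lemma cdiff_diff:
  assumes "cdiff f y" "cdiff g y"
  shows "cdiff (\<lambda>y. f y - g y) y"
  using cdiff_add[OF assms(1) cdiff_scaleR[OF assms(2), of "-1"]] by simp

lemma cdiff_sum:
  "(\<And>i. i \<in> A \<Longrightarrow> cdiff (f i) y) \<Longrightarrow>
    cdiff (\<lambda>y. \<Sum>i\<in>A. f i y) y"
  by (induction A rule: infinite_finite_induct) (auto intro: cdiff_add cdiff_const)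

lemma cdiff_compose:
  assumes "cdiff f y" "cdiff g (f y)"
  shows "cdiff (\<lambda>y. g (f y)) y"
proof -
  from assms obtain f' g' where "(f has_derivative f') (at y)" "\<forall>c v. f' (c *s v) = c *s f' v"
    "(g has_derivative g') (at (f y))" "\<forall>c v. g' (c *s v) = c *s g' v"
    unfolding complex_differentiable_at_def by blast
  then show ?thesis unfolding complex_differentiable_at_def
    by (intro exI[of _ "\<lambda>v. g' (f' v)"]) (auto intro: has_derivative_compose)
qed

lemma cdiff_cong:
  assumes "cdiff f y" "open U" "y \<in> U" "\<And>x. x \<in> U \<Longrightarrow> f x = g x"
  shows "cdiff g y"
  using assms unfolding complex_differentiable_at_def
  by (meson has_derivative_transform_within_open)

text \<open>Along a complex line a holomorphic map is an ordinary holomorphic function of one variable. This is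
  where complex linearity of the derivative enters.\<close>

lemma vholo_line:
  assumes "cdiff g (y + s *s v)"
  shows "((\<lambda>s. g (y + s *s v) $ i) has_field_derivative
           frechet_derivative g (at (y + s *s v)) v $ i) (at s)"
proof -
  let ?f' = "frechet_derivative g (at (y + s *s v))"
  have "((\<lambda>s. y + s *s v) has_derivative (\<lambda>t. t *s v)) (at s)"
    using has_derivative_add[OF has_derivative_const
        bounded_linear_imp_has_derivative[OF bounded_linear_smult_left]] by simp
  from has_derivative_compose[OF this cdiff_frechet(1)[OF assms]]
  have "((\<lambda>s. g (y + s *s v) $ i) has_derivative (\<lambda>t. ?f' (t *s v) $ i)) (at s)"
    by (rule bounded_linear.has_derivative[OF bounded_linear_vec_nth])
  moreover have "(\<lambda>t. ?f' (t *s v) $ i) = (*) (?f' v $ i)"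
    using cdiff_frechet(2)[OF assms] by (auto simp: mult.commute)
  ultimately show ?thesis by (simp add: has_field_derivative_def)
qed

lemma vholo_line_holomorphic:
  assumes "\<And>s. s \<in> S \<Longrightarrow> cdiff g (y + s *s v)"
  shows "(\<lambda>s. g (y + s *s v) $ i) holomorphic_on S"
  unfolding holomorphic_on_def field_differentiable_def
  using vholo_line[OF assms] has_field_derivative_at_within by blast

text \<open>Cauchy's estimate on the disc cut out of the ball by the line through \<open>y\<close> in direction \<open>v\<close>. It is
  applied to each component separately, which accounts for the factor \<open>CARD('m)\<close>.\<close>

lemma frechet_derivative_bound:
  fixes g :: "complex ^ 'm \<Rightarrow> complex ^ 'm"
  assumes "vholo (ball y \<rho>) g" "\<rho> > 0" "\<And>x. x \<in> ball y \<rho> \<Longrightarrow> norm (g x) \<le> K"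
  shows "norm (frechet_derivative g (at y) v) \<le> real CARD('m) * K * norm v / \<rho>"
proof (cases "v = 0")
  case True
  have "cdiff g y" using assms by (auto simp: vholo_def)
  from cdiff_frechet(1)[OF this] have "frechet_derivative g (at y) 0 = 0"
    by (simp add: has_derivative_def bounded_linear.linear linear_0)
  with True show ?thesis by simp
next
  case False
  define \<sigma> where "\<sigma> = \<rho> / norm v"
  have \<sigma>: "\<sigma> > 0" using False assms(2) by (simp add: \<sigma>_def)
  have inb: "y + s *s v \<in> ball y \<rho>" if "norm s < \<sigma>" for s
    using that False by (simp add: dist_norm norm_vector_smult \<sigma>_def field_simps)
  have "norm (frechet_derivative g (at y) v $ i) \<le> K / \<sigma>" for i
  proof -
    let ?\<phi> = "\<lambda>s. g (y + s *s v) $ i"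
    have hol: "?\<phi> holomorphic_on ball 0 \<sigma>"
      using inb by (intro vholo_line_holomorphic vholoD[OF assms(1)]) auto
    have bd: "norm (?\<phi> s) \<le> K" if "norm s < \<sigma>" for s
      using assms(3)[OF inb[OF that]] Finite_Cartesian_Product.norm_nth_le order_trans by blast
    have "(?\<phi> has_field_derivative frechet_derivative g (at y) v $ i) (at 0)"
      using vholo_line[of g y 0 v i] vholoD[OF assms(1), of y] assms(2) by simp
    then have "deriv ?\<phi> 0 = frechet_derivative g (at y) v $ i"
      by (rule DERIV_imp_deriv)
    then show ?thesis
      using holomorphic_coeff_bound[OF hol \<sigma> bd, of 1] by simp
  qed
  then have "norm (frechet_derivative g (at y) v) \<le> real CARD('m) * (K / \<sigma>)"
    by (rule norm_le_card_component)
  then show ?thesis using False assms(2) by (simp add: \<sigma>_def field_simps)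
qed

text \<open>The several-variable Weierstrass theorem. By Cauchy's estimate for the differences \<open>f m - f n\<close>
  the derivatives are uniformly Cauchy on the half ball, so the derivative may be taken under the limit;
  complex linearity survives pointwise limits.\<close>

lemma vholo_uniform_limit:
  fixes f :: "nat \<Rightarrow> complex ^ 'm \<Rightarrow> complex ^ 'm"
  assumes e: "e > 0" and hol: "eventually (\<lambda>n. vholo (ball y e) (f n)) sequentially"
    and lim: "uniform_limit (ball y e) f g sequentially"
  shows "cdiff g y"
proof -
  let ?S = "ball y (e/2)" and ?\<kappa> = "real CARD('m)"
  have \<kappa>: "?\<kappa> > 0" by simp
  obtain N0 where N0: "\<And>n. n \<ge> N0 \<Longrightarrow> vholo (ball y e) (f n)"
    using hol by (auto simp: eventually_sequentially)
  \<comment> \<open>Holomorphy holds only from some index on, so the sequence is shifted.\<close>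
  define F where "F n = f (n + N0)" for n
  have Fhol: "vholo (ball y e) (F n)" for n
    using N0 by (simp add: F_def)
  have sub: "ball x (e/2) \<subseteq> ball y e" if "x \<in> ?S" for x
  proof
    fix w assume "w \<in> ball x (e/2)"
    then show "w \<in> ball y e"
      using that dist_triangle[of y w x] by (simp)
  qed
  define F' where "F' n x = frechet_derivative (F n) (at x)" for n x
  have diff: "cdiff (F n) x" if "x \<in> ?S" for n x
    using Fhol sub[OF that] that e by (meson centre_in_ball half_gt_zero subsetD vholoD)
  have F'_cauchy: "\<exists>N. \<forall>m\<ge>N. \<forall>n\<ge>N. \<forall>x\<in>?S. \<forall>v. norm (F' m x v - F' n x v) \<le> \<epsilon> * norm v"
    if \<epsilon>: "\<epsilon> > 0" for \<epsilon>
  proof -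
    define \<eta> where "\<eta> = \<epsilon> * e / (4 * ?\<kappa>)"
    have \<eta>: "\<eta> > 0" using \<epsilon> e \<kappa> by (simp add: \<eta>_def)
    from uniform_limitD[OF lim \<eta>] obtain N where
      N: "\<And>n x. n \<ge> N \<Longrightarrow> x \<in> ball y e \<Longrightarrow> dist (f n x) (g x) < \<eta>"
      unfolding eventually_sequentially by blast
    show ?thesis
    proof (intro exI[of _ N] allI ballI impI)
      fix m n x v assume mn: "N \<le> m" "N \<le> n" and x: "x \<in> ?S"
      have "norm (F m w - F n w) \<le> 2 * \<eta>" if "w \<in> ball x (e/2)" for w
      proof -
        have "w \<in> ball y e" using sub[OF x] that by blast
        then have "dist (F m w) (g w) < \<eta>" "dist (F n w) (g w) < \<eta>"
          using N[of "m + N0"] N[of "n + N0"] mn by (auto simp: F_def)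
        then show ?thesis
          using dist_triangle2[of "F m w" "F n w" "g w"] by (simp add: dist_norm)
      qed
      moreover have "vholo (ball x (e/2)) (\<lambda>w. F m w - F n w)"
        using Fhol sub[OF x] unfolding vholo_def by (blast intro: cdiff_diff)
      ultimately have "norm (frechet_derivative (\<lambda>w. F m w - F n w) (at x) v)
          \<le> ?\<kappa> * (2 * \<eta>) * norm v / (e/2)"
        using e by (intro frechet_derivative_bound) auto
      moreover have "frechet_derivative (\<lambda>w. F m w - F n w) (at x) = (\<lambda>v. F' m x v - F' n x v)"
        unfolding F'_def
        by (rule frechet_derivative_at[symmetric])
           (intro has_derivative_diff cdiff_frechet(1) diff x)
      ultimately show "norm (F' m x v - F' n x v) \<le> \<epsilon> * norm v"
        using e \<kappa> by (simp add: \<eta>_def field_simps)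
    qed
  qed
  define g' where "g' x v = lim (\<lambda>n. F' n x v)" for x v
  have lim': "(\<lambda>n. F' n x v) \<longlonglongrightarrow> g' x v" if xS: "x \<in> ?S" for x v
  proof -
    have "Cauchy (\<lambda>n. F' n x v)"
    proof (rule metric_CauchyI)
      fix \<epsilon> :: real assume "\<epsilon> > 0"
      have p: "norm v + 1 > 0" by (simp add: add_nonneg_pos)
      then have pos: "\<epsilon> / (norm v + 1) > 0" using \<open>\<epsilon> > 0\<close> by simp
      from F'_cauchy[OF pos] obtain N where
        N: "\<And>m n. m \<ge> N \<Longrightarrow> n \<ge> N \<Longrightarrow> norm (F' m x v - F' n x v) \<le> \<epsilon> / (norm v + 1) * norm v"
        using xS by blast
      have small: "\<epsilon> / (norm v + 1) * norm v < \<epsilon>"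
        using \<open>\<epsilon> > 0\<close> p by (simp add: field_simps)
      show "\<exists>M. \<forall>m\<ge>M. \<forall>n\<ge>M. dist (F' m x v) (F' n x v) < \<epsilon>"
      proof (intro exI[of _ N] allI impI)
        fix m n assume "N \<le> m" "N \<le> n"
        from le_less_trans[OF N[OF this] small] show "dist (F' m x v) (F' n x v) < \<epsilon>"
          by (simp add: dist_norm)
      qed
    qed
    then show ?thesis
      unfolding g'_def by (simp add: Cauchy_convergent_iff convergent_LIMSEQ_iff)
  qed
  have limF: "(\<lambda>n. F n x) \<longlonglongrightarrow> g x" if "x \<in> ball y e" for x
    unfolding F_def using tendsto_uniform_limitI[OF lim that] LIMSEQ_ignore_initial_segment by blast
  have "\<exists>G. \<forall>x\<in>?S. (\<lambda>n. F n x) \<longlonglongrightarrow> G x \<and> (G has_derivative g' x) (at x within ?S)"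
  proof (rule has_derivative_sequence)
    show "(F n has_derivative F' n x) (at x within ?S)" if "x \<in> ?S" for n x
      unfolding F'_def using cdiff_frechet(1)[OF diff[OF that]] has_derivative_at_withinI by blast
    show "\<forall>\<^sub>F n in sequentially. \<forall>x\<in>?S. \<forall>h. norm (F' n x h - g' x h) \<le> \<epsilon> * norm h" if \<epsilon>: "\<epsilon> > 0" for \<epsilon>
    proof -
      from F'_cauchy[OF \<epsilon>] obtain N where
        N: "\<And>m n x v. m \<ge> N \<Longrightarrow> n \<ge> N \<Longrightarrow> x \<in> ?S \<Longrightarrow> norm (F' n x v - F' m x v) \<le> \<epsilon> * norm v"
        by blast
      have "norm (F' n x v - g' x v) \<le> \<epsilon> * norm v" if "n \<ge> N" "x \<in> ?S" for n x v
      proof (rule tendsto_upperbound)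
        show "(\<lambda>m. norm (F' n x v - F' m x v)) \<longlonglongrightarrow> norm (F' n x v - g' x v)"
          by (intro tendsto_intros lim' that)
        show "\<forall>\<^sub>F m in sequentially. norm (F' n x v - F' m x v) \<le> \<epsilon> * norm v"
          using eventually_ge_at_top[of N] by (rule eventually_mono) (use N that in blast)
      qed auto
      then show ?thesis
        unfolding eventually_sequentially by (intro exI[of _ N] allI ballI impI)
    qed
    show "y \<in> ?S" using e by simp
    show "(\<lambda>n. F n y) \<longlonglongrightarrow> g y" using e by (intro limF) auto
  qed auto
  then obtain G where G: "\<And>x. x \<in> ?S \<Longrightarrow> (\<lambda>n. F n x) \<longlonglongrightarrow> G x"
    "\<And>x. x \<in> ?S \<Longrightarrow> (G has_derivative g' x) (at x within ?S)" by blast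
  have Gg: "G x = g x" if "x \<in> ?S" for x
    using LIMSEQ_unique[OF G(1)[OF that] limF] that e by auto
  have yS: "y \<in> ?S" using e by simp
  have "(G has_derivative g' y) (at y)"
    using G(2)[OF yS] at_within_open[OF yS open_ball] by simp
  then have "(g has_derivative g' y) (at y)"
    by (rule has_derivative_transform_within_open[OF _ open_ball yS Gg])
  moreover have "g' y (c *s v) = c *s g' y v" for c v
  proof (rule LIMSEQ_unique)
    show "(\<lambda>n. F' n y (c *s v)) \<longlonglongrightarrow> g' y (c *s v)" using e by (intro lim') auto
    have "(\<lambda>n. c *s F' n y v) \<longlonglongrightarrow> c *s g' y v"
      using e by (intro bounded_linear.tendsto[OF bounded_linear_smult_right] lim') auto
    moreover have "F' n y (c *s v) = c *s F' n y v" for n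
      unfolding F'_def using diff[of y] e by (intro cdiff_frechet(2)) auto
    ultimately show "(\<lambda>n. F' n y (c *s v)) \<longlonglongrightarrow> c *s g' y v" by simp
  qed
  ultimately show ?thesis unfolding complex_differentiable_at_def by blast
qed

text \<open>The Lie derivative is the limit of the difference quotients \<open>n * (g (y + f y / n) - g y)\<close>. These are
  holomorphic as compositions, and by the second-order Taylor bound along the line in direction \<open>f y\<close>
  the convergence is locally uniform. This avoids
  differentiating the derivative of \<open>g\<close>.\<close>

lemma vholo_lie_deriv:
  fixes f g :: "complex ^ 'm \<Rightarrow> complex ^ 'm"
  assumes U: "open U" and f: "vholo U f" and g: "vholo U g"
  shows "vholo U (lie_deriv f g)"
  unfolding vholo_def
proof
  fix y assume "y \<in> U"
  then obtain e where e: "e > 0" "cball y e \<subseteq> U"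
    using U open_contains_cball by blast
  define \<rho> where "\<rho> = e / 2"
  have \<rho>: "\<rho> > 0" using e by (simp add: \<rho>_def)
  have "compact (h ` cball y e)" if "vholo U h" for h
    using vholo_continuous_on[OF vholo_subset[OF that e(2)]]
    by (rule compact_continuous_image) (rule compact_cball)
  then have "bounded (g ` cball y e)" "bounded (f ` cball y e)"
    using f g compact_imp_bounded by blast+
  then obtain K L where K: "\<And>x. x \<in> cball y e \<Longrightarrow> norm (g x) \<le> K"
    and L: "\<And>x. x \<in> cball y e \<Longrightarrow> norm (f x) \<le> L" unfolding bounded_iff by (metis imageI)
  have K0: "K \<ge> 0" "L \<ge> 0"
    using order_trans[OF norm_ge_zero K[of y]] order_trans[OF norm_ge_zero L[of y]] e by auto
  \<comment> \<open>On the disc of radius \<open>\<sigma>\<close> the lines \<open>s \<mapsto> x + s *s f x\<close> with \<open>x\<close> in the half ball stay in \<open>cball y e\<close>; the \<open>+ 1\<close> covers \<open>L = 0\<close>.\<close>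
  define \<sigma> where "\<sigma> = \<rho> / (L + 1)"
  have \<sigma>: "\<sigma> > 0" using \<rho> K0 by (simp add: \<sigma>_def add_nonneg_pos)
  have inb: "x + s *s f x \<in> cball y e" if "x \<in> ball y \<rho>" "norm s \<le> \<sigma>" for x s
  proof -
    have "x \<in> cball y e" using that \<rho> by (simp add: \<rho>_def)
    then have "norm (s *s f x) \<le> \<sigma> * L"
      using that L \<sigma> K0 by (auto simp: norm_vector_smult intro!: mult_mono)
    also have "\<dots> \<le> \<rho>" using \<rho> K0 by (simp add: \<sigma>_def field_simps)
    finally show ?thesis
      using that dist_triangle_add_half[of y x] norm_triangle_ineq4[of "y - x" "s *s f x"]
      by (simp add: dist_norm \<rho>_def algebra_simps)
  qed
  define s where "s n = 1 / real (Suc n)" for n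
  define q where "q n x = complex_of_real (real (Suc n)) *s (g (x + complex_of_real (s n) *s f x) - g x)"
    for n x
  have s0: "s \<longlonglongrightarrow> 0"
    unfolding s_def using LIMSEQ_inverse_real_of_nat by (simp add: inverse_eq_divide)
  have ev: "eventually (\<lambda>n. s n < \<sigma> / 2) sequentially"
    using order_tendstoD(2)[OF s0, of "\<sigma>/2"] \<sigma> by simp
  have spos: "s n > 0" for n by (simp add: s_def)
  show "cdiff (lie_deriv f g) y"
  proof (rule vholo_uniform_limit[OF \<rho>])
    show "\<forall>\<^sub>F n in sequentially. vholo (ball y \<rho>) (q n)"
      using ev
    proof eventually_elim
      case (elim n)
      show ?case unfolding vholo_def q_def
      proof (intro ballI cdiff_smult cdiff_diff)
        fix x assume x: "x \<in> ball y \<rho>"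
        have xU: "x \<in> U" using x e \<rho> by (auto simp: \<rho>_def subset_iff)
        then show "cdiff g x"
          using g vholoD by auto
        have "x + complex_of_real (s n) *s f x \<in> U"
          using inb[OF x, of "complex_of_real (s n)"] elim spos[of n] \<sigma> e by auto
        then have "cdiff g (x + complex_of_real (s n) *s f x)"
          using g vholoD by auto
        moreover have "cdiff (\<lambda>x. x + complex_of_real (s n) *s f x) x"
          using vholoD[OF f xU] by (intro cdiff_add cdiff_smult cdiff_id)
        ultimately show "cdiff (\<lambda>x. g (x + complex_of_real (s n) *s f x)) x"
          by (intro cdiff_compose[of _ x g])
      qed
    qed
    define C where "C = real CARD('m) * (2 * K / \<sigma>\<^sup>2)"
    have est: "norm (q n x - lie_deriv f g x) \<le> C * s n" if n: "s n < \<sigma> / 2" and x: "x \<in> ball y \<rho>" for n x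
    proof -
      let ?t = "complex_of_real (s n)"
      have "norm ((q n x - lie_deriv f g x) $ i) \<le> 2 * K / \<sigma>\<^sup>2 * s n" for i
      proof -
        let ?\<phi> = "\<lambda>s. g (x + s *s f x) $ i"
        have hol: "?\<phi> holomorphic_on ball 0 \<sigma>"
          using inb[OF x] e by (intro vholo_line_holomorphic vholoD[OF g]) (auto simp: subset_iff)
        have bd: "norm (?\<phi> s) \<le> K" if "norm s < \<sigma>" for s
          using K[OF inb[OF x less_imp_le[OF that]]] Finite_Cartesian_Product.norm_nth_le order_trans by blast
        have xU: "x \<in> U" using x e \<rho> by (auto simp: \<rho>_def subset_iff)
        have "(?\<phi> has_field_derivative frechet_derivative g (at x) (f x) $ i) (at 0)"
          using vholo_line[of g x 0 "f x" i] vholoD[OF g xU] by simp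
        then have d: "deriv ?\<phi> 0 = lie_deriv f g x $ i"
          unfolding lie_deriv_def by (rule DERIV_imp_deriv)
        have "norm (?\<phi> ?t - (\<Sum>p<2. (deriv ^^ p) ?\<phi> 0 / fact p * ?t ^ p)) \<le> 2 * K * (norm ?t / \<sigma>) ^ 2"
          using n spos[of n] by (intro holomorphic_taylor_tail[OF hol \<sigma> bd]) auto
        also have "(\<Sum>p<2. (deriv ^^ p) ?\<phi> 0 / fact p * ?t ^ p) = g x $ i + lie_deriv f g x $ i * ?t"
          using d by (simp add: numeral_2_eq_2)
        finally have *: "norm (?\<phi> ?t - g x $ i - lie_deriv f g x $ i * ?t) \<le> 2 * K * (s n / \<sigma>)\<^sup>2"
          using spos[of n] by (simp add: algebra_simps)
        have "(q n x - lie_deriv f g x) $ i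
            = complex_of_real (real (Suc n)) * (?\<phi> ?t - g x $ i - lie_deriv f g x $ i * ?t)"
        proof -
          have "complex_of_real (real (Suc n)) * ?t = 1"
            unfolding s_def of_real_mult[symmetric] by simp
          then show ?thesis by (simp add: q_def algebra_simps del: of_nat_Suc)
        qed
        then have "norm ((q n x - lie_deriv f g x) $ i)
            = real (Suc n) * norm (?\<phi> ?t - g x $ i - lie_deriv f g x $ i * ?t)"
          by (simp only: norm_mult norm_of_real abs_of_nat)
        also have "\<dots> \<le> real (Suc n) * (2 * K * (s n / \<sigma>)\<^sup>2)"
          using * by (intro mult_left_mono) auto
        also have "\<dots> = 2 * K / \<sigma>\<^sup>2 * s n"
          by (simp add: s_def power2_eq_square field_simps del: of_nat_Suc)
        finally show ?thesis .
      qed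
      then have "norm (q n x - lie_deriv f g x) \<le> real CARD('m) * (2 * K / \<sigma>\<^sup>2 * s n)"
        by (rule norm_le_card_component)
      then show ?thesis by (simp add: C_def mult.assoc)
    qed
    show "uniform_limit (ball y \<rho>) q (lie_deriv f g) sequentially"
    proof (rule uniform_limitI)
      fix \<epsilon> :: real assume "\<epsilon> > 0"
      have "(\<lambda>n. C * s n) \<longlonglongrightarrow> 0" using tendsto_mult_right_zero[OF s0] by simp
      from order_tendstoD(2)[OF this \<open>\<epsilon> > 0\<close>] ev
      show "\<forall>\<^sub>F n in sequentially. \<forall>x\<in>ball y \<rho>. dist (q n x) (lie_deriv f g x) < \<epsilon>"
      proof eventually_elim
        case (elim n)
        show ?case
        proof
          fix x assume "x \<in> ball y \<rho>"
          from est[OF elim(2) this] elim(1) show "dist (q n x) (lie_deriv f g x) < \<epsilon>"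
            by (simp add: dist_norm)
        qed
      qed
    qed
  qed
qed

section \<open>Power series in several variables\<close>

text \<open>Multi-indices in the variables \<open>0, \<dots>, n - 1\<close>. Counting the variables, rather than naming the last one, gives
  inductions over the number of variables a trivial base case.\<close>

definition indices :: "nat \<Rightarrow> multi_index set" where
  "indices n = {\<alpha>. \<forall>l\<ge>n. \<alpha> l = 0}"

lemma multi_indices_eq: "multi_indices d = indices (Suc d)"
  by (auto simp: multi_indices_def indices_def Suc_le_eq)

lemma indices_0: "indices 0 = {\<lambda>_. 0}"
  by (auto simp: indices_def)

lemma bij_indices_Suc:
  "bij_betw (\<lambda>(p, \<beta>). \<beta>(n := p)) (UNIV \<times> indices n) (indices (Suc n))"
proof (rule bij_betw_byWitness[where f' = "\<lambda>\<alpha>. (\<alpha> n, \<alpha>(n := 0))"])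
  show "\<forall>a\<in>UNIV \<times> indices n. (\<lambda>\<alpha>. (\<alpha> n, \<alpha>(n := 0))) (case a of (p, \<beta>) \<Rightarrow> \<beta>(n := p)) = a"
    by (auto simp: indices_def fun_eq_iff)
qed (auto simp: indices_def)

lemma has_sum_indices_Suc_iff:
  "(f has_sum S) (indices (Suc n)) \<longleftrightarrow>
     ((\<lambda>(p, \<beta>). f (\<beta>(n := p))) has_sum S) (UNIV \<times> indices n)"
  using has_sum_reindex_bij_betw[OF bij_indices_Suc, of f n S] by (simp add: case_prod_beta')

lemma prod_upd_Suc:
  "(\<Prod>l<Suc n. x l ^ (\<beta>(n := p)) l) = x n ^ p * (\<Prod>l<n. x l ^ \<beta> l)"
  for x :: "nat \<Rightarrow> 'a :: comm_monoid_mult"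
  by (simp add: mult.commute)

text \<open>The common majorant of all multivariate series below.\<close>

lemma has_sum_geometric_indices:
  fixes q :: "nat \<Rightarrow> real"
  assumes "\<And>l. l < n \<Longrightarrow> 0 \<le> q l \<and> q l < 1"
  shows "((\<lambda>\<alpha>. \<Prod>l<n. q l ^ \<alpha> l) has_sum (\<Prod>l<n. 1 / (1 - q l))) (indices n)"
  using assms
proof (induction n)
  case 0
  then show ?case by (simp add: indices_0 has_sum_finiteI)
next
  case (Suc n)
  let ?G = "\<Prod>l<n. 1 / (1 - q l)"
  have q: "0 \<le> q n" "q n < 1" "\<And>l. l < n \<Longrightarrow> 0 \<le> q l" using Suc.prems by auto
  have IH: "((\<lambda>\<alpha>. \<Prod>l<n. q l ^ \<alpha> l) has_sum ?G) (indices n)"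
    using Suc by auto
  have inner: "((\<lambda>\<beta>. q n ^ p * (\<Prod>l<n. q l ^ \<beta> l)) has_sum (q n ^ p * ?G)) (indices n)" for p
    by (rule has_sum_cmult_right[OF IH])
  have "((\<lambda>p. q n ^ p) has_sum (1 / (1 - q n))) UNIV"
    by (intro norm_summable_imp_has_sum geometric_sums)
       (use q in \<open>auto intro!: summable_geometric simp: norm_power\<close>)
  then have outer: "((\<lambda>p. q n ^ p * ?G) has_sum (1 / (1 - q n) * ?G)) UNIV"
    by (rule has_sum_cmult_left)
  have "(\<lambda>(p, \<beta>). q n ^ p * (\<Prod>l<n. q l ^ \<beta> l)) summable_on (UNIV \<times> indices n)"
  proof (rule summable_on_SigmaI[where g = "\<lambda>p. q n ^ p * ?G"])
    show "(\<lambda>p. q n ^ p * ?G) summable_on UNIV"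
      using outer by (rule has_sum_imp_summable)
  qed (use inner q in \<open>auto intro!: mult_nonneg_nonneg prod_nonneg\<close>)
  then have "((\<lambda>(p, \<beta>). q n ^ p * (\<Prod>l<n. q l ^ \<beta> l)) has_sum (1 / (1 - q n) * ?G)) (UNIV \<times> indices n)"
    by (intro has_sum_SigmaI[OF _ outer]) (use inner in auto)
  then show ?case
    unfolding has_sum_indices_Suc_iff prod_upd_Suc by (simp add: mult.commute)
qed

lemma vholo_open_uniform_limit:
  assumes "open U" "\<And>n. vholo U (f n)" "uniform_limit U f g sequentially"
  shows "vholo U g"
  unfolding vholo_def
proof
  fix y assume "y \<in> U"
  then obtain e where e: "e > 0" "ball y e \<subseteq> U" using assms(1) open_contains_ball by blast
  show "cdiff g y"
  proof (rule vholo_uniform_limit[OF e(1)])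
    show "\<forall>\<^sub>F n in sequentially. vholo (ball y e) (f n)"
      using vholo_subset[OF assms(2) e(2)] by simp
    show "uniform_limit (ball y e) f g sequentially"
      by (rule uniform_limit_on_subset[OF assms(3) e(2)])
  qed
qed

lemma holomorphic_open_uniform_limit:
  assumes "open S" "\<And>n. (f n :: complex \<Rightarrow> complex) holomorphic_on S" "uniform_limit S f g sequentially"
  shows "g holomorphic_on S"
proof (rule holomorphic_uniform_sequence[OF assms(1,2)])
  fix x assume "x \<in> S"
  then obtain e where "e > 0" "cball x e \<subseteq> S" using assms(1) open_contains_cball by blast
  then show "\<exists>d>0. cball x d \<subseteq> S \<and> uniform_limit (cball x d) f g sequentially"
    using uniform_limit_on_subset[OF assms(3)] by blast
qed

text \<open>Holomorphy in the parameter \<open>y\<close> jointly, and in each of the first \<open>n\<close> increments \<open>x l\<close> separately. Separate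
  holomorphy suffices because power series are extracted one variable at a time, and it can be stated
  for a number \<open>n\<close> of variables that is not the dimension of a type.\<close>

definition param_holo ::
    "nat \<Rightarrow> real \<Rightarrow> (complex ^ 'm) set \<Rightarrow> ((nat \<Rightarrow> complex) \<Rightarrow> complex ^ 'm \<Rightarrow> complex ^ 'm) \<Rightarrow> bool" where
  "param_holo n r U F \<longleftrightarrow>
     (\<forall>x. (\<forall>l. norm (x l) < r) \<longrightarrow> vholo U (F x) \<and>
        (\<forall>y\<in>U. \<forall>l<n. \<forall>i. (\<lambda>\<tau>. F (x(l := \<tau>)) y $ i) holomorphic_on ball 0 r))"

lemma param_holo_limit:
  fixes F :: "nat \<Rightarrow> (nat \<Rightarrow> complex) \<Rightarrow> complex ^ 'm \<Rightarrow> complex ^ 'm"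
  assumes "open U" and F: "\<And>j. param_holo n r U (F j)" and c: "c \<longlonglongrightarrow> 0"
    and est: "\<And>j x y i. (\<forall>l. norm (x l) < r) \<Longrightarrow> y \<in> U \<Longrightarrow> norm (F j x y $ i - G x y $ i) \<le> c j"
  shows "param_holo n r U G"
  unfolding param_holo_def
proof (intro allI impI conjI ballI)
  fix x :: "nat \<Rightarrow> complex" assume x: "\<forall>l. norm (x l) < r"
  show "vholo U (G x)"
  proof (rule vholo_open_uniform_limit[OF assms(1)])
    show "vholo U (F j x)" for j using F x by (simp add: param_holo_def)
    show "uniform_limit U (\<lambda>j. F j x) (G x) sequentially"
    proof (rule uniform_limitI)
      fix e :: real assume e: "e > 0"
      have "(\<lambda>j. real CARD('m) * c j) \<longlonglongrightarrow> 0" by (rule tendsto_mult_right_zero[OF c])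
      from order_tendstoD(2)[OF this e]
      show "\<forall>\<^sub>F j in sequentially. \<forall>y\<in>U. dist (F j x y) (G x y) < e"
      proof eventually_elim
        case (elim j)
        show ?case
        proof
          fix y assume y: "y \<in> U"
          have "norm (F j x y - G x y) \<le> real CARD('m) * c j"
            using est[OF x y] by (intro norm_le_card_component) simp
          with elim show "dist (F j x y) (G x y) < e" by (simp add: dist_norm)
        qed
      qed
    qed
  qed
  fix y l i assume y: "y \<in> U" and l: "l < n"
  show "(\<lambda>\<tau>. G (x(l := \<tau>)) y $ i) holomorphic_on ball 0 r"
  proof (rule holomorphic_open_uniform_limit[OF open_ball])
    show "(\<lambda>\<tau>. F j (x(l := \<tau>)) y $ i) holomorphic_on ball 0 r" for j
      using F x y l by (simp add: param_holo_def)
    show "uniform_limit (ball 0 r) (\<lambda>j \<tau>. F j (x(l := \<tau>)) y $ i) (\<lambda>\<tau>. G (x(l := \<tau>)) y $ i) sequentially"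
    proof (rule uniform_limitI)
      fix e :: real assume e: "e > 0"
      from order_tendstoD(2)[OF c e]
      show "\<forall>\<^sub>F j in sequentially. \<forall>\<tau>\<in>ball 0 r. dist (F j (x(l := \<tau>)) y $ i) (G (x(l := \<tau>)) y $ i) < e"
      proof eventually_elim
        case (elim j)
        show ?case
        proof
          fix \<tau> :: complex assume "\<tau> \<in> ball 0 r"
          then have "norm (F j (x(l := \<tau>)) y $ i - G (x(l := \<tau>)) y $ i) \<le> c j"
            using x by (intro est y) simp
          with elim show "dist (F j (x(l := \<tau>)) y $ i) (G (x(l := \<tau>)) y $ i) < e" by (simp add: dist_norm)
        qed
      qed
    qed
  qed
qed

text \<open>The \<open>p\<close>-th Taylor coefficient in the variable \<open>x n\<close>, as a function of the remaining ones.\<close>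

definition coeff_last ::
    "nat \<Rightarrow> ((nat \<Rightarrow> complex) \<Rightarrow> complex ^ 'm \<Rightarrow> complex ^ 'm) \<Rightarrow> nat \<Rightarrow>
      (nat \<Rightarrow> complex) \<Rightarrow> complex ^ 'm \<Rightarrow> complex ^ 'm" where
  "coeff_last n F p x y = (\<chi> i. (deriv ^^ p) (\<lambda>\<tau>. F (x(n := \<tau>)) y $ i) 0 / fact p)"

text \<open>Taylor coefficients inherit holomorphy in the other variables: by strong induction, the \<open>p\<close>-th one is the
  uniform limit, as \<open>\<tau>\<close> tends to \<open>0\<close>, of the remainder after \<open>p\<close> terms divided by \<open>\<tau> ^ p\<close>.\<close>

lemma param_holo_coeff_last:
  fixes F :: "(nat \<Rightarrow> complex) \<Rightarrow> complex ^ 'm \<Rightarrow> complex ^ 'm"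
  assumes U: "open U" and r: "r > 0" and F: "param_holo (Suc n) r U F"
    and M: "\<And>x y i. (\<forall>l. norm (x l) < r) \<Longrightarrow> y \<in> U \<Longrightarrow> norm (F x y $ i) \<le> M"
  shows "param_holo n r U (coeff_last n F p)"
proof (induction p rule: less_induct)
  case (less p)
  define \<tau> where "\<tau> j = r / 2 * inverse (real (Suc j))" for j
  have \<tau>pos: "\<tau> j > 0" for j using r by (simp add: \<tau>_def)
  have \<tau>le: "\<tau> j \<le> r / 2" for j
    using mult_left_mono[of "inverse (real (Suc j))" 1 "r / 2"] r by (simp add: \<tau>_def inverse_le_1_iff)
  have \<tau>r: "\<tau> j < r" for j using \<tau>le[of j] r by linarith
  define T where "T j = complex_of_real (\<tau> j)" for j
  have nT: "norm (T j) = \<tau> j" for j using \<tau>pos[of j] by (simp add: T_def)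
  define H where "H j x y = (1 / T j ^ p) *s
      (F (x(n := T j)) y - (\<Sum>q<p. T j ^ q *s coeff_last n F q x y))" for j x y
  show ?case
  proof (rule param_holo_limit[OF U])
    show "param_holo n r U (H j)" for j
      unfolding param_holo_def
    proof (intro allI impI conjI ballI)
      fix x :: "nat \<Rightarrow> complex" assume x: "\<forall>l. norm (x l) < r"
      have x': "\<forall>l. norm ((x(n := T j)) l) < r" using x nT \<tau>r by simp
      have "vholo U (F (x(n := T j)))" using F x' by (simp add: param_holo_def)
      moreover have "vholo U (coeff_last n F q x)" if "q < p" for q
        using less[OF that] x by (simp add: param_holo_def)
      ultimately show "vholo U (H j x)"
        unfolding vholo_def H_def by (auto intro!: cdiff_smult cdiff_diff cdiff_sum)
      fix y l i assume y: "y \<in> U" and l: "l < n"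
      have eq: "(\<lambda>\<sigma>. H j (x(l := \<sigma>)) y $ i) = (\<lambda>\<sigma>. (1 / T j ^ p) *
          (F ((x(n := T j))(l := \<sigma>)) y $ i - (\<Sum>q<p. T j ^ q * coeff_last n F q (x(l := \<sigma>)) y $ i)))"
        using l by (simp add: H_def fun_upd_twist diff_divide_distrib)
      have l': "l < Suc n" using l by simp
      have h1: "(\<lambda>\<sigma>. F ((x(n := T j))(l := \<sigma>)) y $ i) holomorphic_on ball 0 r"
        using F x' y l' unfolding param_holo_def by blast
      have h2: "(\<lambda>\<sigma>. coeff_last n F q (x(l := \<sigma>)) y $ i) holomorphic_on ball 0 r" if "q < p" for q
        using less[OF that] x y l by (simp add: param_holo_def)
      show "(\<lambda>\<sigma>. H j (x(l := \<sigma>)) y $ i) holomorphic_on ball 0 r"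
        unfolding eq by (intro holomorphic_intros h1 h2) auto
    qed
    show "(\<lambda>j. 2 * M / r ^ Suc p * \<tau> j) \<longlonglongrightarrow> 0"
    proof -
      have "\<tau> \<longlonglongrightarrow> 0"
        unfolding \<tau>_def by (rule tendsto_mult_right_zero[OF LIMSEQ_inverse_real_of_nat])
      then show ?thesis by (rule tendsto_mult_right_zero)
    qed
    fix j and x :: "nat \<Rightarrow> complex" and y i assume x: "\<forall>l. norm (x l) < r" and y: "y \<in> U"
    let ?\<phi> = "\<lambda>\<tau>. F (x(n := \<tau>)) y $ i"
    have hol: "?\<phi> holomorphic_on ball 0 r"
      using F x y by (simp add: param_holo_def)
    have bd: "norm (?\<phi> s) \<le> M" if "norm s < r" for s
      using x y that by (intro M) auto
    let ?D = "?\<phi> (T j) - (\<Sum>q<Suc p. (deriv ^^ q) ?\<phi> 0 / fact q * T j ^ q)"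
    have "T j \<noteq> 0" using \<tau>pos[of j] by (simp add: T_def)
    then have "H j x y $ i - coeff_last n F p x y $ i = ?D / T j ^ p"
      by (simp add: H_def coeff_last_def divide_simps mult.commute) (simp add: algebra_simps)
    then have "norm (H j x y $ i - coeff_last n F p x y $ i) = norm ?D / \<tau> j ^ p"
      by (simp add: norm_divide norm_power nT)
    also have "norm ?D \<le> 2 * M * (norm (T j) / r) ^ Suc p"
      using nT \<tau>le by (intro holomorphic_taylor_tail[OF hol r bd]) auto
    then have "norm ?D / \<tau> j ^ p \<le> 2 * M * (\<tau> j / r) ^ Suc p / \<tau> j ^ p"
      using \<tau>pos[of j] unfolding nT by (intro divide_right_mono) auto
    also have "\<dots> = 2 * M / r ^ Suc p * \<tau> j"
      using \<tau>pos[of j] by (simp add: power_divide)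
    finally show "norm (H j x y $ i - coeff_last n F p x y $ i) \<le> 2 * M / r ^ Suc p * \<tau> j" .
  qed
qed

text \<open>Induction on the number of variables: expand in the last variable and apply the hypothesis to the
  coefficients, which are again holomorphic and satisfy Cauchy's bound. The iterated sum is a
  sum over multi-indices because everything is dominated by a product of geometric series.\<close>

theorem multivariate_power_series:
  fixes F :: "(nat \<Rightarrow> complex) \<Rightarrow> complex ^ 'm \<Rightarrow> complex ^ 'm"
  assumes U: "open U" and r: "r > 0" and F: "param_holo n r U F"
    and M: "\<And>x y i. (\<forall>l. norm (x l) < r) \<Longrightarrow> y \<in> U \<Longrightarrow> norm (F x y $ i) \<le> M"
  shows "\<exists>c. (\<forall>\<alpha>\<in>indices n. vholo U (c \<alpha>) \<and> (\<forall>y\<in>U. \<forall>i. norm (c \<alpha> y $ i) \<le> M / r ^ (\<Sum>l<n. \<alpha> l))) \<and>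
    (\<forall>x y i. (\<forall>l. norm (x l) < r) \<longrightarrow> (\<forall>l\<ge>n. x l = 0) \<longrightarrow> y \<in> U \<longrightarrow>
       ((\<lambda>\<alpha>. (\<Prod>l<n. x l ^ \<alpha> l) * c \<alpha> y $ i) has_sum F x y $ i) (indices n))"
  using F M
proof (induction n arbitrary: F M)
  case 0
  show ?case
  proof (intro exI[of _ "\<lambda>\<alpha>. F (\<lambda>_. 0)"] conjI ballI allI impI)
    show "vholo U (F (\<lambda>_. 0))" using 0(1) r by (simp add: param_holo_def)
    show "norm (F (\<lambda>_. 0) y $ i) \<le> M / r ^ (\<Sum>l<0. \<alpha> l)" if "y \<in> U" for y i and \<alpha> :: multi_index
      using 0(2)[of "\<lambda>_. 0" y i] that r by simp
    fix x :: "nat \<Rightarrow> complex" and y i assume "\<forall>l\<ge>0. x l = 0"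
    then have "x = (\<lambda>_. 0)" by (simp add: fun_eq_iff)
    then show "((\<lambda>\<alpha>. (\<Prod>l<0. x l ^ \<alpha> l) * F (\<lambda>_. 0) y $ i) has_sum F x y $ i) (indices 0)"
      by (simp add: indices_0 has_sum_finiteI)
  qed
next
  case (Suc n)
  have hol: "(\<lambda>\<tau>. F (x(n := \<tau>)) y $ i) holomorphic_on ball 0 r"
    and bd: "\<And>s. norm s < r \<Longrightarrow> norm (F (x(n := s)) y $ i) \<le> M"
    if "\<forall>l. norm (x l) < r" "y \<in> U" for x y i
    using Suc.prems(1) that by (auto simp: param_holo_def intro!: Suc.prems(2))
  have G_bd: "norm (coeff_last n F p x y $ i) \<le> M / r ^ p"
    if "\<forall>l. norm (x l) < r" "y \<in> U" for p x y i
    unfolding coeff_last_def using holomorphic_coeff_bound[OF hol[OF that] r bd[OF that]] by simp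
  define P where "P p c \<longleftrightarrow> (\<forall>\<alpha>\<in>indices n. vholo U (c \<alpha>) \<and>
        (\<forall>y\<in>U. \<forall>i. norm (c \<alpha> y $ i) \<le> (M / r ^ p) / r ^ (\<Sum>l<n. \<alpha> l))) \<and>
    (\<forall>x y i. (\<forall>l. norm (x l) < r) \<longrightarrow> (\<forall>l\<ge>n. x l = 0) \<longrightarrow> y \<in> U \<longrightarrow>
       ((\<lambda>\<alpha>. (\<Prod>l<n. x l ^ \<alpha> l) * c \<alpha> y $ i) has_sum coeff_last n F p x y $ i) (indices n))" for p c
  have "\<exists>c. P p c" for p
    unfolding P_def using param_holo_coeff_last[OF U r Suc.prems] G_bd by (rule Suc.IH)
  then obtain c where c': "\<And>p. P p (c p)"
    using choice[of P] by blast
  have c: "\<And>p \<alpha>. \<alpha> \<in> indices n \<Longrightarrow> vholo U (c p \<alpha>)"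
    "\<And>p \<alpha> y i. \<alpha> \<in> indices n \<Longrightarrow> y \<in> U \<Longrightarrow> norm (c p \<alpha> y $ i) \<le> (M / r ^ p) / r ^ (\<Sum>l<n. \<alpha> l)"
    "\<And>p x y i. (\<forall>l. norm (x l) < r) \<Longrightarrow> (\<forall>l\<ge>n. x l = 0) \<Longrightarrow> y \<in> U \<Longrightarrow>
       ((\<lambda>\<alpha>. (\<Prod>l<n. x l ^ \<alpha> l) * c p \<alpha> y $ i) has_sum coeff_last n F p x y $ i) (indices n)"
    using c' unfolding P_def by simp_all
  have ind: "\<alpha>(n := 0) \<in> indices n" if "\<alpha> \<in> indices (Suc n)" for \<alpha>
    using that by (auto simp: indices_def Suc_le_eq)
  have sum_eq: "(\<Sum>l<n. (\<alpha>(n := 0)) l) + \<alpha> n = (\<Sum>l<Suc n. \<alpha> l)" for \<alpha> :: multi_index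
    by simp
  show ?case
  proof (intro exI[of _ "\<lambda>\<alpha>. c (\<alpha> n) (\<alpha>(n := 0))"] conjI ballI allI impI)
    fix \<alpha> assume \<alpha>: "\<alpha> \<in> indices (Suc n)"
    show "vholo U (c (\<alpha> n) (\<alpha>(n := 0)))" using c(1)[OF ind[OF \<alpha>]] .
    show "norm (c (\<alpha> n) (\<alpha>(n := 0)) y $ i) \<le> M / r ^ (\<Sum>l<Suc n. \<alpha> l)" if "y \<in> U" for y i
      using c(2)[OF ind[OF \<alpha>] that, of "\<alpha> n" i]
      unfolding sum_eq[symmetric] by (simp add: power_add mult.commute)
  next
    fix x :: "nat \<Rightarrow> complex" and y i
    assume x: "\<forall>l. norm (x l) < r" and x0: "\<forall>l\<ge>Suc n. x l = 0" and y: "y \<in> U"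
    define x' where "x' = x(n := 0)"
    have x': "\<forall>l. norm (x' l) < r" "\<forall>l\<ge>n. x' l = 0"
      using x x0 r by (auto simp: x'_def Suc_le_eq)
    have prod_eq: "(\<Prod>l<n. x' l ^ \<beta> l) = (\<Prod>l<n. x l ^ \<beta> l)" for \<beta> :: multi_index
      by (simp add: x'_def)
    define g where "g p \<beta> = x n ^ p * ((\<Prod>l<n. x l ^ \<beta> l) * c p \<beta> y $ i)" for p \<beta>
    have inner: "(g p has_sum (x n ^ p * coeff_last n F p x' y $ i)) (indices n)" for p
      unfolding g_def using has_sum_cmult_right[OF c(3)[OF x' y]] by (simp only: prod_eq)
    define q where "q l = norm (x l) / r" for l
    have q: "0 \<le> q l" "q l < 1" for l using x r by (auto simp: q_def)
    have gb: "norm (g p \<beta>) \<le> M * (\<Prod>l<Suc n. q l ^ (\<beta>(n := p)) l)" if "\<beta> \<in> indices n" for p \<beta>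
    proof -
      have "norm (g p \<beta>) = norm (x n) ^ p * ((\<Prod>l<n. norm (x l) ^ \<beta> l) * norm (c p \<beta> y $ i))"
        by (simp add: g_def norm_mult norm_power prod_norm[symmetric])
      also have "\<dots> \<le> norm (x n) ^ p * ((\<Prod>l<n. norm (x l) ^ \<beta> l) * ((M / r ^ p) / r ^ (\<Sum>l<n. \<beta> l)))"
        by (intro mult_left_mono c(2) that y prod_nonneg) auto
      also have "\<dots> = M * (\<Prod>l<Suc n. q l ^ (\<beta>(n := p)) l)"
        unfolding prod_upd_Suc q_def power_divide prod_dividef power_sum by simp
      finally show ?thesis .
    qed
    have "(\<lambda>z. norm ((\<lambda>(p, \<beta>). g p \<beta>) z)) summable_on (UNIV \<times> indices n)"
    proof (rule Infinite_Sum.abs_summable_on_comparison_test')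
      have "((\<lambda>\<alpha>. \<Prod>l<Suc n. q l ^ \<alpha> l) has_sum (\<Prod>l<Suc n. 1 / (1 - q l))) (indices (Suc n))"
        using q by (intro has_sum_geometric_indices) auto
      from has_sum_cmult_right[OF this, of M]
      show "(\<lambda>(p, \<beta>). M * (\<Prod>l<Suc n. q l ^ (\<beta>(n := p)) l)) summable_on (UNIV \<times> indices n)"
        unfolding has_sum_indices_Suc_iff by (rule has_sum_imp_summable)
      show "norm ((\<lambda>(p, \<beta>). g p \<beta>) z) \<le> (\<lambda>(p, \<beta>). M * (\<Prod>l<Suc n. q l ^ (\<beta>(n := p)) l)) z"
        if "z \<in> UNIV \<times> indices n" for z
        using that gb by (cases z) (simp del: prod.lessThan_Suc)
    qed
    then have summ: "(\<lambda>(p, \<beta>). g p \<beta>) summable_on (UNIV \<times> indices n)"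
      by (rule Infinite_Sum.abs_summable_summable)
    have "((\<lambda>p. x n ^ p * coeff_last n F p x' y $ i) has_sum F x y $ i) UNIV"
    proof (rule norm_summable_imp_has_sum)
      have xn: "norm (x n) < r" using x by simp
      have "(\<lambda>p. (deriv ^^ p) (\<lambda>\<tau>. F (x'(n := \<tau>)) y $ i) 0 / fact p * (x n - 0) ^ p) sums
              F (x'(n := x n)) y $ i"
        using xn by (intro holomorphic_power_series[OF hol[OF x'(1) y]]) auto
      moreover have "x'(n := x n) = x" by (auto simp: x'_def)
      ultimately show "(\<lambda>p. x n ^ p * coeff_last n F p x' y $ i) sums (F x y $ i)"
        by (simp add: coeff_last_def mult.commute)
      show "summable (\<lambda>p. norm (x n ^ p * coeff_last n F p x' y $ i))"
      proof (rule summable_comparison_test')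
        show "summable (\<lambda>p. M * q n ^ p)"
          using q by (intro summable_mult summable_geometric) auto
        show "norm (norm (x n ^ p * coeff_last n F p x' y $ i)) \<le> M * q n ^ p" if "p \<ge> 0" for p
        proof -
          have "norm (x n ^ p * coeff_last n F p x' y $ i) \<le> norm (x n) ^ p * (M / r ^ p)"
            unfolding norm_mult norm_power by (intro mult_left_mono G_bd x' y) auto
          then show ?thesis by (simp add: q_def power_divide mult.commute)
        qed
      qed
    qed
    then have "((\<lambda>(p, \<beta>). g p \<beta>) has_sum F x y $ i) (UNIV \<times> indices n)"
      by (intro has_sum_SigmaI[OF _ _ summ]) (use inner in auto)
    moreover have "(\<lambda>(p, \<beta>). (\<Prod>l<Suc n. x l ^ (\<beta>(n := p)) l) *
          c ((\<beta>(n := p)) n) ((\<beta>(n := p))(n := 0)) y $ i) z = (\<lambda>(p, \<beta>). g p \<beta>) z"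
      if zin: "z \<in> UNIV \<times> indices n" for z
    proof -
      obtain p \<beta> where z: "z = (p, \<beta>)" "\<beta> \<in> indices n" using zin by auto
      have "\<beta>(n := 0) = \<beta>" using z(2) by (auto simp: indices_def)
      then show ?thesis unfolding z prod_upd_Suc g_def by (simp add: mult.assoc)
    qed
    ultimately show "((\<lambda>\<alpha>. (\<Prod>l<Suc n. x l ^ \<alpha> l) * c (\<alpha> n) (\<alpha>(n := 0)) y $ i) has_sum F x y $ i)
        (indices (Suc n))"
      unfolding has_sum_indices_Suc_iff by (subst has_sum_cong) auto
  qed
qed

lemma real_power_series_eq_0:
  fixes b :: "nat \<Rightarrow> real"
  assumes r: "r > 0" and s: "\<And>t. \<bar>t\<bar> < r \<Longrightarrow> (\<lambda>p. b p * t ^ p) sums 0"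
  shows "b p = 0"
proof (cases "p = 0")
  case True
  have "(\<lambda>p. b p * 0 ^ p) sums b 0" using powser_sums_zero[of b] by simp
  moreover have "(\<lambda>p. b p * 0 ^ p) sums 0" using s[of 0] r by simp
  ultimately show ?thesis using sums_unique2 True by blast
next
  case False
  show ?thesis
  proof (rule ccontr)
    assume "b p \<noteq> 0"
    show False
    proof (rule powser_0_nonzero[of r 0 b "\<lambda>_. 0" p])
      fix e :: real assume "0 < e" and e: "\<And>z. z \<in> cball (0::real) e - {0} \<Longrightarrow> (0::real) \<noteq> 0"
      then show False using e[of e] by auto
    qed (use r s False \<open>b p \<noteq> 0\<close> in auto)
  qed
qed

text \<open>For fixed values of the other variables the sum is a power series in the last one that vanishes near \<open>0\<close>;
  so its coefficients vanish, and these are power series in fewer variables. Real arguments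
  suffice, which is what the defining property of the step coefficients provides.\<close>

theorem multivariate_power_series_unique:
  fixes c :: "multi_index \<Rightarrow> real"
  assumes r: "r > 0"
    and s: "\<And>x. (\<forall>l. \<bar>x l\<bar> < r) \<Longrightarrow> ((\<lambda>\<alpha>. (\<Prod>l<n. x l ^ \<alpha> l) * c \<alpha>) has_sum 0) (indices n)"
    and "\<alpha> \<in> indices n"
  shows "c \<alpha> = 0"
  using s assms(3)
proof (induction n arbitrary: c \<alpha>)
  case 0
  have "((\<lambda>\<alpha>. (\<Prod>l<0. (0::real) ^ \<alpha> l) * c \<alpha>) has_sum 0) (indices 0)"
    using 0(1)[of "\<lambda>_. 0"] r by simp
  moreover have "((\<lambda>\<alpha>. (\<Prod>l<0. (0::real) ^ \<alpha> l) * c \<alpha>) has_sum (c (\<lambda>_. 0))) (indices 0)"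
    by (simp add: indices_0 has_sum_finiteI)
  ultimately have "c (\<lambda>_. 0) = 0" by (metis has_sum_unique)
  then show ?case using 0(2) by (simp add: indices_0)
next
  case (Suc n)
  have inner0: "((\<lambda>\<beta>. (\<Prod>l<n. x l ^ \<beta> l) * c (\<beta>(n := p))) has_sum 0) (indices n)"
    if x: "\<forall>l. \<bar>x l\<bar> < r" for x p
  proof -
    have big: "((\<lambda>(p, \<beta>). t ^ p * ((\<Prod>l<n. x l ^ \<beta> l) * c (\<beta>(n := p)))) has_sum 0) (UNIV \<times> indices n)"
      if t: "\<bar>t\<bar> < r" for t
    proof -
      have eq: "(\<Prod>l<Suc n. (x(n := t)) l ^ (\<beta>(n := p)) l) = t ^ p * (\<Prod>l<n. x l ^ \<beta> l)" for \<beta> p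
        unfolding prod_upd_Suc by simp
      have "\<forall>l. \<bar>(x(n := t)) l\<bar> < r" using x t by simp
      from Suc.prems(1)[OF this] show ?thesis
        unfolding has_sum_indices_Suc_iff eq by (simp add: mult.assoc)
    qed
    have summ: "(\<lambda>\<beta>. (\<Prod>l<n. x l ^ \<beta> l) * c (\<beta>(n := p))) summable_on (indices n)" for p
    proof -
      have r2: "r / 2 > 0" "\<bar>r / 2\<bar> < r" using r by auto
      from summable_on_SigmaD1[OF has_sum_imp_summable[OF big[OF r2(2)]], of p]
      have "(\<lambda>\<beta>. (r / 2) ^ p * ((\<Prod>l<n. x l ^ \<beta> l) * c (\<beta>(n := p)))) summable_on (indices n)"
        by simp
      from summable_on_cmult_right[OF this, of "1 / (r / 2) ^ p"] show ?thesis
        using r2(1) by simp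
    qed
    let ?b = "\<lambda>p. infsum (\<lambda>\<beta>. (\<Prod>l<n. x l ^ \<beta> l) * c (\<beta>(n := p))) (indices n)"
    have "(\<lambda>p. ?b p * t ^ p) sums 0" if t: "\<bar>t\<bar> < r" for t
    proof -
      have "((\<lambda>p. t ^ p * ?b p) has_sum 0) UNIV"
        by (rule has_sum_SigmaD[OF big[OF t]])
           (use has_sum_cmult_right[OF has_sum_infsum[OF summ]] in auto)
      then show ?thesis by (intro has_sum_imp_sums) (simp add: mult.commute)
    qed
    then have "?b p = 0" by (rule real_power_series_eq_0[OF r])
    then show ?thesis using has_sum_infsum[OF summ[of p]] by simp
  qed
  have "c ((\<alpha>(n := 0))(n := \<alpha> n)) = 0"
  proof (rule Suc.IH[of "\<lambda>\<beta>. c (\<beta>(n := \<alpha> n))" "\<alpha>(n := 0)"])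
    show "((\<lambda>\<beta>. (\<Prod>l<n. x l ^ \<beta> l) * c (\<beta>(n := \<alpha> n))) has_sum 0) (indices n)"
      if "\<forall>l. \<bar>x l\<bar> < r" for x
      using inner0[OF that] .
    show "\<alpha>(n := 0) \<in> indices n" using Suc.prems(2) by (auto simp: indices_def Suc_le_eq)
  qed
  then show ?case by simp
qed

lemma geometric_steps_tendsto:
  fixes u :: "nat \<Rightarrow> 'a::banach"
  assumes "\<And>n. norm (u (Suc n) - u n) \<le> K * (1/2) ^ n"
  shows "u \<longlonglongrightarrow> lim u"
proof -
  have "summable (\<lambda>n. u (Suc n) - u n)"
    by (rule summable_comparison_test'[where N = 0 and g = "\<lambda>n. K * (1/2) ^ n"])
       (use assms in \<open>auto intro!: summable_mult summable_geometric\<close>)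
  then have "convergent (\<lambda>n. \<Sum>k<n. u (Suc k) - u k)" by (simp add: summable_iff_convergent)
  then have "convergent (\<lambda>n. u n - u 0)" by (simp only: sum_lessThan_telescope[of u])
  then have "convergent (\<lambda>n. u n - u 0 + u 0)" by (intro convergent_add convergent_const)
  then show ?thesis by (simp add: convergent_LIMSEQ_iff)
qed

section \<open>Analyticity of the Runge--Kutta step\<close>

lemma holomorphic_vec_compose:
  fixes K :: "complex \<Rightarrow> complex ^ 'm"
  assumes K: "\<And>i. (\<lambda>\<tau>. K \<tau> $ i) holomorphic_on S" and S: "open S"
    and g: "\<And>\<tau>. \<tau> \<in> S \<Longrightarrow> cdiff g (K \<tau>)"
  shows "(\<lambda>\<tau>. g (K \<tau>) $ i) holomorphic_on S"
proof -
  have "\<exists>D. ((\<lambda>\<tau>. g (K \<tau>) $ i) has_field_derivative D) (at \<tau>)" if \<tau>: "\<tau> \<in> S" for \<tau>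
  proof -
    define k where "k = (\<chi> i. deriv (\<lambda>\<tau>. K \<tau> $ i) \<tau>)"
    have "((\<lambda>\<tau>. K \<tau> $ i) has_derivative (\<lambda>t. (t *s k) $ i)) (at \<tau>)" for i
      using holomorphic_derivI[OF K S \<tau>, of i]
      by (simp add: has_field_derivative_def k_def mult.commute[of _ "deriv _ _"] mult_commute_abs)
    then have "(K has_derivative (\<lambda>t. t *s k)) (at \<tau>)"
      by (subst has_derivative_componentwise_within)
         (auto simp: Basis_vec_def inner_axis intro!: has_derivative_inner_left)
    from has_derivative_compose[OF this cdiff_frechet(1)[OF g[OF \<tau>]]]
    have "((\<lambda>\<tau>. g (K \<tau>) $ i) has_derivative
            (\<lambda>t. frechet_derivative g (at (K \<tau>)) (t *s k) $ i)) (at \<tau>)"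
      by (rule bounded_linear.has_derivative[OF bounded_linear_vec_nth])
    moreover have "(\<lambda>t. frechet_derivative g (at (K \<tau>)) (t *s k) $ i)
        = (*) (frechet_derivative g (at (K \<tau>)) k $ i)"
      using cdiff_frechet(2)[OF g[OF \<tau>]] by (auto simp: mult.commute)
    ultimately show ?thesis by (auto simp: has_field_derivative_def)
  qed
  then show ?thesis
    unfolding holomorphic_on_def field_differentiable_def using has_field_derivative_at_within by blast
qed

text \<open>The starting point itself, regarded as a function of increments and starting point.\<close>

lemma param_holo_point: "param_holo n r U (\<lambda>x y. y)"
  by (auto simp: param_holo_def vholo_def intro: cdiff_id)

lemma param_holo_add:
  "param_holo n r U F \<Longrightarrow> param_holo n r U G \<Longrightarrow> param_holo n r U (\<lambda>x y. F x y + G x y)"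
  by (auto simp: param_holo_def vholo_def intro!: cdiff_add holomorphic_intros)

lemma param_holo_scaleR:
  "param_holo n r U F \<Longrightarrow> param_holo n r U (\<lambda>x y. q *\<^sub>R F x y)"
  by (auto simp: param_holo_def vholo_def scaleR_conv_of_real[where 'a = complex]
      intro!: cdiff_scaleR holomorphic_intros)

lemma param_holo_sum:
  "(\<And>j. j \<in> A \<Longrightarrow> param_holo n r U (F j)) \<Longrightarrow> param_holo n r U (\<lambda>x y. \<Sum>j\<in>A. F j x y)"
  by (auto simp: param_holo_def vholo_def intro!: cdiff_sum holomorphic_intros)

lemma param_holo_coord:
  assumes "param_holo n r U F"
  shows "param_holo n r U (\<lambda>x y. x l *s F x y)"
proof -
  have "(\<lambda>\<tau>. (x(l' := \<tau>)) l) holomorphic_on S" for x :: "nat \<Rightarrow> complex" and l' S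
    by (cases "l = l'") (auto intro: holomorphic_intros)
  then show ?thesis
    using assms by (auto simp: param_holo_def vholo_def simp del: fun_upd_apply
        intro!: cdiff_smult holomorphic_on_mult)
qed

lemma param_holo_compose:
  assumes "param_holo n r U F" "vholo W g"
    "\<And>x y. (\<forall>l. norm (x l) < r) \<Longrightarrow> y \<in> U \<Longrightarrow> F x y \<in> W"
  shows "param_holo n r U (\<lambda>x y. g (F x y))"
  unfolding param_holo_def
proof (intro allI impI conjI ballI)
  fix x :: "nat \<Rightarrow> complex" assume x: "\<forall>l. norm (x l) < r"
  show "vholo U (\<lambda>y. g (F x y))"
    unfolding vholo_def
  proof
    fix y assume y: "y \<in> U"
    have "vholo U (F x)" using assms(1) x by (simp add: param_holo_def)
    from vholoD[OF this y] vholoD[OF assms(2) assms(3)[OF x y]]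
    show "cdiff (\<lambda>y. g (F x y)) y" by (rule cdiff_compose)
  qed
  fix y and l :: nat and i assume y: "y \<in> U" "l < n"
  show "(\<lambda>\<tau>. g (F (x(l := \<tau>)) y) $ i) holomorphic_on ball 0 r"
  proof (rule holomorphic_vec_compose[where K = "\<lambda>\<tau>. F (x(l := \<tau>)) y" and g = g, OF _ open_ball])
    show "(\<lambda>\<tau>. F (x(l := \<tau>)) y $ j) holomorphic_on ball 0 r" for j
      using assms(1) x y by (simp add: param_holo_def)
    show "cdiff g (F (x(l := \<tau>)) y)" if "\<tau> \<in> ball 0 r" for \<tau>
      using that x y by (intro vholoD[OF assms(2) assms(3)]) auto
  qed
qed

lemma has_sum_vec:
  fixes f :: "'b \<Rightarrow> complex ^ 'm"
  assumes "\<And>i. ((\<lambda>x. f x $ i) has_sum (S $ i)) A"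
  shows "(f has_sum S) A"
  using assms unfolding has_sum_def by (intro vec_tendstoI) (simp add: sum_component)

text \<open>The method with vector fields bounded and holomorphic on a ball of radius \<open>2 * R\<close>. Steps are started in the ball
  of radius \<open>R\<close>, the stages stay in the ball of radius \<open>3 * R / 2\<close>, and the remaining \<open>R / 2\<close> is
  the room for Cauchy's estimate.\<close>

locale analytic_rk =
  fixes d s :: nat and a :: "nat \<Rightarrow> nat \<Rightarrow> real" and b :: "nat \<Rightarrow> real"
    and V :: "nat \<Rightarrow> complex ^ 'm \<Rightarrow> complex ^ 'm" and c :: "complex ^ 'm" and R M :: real
  assumes R: "R > 0" and M: "M > 0"
    and V_holo: "\<And>l. l \<le> d \<Longrightarrow> vholo (cball c (2 * R)) (V l)"
    and V_bound: "\<And>l y. l \<le> d \<Longrightarrow> y \<in> cball c (2 * R) \<Longrightarrow> norm (V l y) \<le> M"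
begin

definition coeff_size :: real where
  "coeff_size = 1 + (\<Sum>i=1..s. \<Sum>j=1..s. \<bar>a i j\<bar>) + (\<Sum>i=1..s. \<bar>b i\<bar>)"

definition lip :: real where
  "lip = real CARD('m) * M / (R / 2)"

text \<open>Increments below this size move each stage by at most \<open>R / 2\<close> (first entry) and make the stage equations a
  contraction with factor \<open>1/2\<close> (second entry).\<close>

definition radius :: real where
  "radius = min (R / (2 * (real (Suc d) * coeff_size * M))) (1 / (2 * (real (Suc d) * coeff_size * lip)))"

definition incr :: "(nat \<Rightarrow> complex) \<Rightarrow> complex ^ 'm \<Rightarrow> complex ^ 'm" where
  "incr x v = (\<Sum>l<Suc d. x l *s V l v)"

definition stage_map where
  "stage_map x y K i = y + (\<Sum>j=1..s. a i j *\<^sub>R incr x (K j))"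

primrec stage_iter where
  "stage_iter x y 0 = (\<lambda>i. y)"
| "stage_iter x y (Suc p) = stage_map x y (stage_iter x y p)"

lemma coeff_size_ge: "coeff_size \<ge> 1"
  "i \<in> {1..s} \<Longrightarrow> (\<Sum>j=1..s. \<bar>a i j\<bar>) \<le> coeff_size" "(\<Sum>i=1..s. \<bar>b i\<bar>) \<le> coeff_size"
proof -
  have n: "0 \<le> (\<Sum>i=1..s. \<Sum>j=1..s. \<bar>a i j\<bar>)" "0 \<le> (\<Sum>i=1..s. \<bar>b i\<bar>)"
    by (intro sum_nonneg abs_ge_zero)+
  then show "coeff_size \<ge> 1" "(\<Sum>i=1..s. \<bar>b i\<bar>) \<le> coeff_size"
    by (auto simp: coeff_size_def)
  assume "i \<in> {1..s}"
  then have "(\<Sum>j=1..s. \<bar>a i j\<bar>) \<le> (\<Sum>i=1..s. \<Sum>j=1..s. \<bar>a i j\<bar>)"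
    by (intro member_le_sum[of i "{1..s}" "\<lambda>i. \<Sum>j=1..s. \<bar>a i j\<bar>"]) (auto intro: sum_nonneg)
  with n show "(\<Sum>j=1..s. \<bar>a i j\<bar>) \<le> coeff_size" unfolding coeff_size_def by linarith
qed

lemma lip_pos: "lip > 0" using R M by (simp add: lip_def)

lemma radius_pos: "radius > 0"
  using R M lip_pos coeff_size_ge(1) by (auto simp: radius_def intro!: mult_pos_pos divide_pos_pos)

lemma radius_le: "coeff_size * (real (Suc d) * radius * M) \<le> R / 2"
  "coeff_size * (real (Suc d) * radius * lip) \<le> 1 / 2"
proof -
  let ?A = "real (Suc d) * coeff_size * M" and ?B = "real (Suc d) * coeff_size * lip"
  have quot: "A * (q / (2 * A)) = q / 2" if "A > 0" for A q :: real using that by simp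
  have A: "?A > 0" "?B > 0" using M lip_pos coeff_size_ge(1) by (auto intro!: mult_pos_pos)
  have "?A * radius \<le> ?A * (R / (2 * ?A))"
    using A by (intro mult_left_mono) (auto simp: radius_def)
  also have "\<dots> = R / 2" using A(1) by (rule quot)
  finally show "coeff_size * (real (Suc d) * radius * M) \<le> R / 2" by (simp add: mult_ac)
  have "?B * radius \<le> ?B * (1 / (2 * ?B))"
    using A by (intro mult_left_mono) (auto simp: radius_def)
  also have "\<dots> = 1 / 2" using A(2) by (rule quot)
  finally show "coeff_size * (real (Suc d) * radius * lip) \<le> 1 / 2" by (simp add: mult_ac)
qed

lemma incr_bound:
  assumes "\<forall>l. norm (x l) < radius" "v \<in> cball c (2 * R)"
  shows "norm (incr x v) \<le> real (Suc d) * radius * M"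
proof -
  have "norm (incr x v) \<le> (\<Sum>l<Suc d. norm (x l) * norm (V l v))"
    unfolding incr_def norm_vector_smult[symmetric] by (rule norm_sum)
  also have "\<dots> \<le> (\<Sum>l<Suc d. radius * M)"
    using assms M radius_pos by (intro sum_mono mult_mono V_bound) (auto simp: less_imp_le)
  finally show ?thesis by simp
qed

text \<open>Each point of the smaller ball is at distance at least \<open>R / 2\<close> from the boundary of the larger one, so \<open>lip\<close> bounds
  the derivative there.\<close>

lemma V_lipschitz:
  assumes "l \<le> d" "v \<in> cball c (3 * R / 2)" "w \<in> cball c (3 * R / 2)"
  shows "norm (V l v - V l w) \<le> lip * norm (v - w)"
proof (rule differentiable_bound[where S = "cball c (3 * R / 2)" and f' = "\<lambda>x. frechet_derivative (V l) (at x)"])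
  fix x assume x: "x \<in> cball c (3 * R / 2)"
  have sub: "w \<in> cball c (2 * R)" if "w \<in> ball x (R / 2)" for w
  proof -
    have "dist c w \<le> dist c x + dist x w" by (rule dist_triangle)
    with x that show ?thesis by simp
  qed
  have "x \<in> cball c (2 * R)" using x R by simp
  then have cd: "cdiff (V l) x"
    using V_holo[OF assms(1)] vholoD by blast
  then show "(V l has_derivative frechet_derivative (V l) (at x)) (at x within cball c (3 * R / 2))"
    using cdiff_frechet(1) has_derivative_at_withinI by blast
  have "norm (frechet_derivative (V l) (at x) u) \<le> lip * norm u" for u
  proof -
    have "norm (frechet_derivative (V l) (at x) u) \<le> real CARD('m) * M * norm u / (R / 2)"
      using V_holo[OF assms(1)] R sub V_bound[OF assms(1)]
      by (intro frechet_derivative_bound vholo_subset[of _ "V l" "ball x (R/2)"]) auto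
    then show ?thesis by (simp add: lip_def mult_ac)
  qed
  then show "onorm (frechet_derivative (V l) (at x)) \<le> lip"
    by (rule onorm_le)
qed (use assms in auto)

lemma incr_lipschitz:
  assumes "\<forall>l. norm (x l) < radius" "v \<in> cball c (3 * R / 2)" "w \<in> cball c (3 * R / 2)"
  shows "norm (incr x v - incr x w) \<le> real (Suc d) * radius * lip * norm (v - w)"
proof -
  have "incr x v - incr x w = (\<Sum>l<Suc d. x l *s (V l v - V l w))"
    unfolding incr_def sum_subtractf[symmetric]
    by (intro sum.cong) (auto simp: vec_eq_iff algebra_simps)
  then have "norm (incr x v - incr x w) \<le> (\<Sum>l<Suc d. norm (x l) * norm (V l v - V l w))"
    unfolding norm_vector_smult[symmetric] by (simp only: norm_sum)
  also have "\<dots> \<le> (\<Sum>l<Suc d. radius * (lip * norm (v - w)))"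
    using assms radius_pos by (intro sum_mono mult_mono V_lipschitz) (auto simp: less_imp_le)
  finally show ?thesis by (simp add: mult_ac)
qed

lemma weighted_sum_bound:
  assumes "\<And>j. j \<in> {1..s} \<Longrightarrow> norm (u j) \<le> B" "(\<Sum>j=1..s. \<bar>q j\<bar>) \<le> coeff_size" "B \<ge> 0"
  shows "norm (\<Sum>j=1..s. q j *\<^sub>R u j) \<le> coeff_size * B"
proof -
  have "norm (\<Sum>j=1..s. q j *\<^sub>R u j) \<le> (\<Sum>j=1..s. \<bar>q j\<bar> * B)"
    using assms by (intro sum_norm_le) (auto intro: mult_left_mono)
  also have "\<dots> \<le> coeff_size * B"
    unfolding sum_distrib_right[symmetric] using assms by (intro mult_right_mono)
  finally show ?thesis .
qed

lemma weighted_incr_bound: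
  assumes "\<forall>l. norm (x l) < radius" "\<And>j. j \<in> {1..s} \<Longrightarrow> K j \<in> cball c (2 * R)"
    "(\<Sum>j=1..s. \<bar>q j\<bar>) \<le> coeff_size"
  shows "norm (\<Sum>j=1..s. q j *\<^sub>R incr x (K j)) \<le> R / 2"
proof -
  have "norm (\<Sum>j=1..s. q j *\<^sub>R incr x (K j)) \<le> coeff_size * (real (Suc d) * radius * M)"
    using assms M radius_pos by (intro weighted_sum_bound incr_bound) auto
  then show ?thesis using radius_le(1) by linarith
qed

lemma stage_map_bound:
  assumes "\<forall>l. norm (x l) < radius" "\<And>j. j \<in> {1..s} \<Longrightarrow> K j \<in> cball c (2 * R)" "i \<in> {1..s}"
  shows "norm (stage_map x y K i - y) \<le> R / 2"
  using weighted_incr_bound[OF assms(1,2) coeff_size_ge(2)[OF assms(3)]] by (simp add: stage_map_def)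

lemma stage_map_contraction:
  assumes "\<forall>l. norm (x l) < radius"
    and "\<And>j. j \<in> {1..s} \<Longrightarrow> K j \<in> cball c (3 * R / 2)" "\<And>j. j \<in> {1..s} \<Longrightarrow> K' j \<in> cball c (3 * R / 2)"
    and "\<And>j. j \<in> {1..s} \<Longrightarrow> norm (K j - K' j) \<le> B" "B \<ge> 0" "i \<in> {1..s}"
  shows "norm (stage_map x y K i - stage_map x y K' i) \<le> B / 2"
proof -
  have "stage_map x y K i - stage_map x y K' i = (\<Sum>j=1..s. a i j *\<^sub>R (incr x (K j) - incr x (K' j)))"
    by (simp add: stage_map_def sum_subtractf scaleR_right_diff_distrib)
  also have "norm \<dots> \<le> coeff_size * (real (Suc d) * radius * lip * B)"
  proof (intro weighted_sum_bound coeff_size_ge(2) assms)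
    fix j assume j: "j \<in> {1..s}"
    have "norm (incr x (K j) - incr x (K' j)) \<le> real (Suc d) * radius * lip * norm (K j - K' j)"
      using j assms by (intro incr_lipschitz) auto
    also have "\<dots> \<le> real (Suc d) * radius * lip * B"
      using radius_pos lip_pos j assms(4) by (intro mult_left_mono) auto
    finally show "norm (incr x (K j) - incr x (K' j)) \<le> real (Suc d) * radius * lip * B" .
  qed (use radius_pos lip_pos assms in auto)
  also have "\<dots> = coeff_size * (real (Suc d) * radius * lip) * B" by simp
  also have "\<dots> \<le> 1 / 2 * B" using radius_le(2) assms(5) by (intro mult_right_mono) auto
  finally show ?thesis by simp
qed

text \<open>Whatever lies within \<open>R / 2\<close> of an admissible starting point is inside the ball on which the contraction
  estimate holds.\<close>

lemma near_start:
  assumes "y \<in> ball c R" "norm (v - y) \<le> R / 2"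
  shows "v \<in> cball c (3 * R / 2)" "v \<in> cball c (2 * R)"
proof -
  have "dist c v \<le> dist c y + dist y v" by (rule dist_triangle)
  then have "dist c v \<le> 3 * R / 2" using assms by (simp add: dist_norm norm_minus_commute)
  then show "v \<in> cball c (3 * R / 2)" "v \<in> cball c (2 * R)" using R by auto
qed

lemma stage_iter_near:
  assumes "\<forall>l. norm (x l) < radius" "y \<in> ball c R"
  shows "i \<in> {1..s} \<Longrightarrow> norm (stage_iter x y p i - y) \<le> R / 2"
proof (induction p arbitrary: i)
  case 0
  then show ?case using R by simp
next
  case (Suc p)
  show ?case
    unfolding stage_iter.simps
    using Suc near_start(2)[OF assms(2)] by (intro stage_map_bound assms) auto
qed

lemma stage_iter_step:
  assumes x: "\<forall>l. norm (x l) < radius" and y: "y \<in> ball c R"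
  shows "i \<in> {1..s} \<Longrightarrow> norm (stage_iter x y (Suc p) i - stage_iter x y p i) \<le> R * (1/2) ^ Suc p"
proof (induction p arbitrary: i)
  case 0
  then show ?case using stage_iter_near[OF x y, of i 1] by simp
next
  case (Suc p)
  have "norm (stage_map x y (stage_iter x y (Suc p)) i - stage_map x y (stage_iter x y p) i)
      \<le> (R * (1/2) ^ Suc p) / 2"
  proof (rule stage_map_contraction[OF x])
    show "stage_iter x y (Suc p) j \<in> cball c (3 * R / 2)" "stage_iter x y p j \<in> cball c (3 * R / 2)"
      if "j \<in> {1..s}" for j
      using near_start(1)[OF y stage_iter_near[OF x y that]] by blast+
  qed (use Suc R in auto)
  then show ?case by simp
qed

text \<open>Any solution of the stage equations attracts the iterates at a rate independent of the
  solution. This gives both uniqueness of the stages and uniform convergence.\<close>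

lemma fixed_point_near_iter:
  assumes x: "\<forall>l. norm (x l) < radius" and y: "y \<in> ball c R"
    and K: "\<And>j. j \<in> {1..s} \<Longrightarrow> K j \<in> cball c (2 * R)"
      "\<And>j. j \<in> {1..s} \<Longrightarrow> K j = stage_map x y K j"
  shows "i \<in> {1..s} \<Longrightarrow> norm (stage_iter x y p i - K i) \<le> R * (1/2) ^ p"
proof (induction p arbitrary: i)
  case 0
  have "norm (stage_map x y K i - y) \<le> R / 2"
    using K 0 by (intro stage_map_bound x) auto
  then show ?case using K(2)[OF 0] R by (simp add: norm_minus_commute)
next
  case (Suc p)
  have "norm (stage_map x y (stage_iter x y p) i - stage_map x y K i) \<le> (R * (1/2) ^ p) / 2"
  proof (rule stage_map_contraction[OF x])
    fix j assume j: "j \<in> {1..s}"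
    show "stage_iter x y p j \<in> cball c (3 * R / 2)"
      by (rule near_start(1)[OF y stage_iter_near[OF x y j]])
    have "norm (stage_map x y K j - y) \<le> R / 2" using K j by (intro stage_map_bound x) auto
    then show "K j \<in> cball c (3 * R / 2)" using K(2)[OF j] near_start(1)[OF y] by simp
  qed (use Suc R in auto)
  then show ?case using K(2)[OF Suc.prems] by simp
qed

definition stage where "stage x y i = lim (\<lambda>p. stage_iter x y p i)"

lemma stage_iter_tendsto:
  assumes x: "\<forall>l. norm (x l) < radius" and y: "y \<in> ball c R" and i: "i \<in> {1..s}"
  shows "(\<lambda>p. stage_iter x y p i) \<longlonglongrightarrow> stage x y i"
  unfolding stage_def
  by (rule geometric_steps_tendsto[where K = "R * (1/2)"]) (use stage_iter_step[OF x y i] in simp)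

lemma stage_near:
  assumes x: "\<forall>l. norm (x l) < radius" and y: "y \<in> ball c R" and i: "i \<in> {1..s}"
  shows "norm (stage x y i - y) \<le> R / 2"
  by (rule LIMSEQ_le_const2[OF tendsto_norm[OF tendsto_diff[OF stage_iter_tendsto[OF x y i] tendsto_const]]])
     (use stage_iter_near[OF x y i] in auto)

text \<open>Passing to the limit in the iteration, by continuity of the vector fields.\<close>

lemma stage_fixed_point:
  assumes x: "\<forall>l. norm (x l) < radius" and y: "y \<in> ball c R" and i: "i \<in> {1..s}"
  shows "stage x y i = stage_map x y (stage x y) i"
proof (rule LIMSEQ_unique)
  show "(\<lambda>p. stage_iter x y (Suc p) i) \<longlonglongrightarrow> stage x y i"
    by (rule LIMSEQ_Suc[OF stage_iter_tendsto[OF assms]])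
  have "(\<lambda>p. incr x (stage_iter x y p j)) \<longlonglongrightarrow> incr x (stage x y j)" if j: "j \<in> {1..s}" for j
    unfolding incr_def
  proof (intro tendsto_sum bounded_linear.tendsto[OF bounded_linear_smult_right])
    fix l assume "l \<in> {..<Suc d}"
    then have "cdiff (V l) (stage x y j)"
      using near_start(2)[OF y stage_near[OF x y j]] by (intro vholoD[OF V_holo]) auto
    from isCont_tendsto_compose[OF cdiff_continuous[OF this] stage_iter_tendsto[OF x y j]]
    show "(\<lambda>p. V l (stage_iter x y p j)) \<longlonglongrightarrow> V l (stage x y j)" .
  qed
  then show "(\<lambda>p. stage_iter x y (Suc p) i) \<longlonglongrightarrow> stage_map x y (stage x y) i"
    unfolding stage_iter.simps stage_map_def
    by (intro tendsto_add tendsto_const tendsto_sum tendsto_scaleR)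
qed

lemma fixed_point_unique:
  assumes x: "\<forall>l. norm (x l) < radius" and y: "y \<in> ball c R"
    and K: "\<And>j. j \<in> {1..s} \<Longrightarrow> K j \<in> cball c (2 * R)"
      "\<And>j. j \<in> {1..s} \<Longrightarrow> K j = stage_map x y K j" and i: "i \<in> {1..s}"
  shows "K i = stage x y i"
proof (rule LIMSEQ_unique)
  show "(\<lambda>p. stage_iter x y p i) \<longlonglongrightarrow> stage x y i" by (rule stage_iter_tendsto[OF x y i])
  have z: "(\<lambda>p. R * (1/2) ^ p) \<longlonglongrightarrow> 0"
    by (intro tendsto_mult_right_zero LIMSEQ_power_zero) auto
  have "(\<lambda>p. stage_iter x y p i - K i) \<longlonglongrightarrow> 0"
    using fixed_point_near_iter[OF x y K i] by (intro Lim_null_comparison[OF _ z]) auto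
  then show "(\<lambda>p. stage_iter x y p i) \<longlonglongrightarrow> K i" by (simp add: LIM_zero_iff)
qed

lemma stage_map_param_holo:
  assumes "\<And>j. j \<in> {1..s} \<Longrightarrow> param_holo n radius (ball c R) (\<lambda>x y. K x y j)"
    and "\<And>j x y. j \<in> {1..s} \<Longrightarrow> (\<forall>l. norm (x l) < radius) \<Longrightarrow> y \<in> ball c R \<Longrightarrow> K x y j \<in> cball c (2 * R)"
  shows "param_holo n radius (ball c R) (\<lambda>x y. \<Sum>j=1..s. q j *\<^sub>R incr x (K x y j))"
  unfolding incr_def
proof (intro param_holo_sum param_holo_scaleR param_holo_coord)
  fix j l assume j: "j \<in> {1..s}" and l: "l \<in> {..<Suc d}"
  then have l': "l \<le> d" by simp
  show "param_holo n radius (ball c R) (\<lambda>x y. V l (K x y j))"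
    by (rule param_holo_compose[OF assms(1)[OF j] V_holo[OF l'] assms(2)[OF j]])
qed

lemma stage_iter_param_holo:
  "i \<in> {1..s} \<Longrightarrow> param_holo n radius (ball c R) (\<lambda>x y. stage_iter x y p i)"
proof (induction p arbitrary: i)
  case 0
  show ?case by (simp add: param_holo_point)
next
  case (Suc p)
  show ?case
    unfolding stage_iter.simps stage_map_def
  proof (rule param_holo_add[OF param_holo_point], rule stage_map_param_holo)
    show "param_holo n radius (ball c R) (\<lambda>x y. stage_iter x y p j)" if "j \<in> {1..s}" for j
      by (rule Suc.IH[OF that])
    show "stage_iter x y p j \<in> cball c (2 * R)"
      if "j \<in> {1..s}" "\<forall>l. norm (x l) < radius" "y \<in> ball c R" for j x y
      by (rule near_start(2)[OF that(3) stage_iter_near[OF that(2,3,1)]])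
  qed
qed

text \<open>The iterates are holomorphic as compositions and sums, and they converge uniformly in increments and starting
  point.\<close>

lemma stage_param_holo:
  assumes i: "i \<in> {1..s}"
  shows "param_holo n radius (ball c R) (\<lambda>x y. stage x y i)"
proof (rule param_holo_limit[OF open_ball stage_iter_param_holo[OF i]])
  show "(\<lambda>p. R * (1/2) ^ p) \<longlonglongrightarrow> 0"
    by (intro tendsto_mult_right_zero LIMSEQ_power_zero) auto
  fix p y k and x :: "nat \<Rightarrow> complex" assume x: "\<forall>l. norm (x l) < radius" and y: "y \<in> ball c R"
  have "norm (stage_iter x y p i - stage x y i) \<le> R * (1/2) ^ p"
    using near_start(2)[OF y stage_near[OF x y]] stage_fixed_point[OF x y]
    by (intro fixed_point_near_iter[OF x y _ _ i]) auto
  then show "norm (stage_iter x y p i $ k - stage x y i $ k) \<le> R * (1/2) ^ p"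
    using Finite_Cartesian_Product.norm_nth_le[of "stage_iter x y p i - stage x y i" k] by simp
qed

definition increment_sum where
  "increment_sum x y = (\<Sum>i=1..s. b i *\<^sub>R incr x (stage x y i))"

lemma increment_sum_bound:
  assumes "\<forall>l. norm (x l) < radius" "y \<in> ball c R"
  shows "norm (increment_sum x y) \<le> R / 2"
  unfolding increment_sum_def
  using near_start(2)[OF assms(2) stage_near[OF assms]]
  by (intro weighted_incr_bound assms coeff_size_ge) auto

lemma increment_sum_param_holo: "param_holo n radius (ball c R) increment_sum"
  unfolding increment_sum_def[abs_def]
proof (rule stage_map_param_holo)
  show "param_holo n radius (ball c R) (\<lambda>x y. stage x y j)" if "j \<in> {1..s}" for j
    by (rule stage_param_holo[OF that])
  show "stage x y j \<in> cball c (2 * R)"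
    if "j \<in> {1..s}" "\<forall>l. norm (x l) < radius" "y \<in> ball c R" for j x y
    by (rule near_start(2)[OF that(3) stage_near[OF that(2,3,1)]])
qed

text \<open>A real step size and real increments as one vector, extended by \<open>0\<close>, so that monomials become products over
  \<open>l < Suc d\<close>.\<close>

definition real_point :: "real \<Rightarrow> (nat \<Rightarrow> real) \<Rightarrow> nat \<Rightarrow> real" where
  "real_point h \<Delta> l = (if l = 0 then h else if l \<le> d then \<Delta> l else 0)"

lemma monomial_real_point:
  "h ^ \<alpha> 0 * (\<Prod>l=1..d. \<Delta> l ^ \<alpha> l) = (\<Prod>l<Suc d. real_point h \<Delta> l ^ \<alpha> l)"
  unfolding prod.lessThan_Suc_shift One_nat_def prod.atLeast1_atMost_eq
  by (simp add: real_point_def)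

lemma rk_increment_eq_incr:
  "rk_increment d V h \<Delta> v = incr (\<lambda>l. complex_of_real (real_point h \<Delta> l)) v"
  unfolding rk_increment_def incr_def scaleR_eq_smult sum.lessThan_Suc_shift One_nat_def sum.atLeast1_atMost_eq
  by (simp add: real_point_def)

abbreviation "one_step \<equiv> rk_step d s a b V (cball c (2 * R))"
abbreviation "expansion \<equiv> rk_expansion d s a b V (cball c (2 * R))"
abbreviation "step_coeff \<equiv> rk_coeff d s a b V (cball c (2 * R))"
abbreviation "monomial h \<Delta> \<alpha> \<equiv> h ^ \<alpha> 0 * (\<Prod>l=1..d. \<Delta> l ^ \<alpha> l)"

lemma rk_step_iff:
  assumes h: "\<bar>h\<bar> < radius" "\<forall>l\<in>{1..d}. \<bar>\<Delta> l\<bar> < radius" and y: "y \<in> ball c R"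
  shows "one_step h \<Delta> y Y \<longleftrightarrow>
    Y = y + increment_sum (\<lambda>l. complex_of_real (real_point h \<Delta> l)) y"
proof -
  let ?x = "\<lambda>l. complex_of_real (real_point h \<Delta> l)"
  have x: "\<forall>l. norm (?x l) < radius"
    using h radius_pos by (auto simp: real_point_def)
  have fp: "stage_map ?x y K i = y + (\<Sum>j=1..s. a i j *\<^sub>R rk_increment d V h \<Delta> (K j))" for K i
    by (simp add: stage_map_def rk_increment_eq_incr)
  show ?thesis
  proof
    assume "one_step h \<Delta> y Y"
    then obtain K where K0: "\<forall>i\<in>{1..s}. K i \<in> cball c (2 * R) \<and>
          K i = y + (\<Sum>j=1..s. a i j *\<^sub>R rk_increment d V h \<Delta> (K j))"
      and Y: "Y = y + (\<Sum>i=1..s. b i *\<^sub>R rk_increment d V h \<Delta> (K i))"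
      unfolding rk_step_def by (elim exE conjE)
    have K: "K i \<in> cball c (2 * R)" "K i = stage_map ?x y K i" if "i \<in> {1..s}" for i
      using K0 that unfolding fp by blast+
    have "K i = stage ?x y i" if "i \<in> {1..s}" for i
      by (rule fixed_point_unique[OF x y K that])
    then show "Y = y + increment_sum ?x y"
      by (simp add: Y increment_sum_def rk_increment_eq_incr)
  next
    assume Y: "Y = y + increment_sum ?x y"
    show "one_step h \<Delta> y Y"
      unfolding rk_step_def
    proof (intro exI[of _ "stage ?x y"] conjI ballI)
      show "stage ?x y i \<in> cball c (2 * R)" if "i \<in> {1..s}" for i
        by (rule near_start(2)[OF y stage_near[OF x y that]])
      show "stage ?x y i = y + (\<Sum>j=1..s. a i j *\<^sub>R rk_increment d V h \<Delta> (stage ?x y j))"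
        if "i \<in> {1..s}" for i
        unfolding fp[symmetric] by (rule stage_fixed_point[OF x y that])
      show "Y = y + (\<Sum>i=1..s. b i *\<^sub>R rk_increment d V h \<Delta> (stage ?x y i))"
        by (simp add: Y increment_sum_def rk_increment_eq_incr)
    qed
  qed
qed

lemma nonzero_indices:
  "{\<alpha> \<in> multi_indices d. mi_order d \<alpha> \<ge> 1} = indices (Suc d) - {\<lambda>_. 0}"
proof -
  have "mi_order d \<alpha> = 0 \<longleftrightarrow> \<alpha> = (\<lambda>_. 0)" if "\<alpha> \<in> multi_indices d" for \<alpha>
  proof -
    have "mi_order d \<alpha> = 0 \<longleftrightarrow> (\<forall>l\<le>d. \<alpha> l = 0)" by (auto simp: mi_order_def)
    also have "\<dots> \<longleftrightarrow> \<alpha> = (\<lambda>_. 0)"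
      using that by (auto simp: multi_indices_def fun_eq_iff not_le[symmetric])
    finally show ?thesis .
  qed
  moreover have "mi_order d (\<lambda>_. 0) = 0" by (simp add: mi_order_def)
  ultimately show ?thesis unfolding multi_indices_eq[symmetric] by (auto simp: Suc_le_eq)
qed

lemma mi_order_eq: "mi_order d \<alpha> = (\<Sum>l<Suc d. \<alpha> l)"
  unfolding mi_order_def by (simp add: lessThan_Suc_atMost)

text \<open>The step determines the sum of the expansion for all small real increments; apply uniqueness of power
  series to the components of the difference.\<close>

lemma expansion_unique:
  assumes y: "y \<in> ball c R"
    and c1: "expansion y c1"
    and c2: "expansion y c2"
    and \<alpha>: "\<alpha> \<in> multi_indices d" "mi_order d \<alpha> \<ge> 1"
  shows "c1 \<alpha> = c2 \<alpha>"
proof (rule euclidean_eqI)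
  fix e :: "complex ^ 'm" assume "e \<in> Basis"
  let ?A = "{\<alpha> \<in> multi_indices d. mi_order d \<alpha> \<ge> 1}"
  let ?m = "\<lambda>h \<Delta> \<alpha>. h ^ \<alpha> 0 * (\<Prod>l=1..d. \<Delta> l ^ \<alpha> l)"
  from c1 c2 obtain \<rho>1 \<rho>2 where \<rho>: "\<rho>1 > 0" "\<rho>2 > 0" and
    e1: "\<And>h \<Delta>. \<bar>h\<bar> < \<rho>1 \<Longrightarrow> (\<forall>l\<in>{1..d}. \<bar>\<Delta> l\<bar> < \<rho>1) \<Longrightarrow>
        (\<exists>Y. one_step h \<Delta> y Y \<and> ((\<lambda>\<alpha>. ?m h \<Delta> \<alpha> *\<^sub>R c1 \<alpha>) has_sum (Y - y)) ?A)" and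
    e2: "\<And>h \<Delta>. \<bar>h\<bar> < \<rho>2 \<Longrightarrow> (\<forall>l\<in>{1..d}. \<bar>\<Delta> l\<bar> < \<rho>2) \<Longrightarrow>
        (\<exists>Y. one_step h \<Delta> y Y \<and> ((\<lambda>\<alpha>. ?m h \<Delta> \<alpha> *\<^sub>R c2 \<alpha>) has_sum (Y - y)) ?A)"
    unfolding rk_expansion_def by blast
  define \<rho> where "\<rho> = min radius (min \<rho>1 \<rho>2)"
  \<comment> \<open>The expansion has no constant term, so the zero multi-index gets coefficient \<open>0\<close>.\<close>
  define D where "D \<alpha> = (if \<alpha> = (\<lambda>_. 0) then 0 else (c1 \<alpha> - c2 \<alpha>) \<bullet> e)" for \<alpha>
  have "D \<alpha> = 0"
  proof (rule multivariate_power_series_unique[where r = \<rho> and n = "Suc d" and c = D and \<alpha> = \<alpha>])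
    show "\<rho> > 0" using \<rho> radius_pos by (simp add: \<rho>_def)
    show "\<alpha> \<in> indices (Suc d)" using \<alpha>(1) by (simp add: multi_indices_eq)
    fix x :: "nat \<Rightarrow> real" assume x: "\<forall>l. \<bar>x l\<bar> < \<rho>"
    have m: "?m (x 0) x \<alpha> = (\<Prod>l<Suc d. x l ^ \<alpha> l)" for \<alpha>
      unfolding prod.lessThan_Suc_shift One_nat_def prod.atLeast1_atMost_eq by simp
    obtain Y1 where Y1: "one_step (x 0) x y Y1"
      "((\<lambda>\<alpha>. ?m (x 0) x \<alpha> *\<^sub>R c1 \<alpha>) has_sum (Y1 - y)) ?A"
      using e1[of "x 0" x] x by (auto simp: \<rho>_def)
    obtain Y2 where Y2: "one_step (x 0) x y Y2"
      "((\<lambda>\<alpha>. ?m (x 0) x \<alpha> *\<^sub>R c2 \<alpha>) has_sum (Y2 - y)) ?A"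
      using e2[of "x 0" x] x by (auto simp: \<rho>_def)
    have "Y1 = Y2"
      using Y1(1) Y2(1) x y by (simp add: rk_step_iff \<rho>_def)
    have "((\<lambda>\<alpha>. - (?m (x 0) x \<alpha> *\<^sub>R c2 \<alpha>)) has_sum - (Y2 - y)) ?A"
      using Y2(2) by (simp add: has_sum_uminus)
    from has_sum_add[OF Y1(2) this] \<open>Y1 = Y2\<close> have "((\<lambda>\<alpha>. ?m (x 0) x \<alpha> *\<^sub>R (c1 \<alpha> - c2 \<alpha>)) has_sum 0) ?A"
      by (simp add: scaleR_right_diff_distrib)
    from has_sum_bounded_linear[OF bounded_linear_inner_left this, of e]
    have "((\<lambda>\<alpha>. (\<Prod>l<Suc d. x l ^ \<alpha> l) * ((c1 \<alpha> - c2 \<alpha>) \<bullet> e)) has_sum 0) ?A"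
      unfolding m by (simp add: o_def)
    moreover have "((\<lambda>\<alpha>. (\<Prod>l<Suc d. x l ^ \<alpha> l) * ((c1 \<alpha> - c2 \<alpha>) \<bullet> e)) has_sum 0) ?A \<longleftrightarrow>
        ((\<lambda>\<alpha>. (\<Prod>l<Suc d. x l ^ \<alpha> l) * D \<alpha>) has_sum 0) (indices (Suc d))"
      unfolding nonzero_indices by (rule has_sum_cong_neutral) (auto simp: D_def)
    ultimately show "((\<lambda>\<alpha>. (\<Prod>l<Suc d. x l ^ \<alpha> l) * D \<alpha>) has_sum 0) (indices (Suc d))"
      by blast
  qed
  moreover have "\<alpha> \<noteq> (\<lambda>_. 0)" using \<alpha>(2) by (auto simp: mi_order_def)
  ultimately show "c1 \<alpha> \<bullet> e = c2 \<alpha> \<bullet> e"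
    by (simp add: D_def inner_diff_left)
qed

text \<open>The coefficient family obtained from the holomorphic increment is an expansion in the sense of
  \<open>rk_expansion\<close>, and by uniqueness it is the family that \<open>rk_coeff\<close> selects. Its constant term vanishes
  because a step with zero increments does not move.\<close>

theorem rk_coeff_analytic:
  shows "\<And>\<alpha>. \<alpha> \<in> multi_indices d \<Longrightarrow> mi_order d \<alpha> \<ge> 1 \<Longrightarrow> vholo (ball c R) (step_coeff \<alpha>)"
    and "\<And>\<alpha> y. \<alpha> \<in> multi_indices d \<Longrightarrow> mi_order d \<alpha> \<ge> 1 \<Longrightarrow> y \<in> ball c R \<Longrightarrow>
      norm (step_coeff \<alpha> y) \<le> real CARD('m) * (R / 2 / radius ^ mi_order d \<alpha>)"
    and "\<And>h \<Delta> y. \<bar>h\<bar> < radius \<Longrightarrow> (\<forall>l\<in>{1..d}. \<bar>\<Delta> l\<bar> < radius) \<Longrightarrow> y \<in> ball c R \<Longrightarrow>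
      \<exists>!Y. one_step h \<Delta> y Y"
    and "\<And>h \<Delta> y Y. \<bar>h\<bar> < radius \<Longrightarrow> (\<forall>l\<in>{1..d}. \<bar>\<Delta> l\<bar> < radius) \<Longrightarrow> y \<in> ball c R \<Longrightarrow>
      one_step h \<Delta> y Y \<Longrightarrow>
      ((\<lambda>\<alpha>. monomial h \<Delta> \<alpha> *\<^sub>R step_coeff \<alpha> y) has_sum (Y - y))
         {\<alpha> \<in> multi_indices d. mi_order d \<alpha> \<ge> 1}"
proof -
  let ?A = "{\<alpha> \<in> multi_indices d. mi_order d \<alpha> \<ge> 1}"
  have "norm (increment_sum x y $ i) \<le> R / 2" if "\<forall>l. norm (x l) < radius" "y \<in> ball c R" for x y i
    using increment_sum_bound[of x y] that Finite_Cartesian_Product.norm_nth_le[of "increment_sum x y" i]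
    by (meson order_trans)
  from multivariate_power_series[OF open_ball radius_pos increment_sum_param_holo this, of "Suc d"]
  obtain C where C: "\<And>\<alpha>. \<alpha> \<in> indices (Suc d) \<Longrightarrow> vholo (ball c R) (C \<alpha>)"
    "\<And>\<alpha> y i. \<alpha> \<in> indices (Suc d) \<Longrightarrow> y \<in> ball c R \<Longrightarrow>
        norm (C \<alpha> y $ i) \<le> R / 2 / radius ^ (\<Sum>l<Suc d. \<alpha> l)"
    "\<And>x y i. (\<forall>l. norm (x l) < radius) \<Longrightarrow> (\<forall>l\<ge>Suc d. x l = 0) \<Longrightarrow> y \<in> ball c R \<Longrightarrow>
       ((\<lambda>\<alpha>. (\<Prod>l<Suc d. x l ^ \<alpha> l) * C \<alpha> y $ i) has_sum increment_sum x y $ i) (indices (Suc d))"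
    by blast
  have C0: "C (\<lambda>_. 0) y = 0" if y: "y \<in> ball c R" for y
  proof -
    have "C (\<lambda>_. 0) y $ i = 0" for i
    proof -
      have "((\<lambda>\<alpha>. (\<Prod>l<Suc d. (0::complex) ^ \<alpha> l) * C \<alpha> y $ i) has_sum increment_sum (\<lambda>_. 0) y $ i)
          (indices (Suc d))"
        using C(3)[of "\<lambda>_. 0" y i] y radius_pos by simp
      moreover have "increment_sum (\<lambda>_. 0) y = 0"
        by (simp add: increment_sum_def incr_def)
      moreover have "(\<Prod>l<Suc d. (0::complex) ^ \<alpha> l) = 0" if \<alpha>: "\<alpha> \<in> indices (Suc d) - {\<lambda>_. 0}" for \<alpha>
      proof -
        obtain l where l: "\<alpha> l \<noteq> 0" using \<alpha> by (auto simp: fun_eq_iff)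
        have "\<forall>l\<ge>Suc d. \<alpha> l = 0" using \<alpha> by (simp add: indices_def)
        with l have "l < Suc d" using not_less by blast
        with l show ?thesis by (intro prod_zero) auto
      qed
      then have "((\<lambda>\<alpha>. (\<Prod>l<Suc d. (0::complex) ^ \<alpha> l) * C \<alpha> y $ i) has_sum x) (indices (Suc d)) \<longleftrightarrow>
          ((\<lambda>\<alpha>. (\<Prod>l<Suc d. (0::complex) ^ \<alpha> l) * C \<alpha> y $ i) has_sum x) {\<lambda>_. 0}" for x
        by (intro has_sum_cong_neutral) (auto simp: indices_def)
      ultimately have "((\<lambda>\<alpha>. (\<Prod>l<Suc d. (0::complex) ^ \<alpha> l) * C \<alpha> y $ i) has_sum 0) {\<lambda>_. 0}"
        by simp
      from has_sum_unique[OF this has_sum_finite] show ?thesis by simp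
    qed
    then show ?thesis by (simp add: vec_eq_iff)
  qed
  have has: "((\<lambda>\<alpha>. monomial h \<Delta> \<alpha> *\<^sub>R C \<alpha> y) has_sum (Y - y)) ?A"
    if h: "\<bar>h\<bar> < radius" and \<Delta>: "\<forall>l\<in>{1..d}. \<bar>\<Delta> l\<bar> < radius" and y: "y \<in> ball c R"
      and Y: "one_step h \<Delta> y Y" for h \<Delta> y Y
  proof -
    let ?x = "\<lambda>l. complex_of_real (real_point h \<Delta> l)"
    have x: "\<forall>l. norm (?x l) < radius" "\<forall>l\<ge>Suc d. ?x l = 0"
      using h \<Delta> radius_pos by (auto simp: real_point_def)
    have eq: "Y - y = increment_sum ?x y"
      using rk_step_iff[OF h \<Delta> y, of Y] Y by simp
    have "((\<lambda>\<alpha>. monomial h \<Delta> \<alpha> *\<^sub>R C \<alpha> y) has_sum (Y - y)) (indices (Suc d))"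
      unfolding eq
    proof (rule has_sum_vec)
      fix i
      have "(monomial h \<Delta> \<alpha> *\<^sub>R C \<alpha> y) $ i = (\<Prod>l<Suc d. ?x l ^ \<alpha> l) * C \<alpha> y $ i" for \<alpha>
        unfolding monomial_real_point scaleR_eq_smult by simp
      then show "((\<lambda>\<alpha>. (monomial h \<Delta> \<alpha> *\<^sub>R C \<alpha> y) $ i) has_sum
          increment_sum ?x y $ i) (indices (Suc d))"
        using C(3)[OF x y, of i] by simp
    qed
    moreover have "((\<lambda>\<alpha>. monomial h \<Delta> \<alpha> *\<^sub>R C \<alpha> y) has_sum (Y - y)) ?A \<longleftrightarrow>
        ((\<lambda>\<alpha>. monomial h \<Delta> \<alpha> *\<^sub>R C \<alpha> y) has_sum (Y - y)) (indices (Suc d))"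
      unfolding nonzero_indices by (rule has_sum_cong_neutral) (use C0[OF y] in auto)
    ultimately show ?thesis by blast
  qed
  have ex: "expansion y (\<lambda>\<alpha>. C \<alpha> y)" if y: "y \<in> ball c R" for y
    unfolding rk_expansion_def
  proof (intro exI[of _ radius] conjI allI impI radius_pos)
    fix h \<Delta> assume "\<bar>h\<bar> < radius \<and> (\<forall>l\<in>{1..d}. \<bar>\<Delta> l\<bar> < radius)"
    then have h: "\<bar>h\<bar> < radius" and \<Delta>: "\<forall>l\<in>{1..d}. \<bar>\<Delta> l\<bar> < radius" by blast+
    have st: "one_step h \<Delta> y
        (y + increment_sum (\<lambda>l. complex_of_real (real_point h \<Delta> l)) y)"
      unfolding rk_step_iff[OF h \<Delta> y] by (rule refl)
    show "\<exists>Y. one_step h \<Delta> y Y \<and>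
        ((\<lambda>\<alpha>. monomial h \<Delta> \<alpha> *\<^sub>R C \<alpha> y) has_sum (Y - y)) ?A"
      by (intro exI conjI) (rule st, rule has[OF h \<Delta> y st])
  qed
  have coeff_eq: "step_coeff \<alpha> y = C \<alpha> y" if "\<alpha> \<in> multi_indices d" "mi_order d \<alpha> \<ge> 1" "y \<in> ball c R" for \<alpha> y
    unfolding rk_coeff_def
  proof (rule the_equality)
    show "\<exists>c'. expansion y c' \<and> C \<alpha> y = c' \<alpha>"
      using ex[OF that(3)] by blast
    show "v = C \<alpha> y" if "\<exists>c'. expansion y c' \<and> v = c' \<alpha>" for v
      using that expansion_unique[OF \<open>y \<in> ball c R\<close> _ ex[OF \<open>y \<in> ball c R\<close>]
          \<open>\<alpha> \<in> multi_indices d\<close> \<open>mi_order d \<alpha> \<ge> 1\<close>] by blast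
  qed
  show "vholo (ball c R) (step_coeff \<alpha>)" if "\<alpha> \<in> multi_indices d" "mi_order d \<alpha> \<ge> 1" for \<alpha>
    unfolding vholo_def
  proof
    fix y assume y: "y \<in> ball c R"
    show "cdiff (step_coeff \<alpha>) y"
      by (rule cdiff_cong[OF vholoD[OF C(1) y] open_ball y])
         (use that coeff_eq in \<open>auto simp: multi_indices_eq\<close>)
  qed
  show "norm (step_coeff \<alpha> y) \<le> real CARD('m) * (R / 2 / radius ^ mi_order d \<alpha>)"
    if "\<alpha> \<in> multi_indices d" "mi_order d \<alpha> \<ge> 1" "y \<in> ball c R" for \<alpha> y
    unfolding coeff_eq[OF that] mi_order_eq
    using that by (intro norm_le_card_component C(2)) (auto simp: multi_indices_eq)
  show "\<exists>!Y. one_step h \<Delta> y Y"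
    if "\<bar>h\<bar> < radius" "\<forall>l\<in>{1..d}. \<bar>\<Delta> l\<bar> < radius" "y \<in> ball c R" for h \<Delta> y
    using rk_step_iff[OF that] by simp
  show "((\<lambda>\<alpha>. monomial h \<Delta> \<alpha> *\<^sub>R step_coeff \<alpha> y) has_sum (Y - y)) ?A"
    if "\<bar>h\<bar> < radius" "\<forall>l\<in>{1..d}. \<bar>\<Delta> l\<bar> < radius" "y \<in> ball c R"
      "one_step h \<Delta> y Y" for h \<Delta> y Y
  proof -
    have "((\<lambda>\<alpha>. monomial h \<Delta> \<alpha> *\<^sub>R step_coeff \<alpha> y) has_sum (Y - y)) ?A \<longleftrightarrow>
        ((\<lambda>\<alpha>. monomial h \<Delta> \<alpha> *\<^sub>R C \<alpha> y) has_sum (Y - y)) ?A"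
      by (rule has_sum_cong) (use coeff_eq that(3) in auto)
    with has[OF that] show ?thesis by blast
  qed
qed

end

section \<open>Words of multi-indices\<close>

definition mi_list_sum :: "multi_index list \<Rightarrow> multi_index" where
  "mi_list_sum ks l = (\<Sum>k\<leftarrow>ks. k l)"

definition mi_upto :: "nat \<Rightarrow> nat \<Rightarrow> multi_index set" where
  "mi_upto d n = {\<alpha> \<in> multi_indices d. 1 \<le> mi_order d \<alpha> \<and> mi_order d \<alpha> \<le> n}"

text \<open>The words of length \<open>i\<close> that occur in the \<open>i\<close>-th Taylor term of the flow of the \<open>n\<close>-truncated field.\<close>

definition lists_upto :: "nat \<Rightarrow> nat \<Rightarrow> nat \<Rightarrow> multi_index list set" where
  "lists_upto d n i = {ks. set ks \<subseteq> mi_upto d n \<and> length ks = i}"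

definition mi_monomial :: "nat \<Rightarrow> real \<Rightarrow> (nat \<Rightarrow> real) \<Rightarrow> multi_index \<Rightarrow> real" where
  "mi_monomial d h \<Delta> \<alpha> = h ^ \<alpha> 0 * (\<Prod>l=1..d. \<Delta> l ^ \<alpha> l)"

abbreviation "words_to d n i \<alpha> \<equiv> {ks. ks \<in> lists_upto d n i \<and> mi_list_sum ks = \<alpha>}"

lemma mi_list_sum_simps [simp]:
  "mi_list_sum [] = (\<lambda>_. 0)" "mi_list_sum (k # ks) = (\<lambda>l. k l + mi_list_sum ks l)"
  by (auto simp: mi_list_sum_def)

lemma finite_mi_upto [simp]: "finite (mi_upto d n)"
proof (rule finite_subset)
  show "mi_upto d n \<subseteq> {f. \<forall>x. (x \<in> {..d} \<longrightarrow> f x \<in> {..n}) \<and> (x \<notin> {..d} \<longrightarrow> f x = 0)}"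
  proof
    fix \<alpha> assume "\<alpha> \<in> mi_upto d n"
    then have \<alpha>: "\<And>l. l > d \<Longrightarrow> \<alpha> l = 0" "(\<Sum>l\<le>d. \<alpha> l) \<le> n"
      by (auto simp: mi_upto_def multi_indices_def mi_order_def)
    have "\<alpha> l \<le> n" if "l \<le> d" for l
      using member_le_sum[of l "{..d}" \<alpha>] that \<alpha>(2) by simp
    with \<alpha>(1) show "\<alpha> \<in> {f. \<forall>x. (x \<in> {..d} \<longrightarrow> f x \<in> {..n}) \<and> (x \<notin> {..d} \<longrightarrow> f x = 0)}"
      by auto
  qed
qed (rule finite_set_of_finite_funs; simp)

lemma mi_upto_subset: "mi_upto d n \<subseteq> multi_indices d"
  by (auto simp: mi_upto_def)

lemma finite_lists_upto [simp]: "finite (lists_upto d n i)"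
  unfolding lists_upto_def by (rule finite_lists_length_eq) simp

lemma lists_upto_0: "lists_upto d n 0 = {[]}"
  by (auto simp: lists_upto_def)

lemma bij_lists_upto_Suc:
  "bij_betw (\<lambda>(k, ks). k # ks) (mi_upto d n \<times> lists_upto d n i) (lists_upto d n (Suc i))"
  by (rule bij_betw_byWitness[where f' = "\<lambda>ks. (hd ks, tl ks)"])
     (auto simp: lists_upto_def length_Suc_conv)

lemma sum_lists_upto_Suc:
  fixes F :: "multi_index list \<Rightarrow> 'a :: comm_monoid_add"
  shows "(\<Sum>ks\<in>lists_upto d n (Suc i). F ks) = (\<Sum>k\<in>mi_upto d n. \<Sum>ks\<in>lists_upto d n i. F (k # ks))"
  using sum.reindex_bij_betw[OF bij_lists_upto_Suc, of F d n i]
  by (simp add: sum.cartesian_product case_prod_beta')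

text \<open>The multinomial expansion, read backwards: summing a product weight over words gives a power.\<close>

lemma sum_prod_lists_upto:
  fixes t :: "multi_index \<Rightarrow> real"
  shows "(\<Sum>ks\<in>lists_upto d n i. prod_list (map t ks)) = (\<Sum>k\<in>mi_upto d n. t k) ^ i"
proof (induction i)
  case 0
  show ?case by (simp add: lists_upto_0)
next
  case (Suc i)
  then show ?case
    by (simp add: sum_lists_upto_Suc sum_distrib_left[symmetric] sum_distrib_right)
qed

lemma mi_order_list_sum: "mi_order d (mi_list_sum ks) = (\<Sum>k\<leftarrow>ks. mi_order d k)"
  by (induction ks) (simp_all add: mi_order_def sum.distrib)

lemma mi_list_sum_indices: "set ks \<subseteq> multi_indices d \<Longrightarrow> mi_list_sum ks \<in> multi_indices d"
  by (induction ks) (auto simp: multi_indices_def)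

lemma mi_monomial_list_sum: "mi_monomial d h \<Delta> (mi_list_sum ks) = prod_list (map (mi_monomial d h \<Delta>) ks)"
  by (induction ks) (simp_all add: mi_monomial_def power_add prod.distrib mult_ac)

lemma mi_monomial_bound:
  assumes "\<bar>h\<bar> \<le> w" "\<forall>l\<in>{1..d}. \<bar>\<Delta> l\<bar> \<le> w"
  shows "\<bar>mi_monomial d h \<Delta> \<alpha>\<bar> \<le> w ^ mi_order d \<alpha>"
proof -
  have w: "w \<ge> 0" using assms(1) by linarith
  have "\<bar>mi_monomial d h \<Delta> \<alpha>\<bar> = \<bar>h\<bar> ^ \<alpha> 0 * (\<Prod>l=1..d. \<bar>\<Delta> l\<bar> ^ \<alpha> l)"
    by (simp add: mi_monomial_def abs_mult power_abs abs_prod)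
  also have "\<dots> \<le> w ^ \<alpha> 0 * (\<Prod>l=1..d. w ^ \<alpha> l)"
    using assms w by (intro mult_mono prod_mono power_mono prod_nonneg) (auto intro: power_mono)
  also have "\<dots> = w ^ mi_order d \<alpha>"
    by (simp add: mi_order_def power_sum atMost_atLeast0 prod.atLeast_Suc_atMost)
  finally show ?thesis .
qed

text \<open>Multi-indices in a splitting of \<open>\<alpha>\<close> have order at most that of \<open>\<alpha>\<close>, so splittings are words in a finite alphabet
  that does not depend on \<open>\<alpha>\<close>.\<close>

lemma splittings_eq:
  assumes \<alpha>: "\<alpha> \<in> multi_indices d" and n: "mi_order d \<alpha> \<le> n"
  shows "splittings d \<alpha> i = {ks \<in> lists_upto d n i. mi_list_sum ks = \<alpha>}"
proof -
  have nth: "(\<Sum>j<length ks. (ks ! j) l) = mi_list_sum ks l" for ks :: "multi_index list" and l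
    by (simp add: mi_list_sum_def sum_list_sum_nth lessThan_atLeast0)
  have "ks \<in> splittings d \<alpha> i \<longleftrightarrow> ks \<in> lists_upto d n i \<and> mi_list_sum ks = \<alpha>" for ks
  proof
    assume ks: "ks \<in> splittings d \<alpha> i"
    then have l: "length ks = i" and k: "\<And>k. k \<in> set ks \<Longrightarrow> k \<in> multi_indices d \<and> 1 \<le> mi_order d k"
      and s: "\<And>l. l \<le> d \<Longrightarrow> mi_list_sum ks l = \<alpha> l"
      by (auto simp: splittings_def nth)
    have "mi_list_sum ks \<in> multi_indices d" using k by (intro mi_list_sum_indices) auto
    then have eq: "mi_list_sum ks = \<alpha>"
      using s \<alpha> by (auto simp: fun_eq_iff multi_indices_def not_le) (metis not_le)
    have "mi_order d k \<le> n" if "k \<in> set ks" for k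
    proof -
      have "mi_order d k \<le> (\<Sum>k\<leftarrow>ks. mi_order d k)"
        using that by (intro member_le_sum_list) auto
      then show ?thesis using n unfolding eq[symmetric] mi_order_list_sum by linarith
    qed
    with k l eq show "ks \<in> lists_upto d n i \<and> mi_list_sum ks = \<alpha>"
      by (auto simp: lists_upto_def mi_upto_def)
  next
    assume "ks \<in> lists_upto d n i \<and> mi_list_sum ks = \<alpha>"
    then show "ks \<in> splittings d \<alpha> i"
      by (auto simp: splittings_def lists_upto_def mi_upto_def nth)
  qed
  then show ?thesis by blast
qed

lemma length_le_order:
  "set ks \<subseteq> mi_upto d n \<Longrightarrow> length ks \<le> mi_order d (mi_list_sum ks)"
  unfolding mi_order_list_sum by (induction ks) (auto simp: mi_upto_def)

lemma sum_geometric_mi_upto: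
  assumes "finite A" "A \<subseteq> multi_indices d"
  shows "(\<Sum>\<alpha>\<in>A. (1/2::real) ^ mi_order d \<alpha>) \<le> 2 ^ Suc d"
proof -
  have "((\<lambda>\<alpha>. \<Prod>l<Suc d. (1/2::real) ^ \<alpha> l) has_sum (\<Prod>l<Suc d. 1 / (1 - 1/2))) (indices (Suc d))"
    by (rule has_sum_geometric_indices) auto
  then have "((\<lambda>\<alpha>. (1/2::real) ^ mi_order d \<alpha>) has_sum 2 ^ Suc d) (multi_indices d)"
    by (simp add: power_sum[symmetric] mi_order_def lessThan_Suc_atMost multi_indices_eq
        del: prod.lessThan_Suc)
  from finite_sum_le_has_sum[OF this assms] show ?thesis by simp
qed

text \<open>For \<open>S \<le> 1/2\<close> the number \<open>exp S - 1 - S\<close> is at most \<open>1/4\<close>; here for partial sums.\<close>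

lemma sum_power_fact_le:
  fixes S :: real
  assumes "0 \<le> S" "S \<le> 1/2"
  shows "(\<Sum>i=2..n. S ^ i / fact i) \<le> 1/4"
proof -
  have "(\<Sum>i=2..n. S ^ i / fact i) \<le> (\<Sum>i=2..n. (1/2) ^ Suc i)"
  proof (rule sum_mono)
    fix i assume i: "i \<in> {2..n}"
    have "(fact 2 :: real) \<le> fact i" using i by (intro fact_mono) auto
    then have "S ^ i / fact i \<le> (1/2) ^ i / 2"
      using assms by (intro frac_le power_mono) (auto simp: fact_2)
    then show "S ^ i / fact i \<le> (1/2) ^ Suc i" by simp
  qed
  also have "\<dots> \<le> 1/4"
  proof -
    have "(\<Sum>i=2..n. (1/2::real) ^ Suc i) = 1/4 - (1/2) ^ Suc n" if "n \<ge> 1" for n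
      using that by (induction n rule: dec_induct) (auto simp: field_simps)
    then show ?thesis by (cases "n \<ge> 1") (auto simp: not_le)
  qed
  finally show ?thesis .
qed

section \<open>Majorants for the modified coefficients\<close>

text \<open>From here on the step coefficients enter through their holomorphy and geometric growth. The number \<open>\<kappa>\<close> is the
  constant of Cauchy's estimate; it is a parameter so that it has a short name.\<close>

locale coeff_family =
  fixes d :: nat and g :: "multi_index \<Rightarrow> complex ^ 'm \<Rightarrow> complex ^ 'm" and c :: "complex ^ 'm"
    and R K0 r \<kappa> :: real
  assumes \<kappa>: "\<kappa> = real CARD('m)" and R: "R > 0" and K0: "K0 > 0" and r: "r > 0"
    and g_holo: "\<And>\<alpha>. \<alpha> \<in> multi_indices d \<Longrightarrow> mi_order d \<alpha> \<ge> 1 \<Longrightarrow> vholo (ball c R) (g \<alpha>)"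
    and g_bound: "\<And>\<alpha> y. \<alpha> \<in> multi_indices d \<Longrightarrow> mi_order d \<alpha> \<ge> 1 \<Longrightarrow> y \<in> ball c R \<Longrightarrow>
      norm (g \<alpha> y) \<le> K0 / r ^ mi_order d \<alpha>"
begin

abbreviation "f \<equiv> modified_coeff d g"

lemma \<kappa>_pos [simp]: "\<kappa> > 0" "\<kappa> \<ge> 0" "\<kappa> \<noteq> 0"
  by (simp_all add: \<kappa>)

text \<open>The summand of the recursion for the modified coefficients that belongs to one splitting.\<close>

definition lie_word :: "multi_index list \<Rightarrow> complex ^ 'm \<Rightarrow> complex ^ 'm" where
  "lie_word ks = foldr (\<lambda>k G. lie_deriv (f k) G) (butlast ks) (f (last ks))"

lemma lie_word_single [simp]: "lie_word [k] = f k"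
  by (simp add: lie_word_def)

lemma lie_word_Cons [simp]: "ks \<noteq> [] \<Longrightarrow> lie_word (k # ks) = lie_deriv (f k) (lie_word ks)"
  by (simp add: lie_word_def)

lemma modified_coeff_eq:
  "f \<alpha> y = g \<alpha> y - (\<Sum>i=2..mi_order d \<alpha>. (1 / fact i) *\<^sub>R (\<Sum>ks\<in>splittings d \<alpha> i. lie_word ks y))"
  unfolding lie_word_def by (subst modified_coeff.simps) (rule refl)

lemma lie_word_holo:
  assumes "ks \<noteq> []" "\<And>k. k \<in> set ks \<Longrightarrow> vholo (ball c R) (f k)"
  shows "vholo (ball c R) (lie_word ks)"
  using assms
proof (induction ks rule: list_nonempty_induct)
  case (cons k ks)
  then show ?case by (simp add: vholo_lie_deriv)
qed simp

text \<open>Induction on the order: the recursion involves only Lie derivatives of coefficients of smaller order.\<close>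

lemma modified_coeff_holo:
  "\<alpha> \<in> multi_indices d \<Longrightarrow> mi_order d \<alpha> \<ge> 1 \<Longrightarrow> vholo (ball c R) (f \<alpha>)"
proof (induction "mi_order d \<alpha>" arbitrary: \<alpha> rule: less_induct)
  case less
  have w: "vholo (ball c R) (lie_word ks)" if "ks \<in> splittings d \<alpha> i" "i \<ge> 2" for ks i
  proof (rule lie_word_holo)
    show "ks \<noteq> []" using that by (auto simp: splittings_def)
    fix k assume k: "k \<in> set ks"
    show "vholo (ball c R) (f k)"
      using that k mi_order_less[OF that k] by (intro less.hyps) (auto simp: splittings_def)
  qed
  have "cdiff (\<lambda>y. g \<alpha> y - (\<Sum>i=2..mi_order d \<alpha>.
      (1 / fact i) *\<^sub>R (\<Sum>ks\<in>splittings d \<alpha> i. lie_word ks y))) y" if y: "y \<in> ball c R" for y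
    using w vholoD[OF g_holo[OF less.prems] y]
    by (intro cdiff_diff cdiff_sum cdiff_scaleR) (auto intro: vholoD[OF _ y])
  then show ?case unfolding vholo_def modified_coeff_eq[abs_def] by blast
qed

text \<open>Each letter \<open>k\<close> in front of the last one costs a differentiation and hence, by Cauchy's estimate on a
  ball of radius \<open>\<delta>\<close>, a factor \<open>\<kappa> / \<delta>\<close>. The radius \<open>T - wt k\<close> of the ball on which \<open>f k\<close> is
  known decreases with a weight of at least \<open>\<delta>\<close>, and the weights add up along the word. Weights
  proportional to the order serve for the recursion, constant weights for the Taylor terms of
  the flow.\<close>

lemma lie_word_bound:
  assumes \<delta>: "\<delta> > 0" and T: "T \<le> R + \<delta>"
    and ks: "ks \<noteq> []"
    and k: "\<And>k. k \<in> set ks \<Longrightarrow> k \<in> multi_indices d \<and> mi_order d k \<ge> 1 \<and> wt k \<ge> \<delta>"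
    and bd: "\<And>k y. k \<in> set ks \<Longrightarrow> y \<in> ball c (T - wt k) \<Longrightarrow> norm (f k y) \<le> \<beta> k"
    and y: "y \<in> ball c (T - (\<Sum>k\<leftarrow>ks. wt k))"
  shows "norm (lie_word ks y) \<le> (\<kappa> / \<delta>) ^ (length ks - 1) * prod_list (map \<beta> ks)"
  using ks k bd y
proof (induction ks arbitrary: y rule: list_nonempty_induct)
  case (single k)
  then show ?case by simp
next
  case (cons k ks)
  let ?s = "\<Sum>k\<leftarrow>ks. wt k" and ?B = "(\<kappa> / \<delta>) ^ (length ks - 1) * prod_list (map \<beta> ks)"
  have s: "?s \<ge> \<delta>"
  proof -
    obtain k' ks' where ks': "ks = k' # ks'" using cons.hyps by (cases ks) auto
    have "0 \<le> (\<Sum>k\<leftarrow>ks'. wt k)"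
      using cons.prems(1) \<delta> ks' by (intro sum_list_nonneg) force
    moreover have "wt k' \<ge> \<delta>" using cons.prems(1)[of k'] ks' by simp
    ultimately show ?thesis using ks' by simp
  qed
  have wk: "wt k \<ge> \<delta>" using cons.prems(1)[of k] by simp
  have y: "dist c y < T - wt k - ?s" using cons.prems(3) by simp
  have IH: "norm (lie_word ks v) \<le> ?B" if "v \<in> ball c (T - ?s)" for v
    by (rule cons.IH[OF _ _ that]) (use cons.prems in auto)
  have sub: "ball y \<delta> \<subseteq> ball c (T - ?s)"
  proof
    fix v assume "v \<in> ball y \<delta>"
    then show "v \<in> ball c (T - ?s)" using dist_triangle[of c v y] y wk by simp
  qed
  have "ball c (T - ?s) \<subseteq> ball c R" using s T by (intro subset_ball) simp
  moreover have "vholo (ball c R) (lie_word ks)"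
    by (rule lie_word_holo) (use cons in \<open>auto intro: modified_coeff_holo\<close>)
  ultimately have "vholo (ball y \<delta>) (lie_word ks)" using sub vholo_subset by blast
  then have "norm (frechet_derivative (lie_word ks) (at y) (f k y)) \<le> real CARD('m) * ?B * norm (f k y) / \<delta>"
    using IH sub \<delta> by (intro frechet_derivative_bound) auto
  also have "\<dots> = \<kappa> / \<delta> * ?B * norm (f k y)" by (simp add: \<kappa>)
  also have "\<dots> \<le> \<kappa> / \<delta> * ?B * \<beta> k"
  proof (intro mult_left_mono)
    show "norm (f k y) \<le> \<beta> k" using cons.prems(2)[of k y] y s \<delta> by simp
    have "y \<in> ball c (T - ?s)" using sub \<delta> centre_in_ball by blast
    from order_trans[OF norm_ge_zero IH[OF this]] show "0 \<le> \<kappa> / \<delta> * ?B" using \<delta> by simp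
  qed
  also have "\<dots> = (\<kappa> / \<delta>) ^ (length (k # ks) - 1) * prod_list (map \<beta> (k # ks))"
    using cons.hyps by (cases ks) auto
  finally show ?case using cons.hyps by (simp add: lie_deriv_def)
qed

text \<open>The amount by which the ball shrinks per differentiation: \<open>N\<close> of them use up a quarter of the radius.\<close>

definition step :: "nat \<Rightarrow> real" where "step N = R / (4 * real N)"

definition majorant :: "nat \<Rightarrow> multi_index \<Rightarrow> real" where
  "majorant N \<alpha> = (SUP y\<in>ball c (R - real (mi_order d \<alpha>) * step N). norm (f \<alpha> y))"

text \<open>Chosen such that the step coefficients contribute at most \<open>1/4\<close> to the sum of weights, see
  \<open>weight_sum_le\<close>.\<close>

definition ratio :: real where
  "ratio = min (1/2) (R / (4 * \<kappa> * K0 * 2 ^ (d + 4)))"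

text \<open>The size of increments for which the majorant series is controlled. It is of order \<open>1 / N\<close>, so the admissible
  truncation index is inversely proportional to the increments.\<close>

definition reach :: "nat \<Rightarrow> real" where "reach N = r * (ratio / real N)"

text \<open>The majorant in units of \<open>step N / \<kappa>\<close>, times the monomial at increments \<open>reach N\<close>. In these units the factors from
  Cauchy's estimate disappear from the recursion.\<close>

definition weight :: "nat \<Rightarrow> multi_index \<Rightarrow> real" where
  "weight N \<alpha> = \<kappa> / step N * majorant N \<alpha> * reach N ^ mi_order d \<alpha>"

abbreviation "weights N ks \<equiv> prod_list (map (weight N) ks)"

lemma ratio_pos: "ratio > 0" "ratio \<le> 1/2"
  using R K0 by (auto simp: ratio_def)

lemma step_pos: "N \<ge> 1 \<Longrightarrow> step N > 0"
  using R by (simp add: step_def)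

lemma reach_pos: "N \<ge> 1 \<Longrightarrow> reach N > 0"
  using r ratio_pos by (simp add: reach_def)

lemma order_step_le: "N \<ge> 1 \<Longrightarrow> j \<le> N \<Longrightarrow> real j * step N \<le> R / 4"
proof -
  assume N: "N \<ge> 1" "j \<le> N"
  then have "real j * step N \<le> real N * step N"
    using step_pos[of N] by (intro mult_right_mono) auto
  also have "\<dots> = R / 4" using N by (simp add: step_def)
  finally show ?thesis .
qed

lemma majorant_upper:
  assumes N: "N \<ge> 1" and \<alpha>: "\<alpha> \<in> mi_upto d N" and y: "y \<in> ball c (R - real (mi_order d \<alpha>) * step N)"
  shows "norm (f \<alpha> y) \<le> majorant N \<alpha>"
proof -
  let ?\<rho> = "R - real (mi_order d \<alpha>) * step N"
  have "?\<rho> < R" using \<alpha> step_pos[OF N] by (simp add: mi_upto_def)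
  then have sub: "cball c ?\<rho> \<subseteq> ball c R" by auto
  have "vholo (ball c R) (f \<alpha>)" using \<alpha> by (intro modified_coeff_holo) (auto simp: mi_upto_def)
  from vholo_continuous_on[OF vholo_subset[OF this sub]]
  have "continuous_on (cball c ?\<rho>) (\<lambda>y. norm (f \<alpha> y))"
    by (rule continuous_on_norm)
  then have "bounded ((\<lambda>y. norm (f \<alpha> y)) ` cball c ?\<rho>)"
    by (intro compact_imp_bounded compact_continuous_image compact_cball)
  from bounded_subset[OF this image_mono[OF ball_subset_cball]]
  have "bdd_above ((\<lambda>y. norm (f \<alpha> y)) ` ball c ?\<rho>)"
    by (rule bounded_imp_bdd_above)
  then show ?thesis unfolding majorant_def using y by (rule cSUP_upper2) simp
qed

lemma majorant_nonneg:
  assumes "N \<ge> 1" "\<alpha> \<in> mi_upto d N"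
  shows "0 \<le> majorant N \<alpha>"
proof -
  have "real (mi_order d \<alpha>) * step N \<le> R / 4"
    using assms by (intro order_step_le) (auto simp: mi_upto_def)
  then have "c \<in> ball c (R - real (mi_order d \<alpha>) * step N)" using R by simp
  from order_trans[OF norm_ge_zero majorant_upper[OF assms this]] show ?thesis .
qed

lemma weight_nonneg:
  assumes "N \<ge> 1" "\<alpha> \<in> mi_upto d N"
  shows "0 \<le> weight N \<alpha>"
  unfolding weight_def
  using majorant_nonneg[OF assms] step_pos[OF assms(1)] reach_pos[OF assms(1)] by simp

lemma prod_weight_nonneg:
  assumes N: "N \<ge> 1" and n: "n \<le> N" and ks: "ks \<in> lists_upto d n i"
  shows "0 \<le> weights N ks"
  using ks n by (intro prod_list_nonneg)
    (auto simp: lists_upto_def mi_upto_def intro!: weight_nonneg[OF N])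

lemma word_weight:
  assumes "N \<ge> 1" "ks \<noteq> []"
  shows "(\<kappa> / step N) ^ (length ks - 1) * prod_list (map (majorant N) ks)
      * reach N ^ mi_order d (mi_list_sum ks) = step N / \<kappa> * weights N ks"
proof -
  have "weights N ks = (\<kappa> / step N) ^ length ks * prod_list (map (majorant N) ks)
      * reach N ^ mi_order d (mi_list_sum ks)"
    unfolding mi_order_list_sum by (induction ks) (auto simp: weight_def power_add)
  moreover have "(\<kappa> / step N) ^ length ks = \<kappa> / step N * (\<kappa> / step N) ^ (length ks - 1)"
    using assms(2) by (cases ks) auto
  ultimately show ?thesis using step_pos[OF assms(1)] by simp
qed

text \<open>The recursion for the modified coefficients, estimated term by term. All letters of a proper splitting have
  smaller order, so only words in the alphabet of order at most \<open>n\<close> occur.\<close>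

lemma weight_recursion:
  assumes N: "N \<ge> 1" and n: "Suc n \<le> N" and \<alpha>: "\<alpha> \<in> mi_upto d (Suc n)"
  shows "weight N \<alpha> \<le> \<kappa> / step N * K0 * (ratio / real N) ^ mi_order d \<alpha>
    + (\<Sum>i=2..Suc n. (\<Sum>ks\<in>words_to d n i \<alpha>. weights N ks) / fact i)"
proof -
  let ?j = "mi_order d \<alpha>"
  let ?\<rho> = "R - real ?j * step N"
  have \<alpha>': "\<alpha> \<in> multi_indices d" "1 \<le> ?j" "?j \<le> Suc n" using \<alpha> by (auto simp: mi_upto_def)
  have \<delta>: "step N > 0" by (rule step_pos[OF N])
  have sp: "ks \<in> lists_upto d n i \<and> mi_list_sum ks = \<alpha>"
    if ks: "ks \<in> splittings d \<alpha> i" and i: "2 \<le> i" for ks i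
  proof -
    have "ks \<in> lists_upto d (Suc n) i" "mi_list_sum ks = \<alpha>"
      using splittings_eq[OF \<alpha>'(1,3)] ks by auto
    moreover have "mi_order d k \<le> n" if "k \<in> set ks" for k
      using mi_order_less[OF ks i that] \<alpha>'(3) by linarith
    ultimately show ?thesis by (auto simp: lists_upto_def mi_upto_def)
  qed
  define B where "B i = (\<Sum>ks\<in>splittings d \<alpha> i. (\<kappa> / step N) ^ (i - 1) * prod_list (map (majorant N) ks))" for i
  have "majorant N \<alpha> \<le> K0 / r ^ ?j + (\<Sum>i=2..?j. B i / fact i)"
    unfolding majorant_def
  proof (rule cSUP_least)
    have "real ?j * step N \<le> R / 4" using n \<alpha>'(3) by (intro order_step_le N) auto
    then show "ball c ?\<rho> \<noteq> {}" using R by simp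
    fix y assume y: "y \<in> ball c ?\<rho>"
    have yR: "y \<in> ball c R" using y \<delta> by (auto intro: less_le_trans)
    have "norm (lie_word ks y) \<le> (\<kappa> / step N) ^ (i - 1) * prod_list (map (majorant N) ks)"
      if ks: "ks \<in> splittings d \<alpha> i" and i: "2 \<le> i" for ks i
    proof -
      have len: "length ks = i" using ks by (simp add: splittings_def)
      have in_upto: "k \<in> mi_upto d N" if "k \<in> set ks" for k
        using sp[OF ks i] that n by (auto simp: lists_upto_def mi_upto_def)
      have "(\<Sum>k\<leftarrow>ks. real (mi_order d k) * step N) = real (mi_order d (mi_list_sum ks)) * step N"
        unfolding mi_order_list_sum by (induction ks) (auto simp: distrib_right)
      then have sum: "(\<Sum>k\<leftarrow>ks. real (mi_order d k) * step N) = real ?j * step N"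
        using sp[OF ks i] by simp
      show ?thesis
        unfolding len[symmetric]
      proof (rule lie_word_bound[where T = R and \<delta> = "step N" and wt = "\<lambda>k. real (mi_order d k) * step N"])
        show "ks \<noteq> []" using len i by auto
        show "k \<in> multi_indices d \<and> 1 \<le> mi_order d k \<and> step N \<le> real (mi_order d k) * step N"
          if "k \<in> set ks" for k
          using in_upto[OF that] \<delta> by (auto simp: mi_upto_def)
      qed (use \<delta> y sum majorant_upper[OF N in_upto] in auto)
    qed
    then have "norm (\<Sum>ks\<in>splittings d \<alpha> i. lie_word ks y) \<le> B i" if "2 \<le> i" for i
      unfolding B_def using that by (intro sum_norm_le) auto
    then have "norm (\<Sum>i=2..?j. (1 / fact i) *\<^sub>R (\<Sum>ks\<in>splittings d \<alpha> i. lie_word ks y))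
        \<le> (\<Sum>i=2..?j. B i / fact i)"
      by (intro sum_norm_le) (simp add: divide_right_mono)
    then show "norm (f \<alpha> y) \<le> K0 / r ^ ?j + (\<Sum>i=2..?j. B i / fact i)"
      unfolding modified_coeff_eq
      by (intro order_trans[OF norm_triangle_ineq4] add_mono g_bound \<alpha>' yR)
  qed
  then have "weight N \<alpha> \<le> \<kappa> / step N * (K0 / r ^ ?j + (\<Sum>i=2..?j. B i / fact i)) * reach N ^ ?j"
    unfolding weight_def using \<delta> reach_pos[OF N]
    by (intro mult_right_mono mult_left_mono) auto
  also have "\<dots> = \<kappa> / step N * K0 * (ratio / real N) ^ ?j
      + (\<Sum>i=2..?j. \<kappa> / step N * B i * reach N ^ ?j / fact i)"
  proof -
    have e: "(ratio / real N) ^ ?j = reach N ^ ?j / r ^ ?j"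
      using r unfolding reach_def power_mult_distrib by simp
    show ?thesis
      unfolding e by (simp add: distrib_left distrib_right sum_distrib_left sum_distrib_right)
  qed
  also have "(\<Sum>i=2..?j. \<kappa> / step N * B i * reach N ^ ?j / fact i)
     \<le> (\<Sum>i=2..Suc n. (\<Sum>ks\<in>words_to d n i \<alpha>. weights N ks) / fact i)"
  proof -
    have nonneg: "0 \<le> weights N ks" if "ks \<in> lists_upto d n i" for ks i
      using n that by (intro prod_weight_nonneg[OF N, of n]) auto
    have "\<kappa> / step N * B i * reach N ^ ?j \<le>
        (\<Sum>ks\<in>words_to d n i \<alpha>. weights N ks)" if i: "2 \<le> i" for i
    proof -
      have "\<kappa> / step N * B i * reach N ^ ?j = (\<Sum>ks\<in>splittings d \<alpha> i. weights N ks)"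
        unfolding B_def sum_distrib_left sum_distrib_right
      proof (rule sum.cong)
        fix ks assume ks: "ks \<in> splittings d \<alpha> i"
        then have "length ks = i" "ks \<noteq> []" using i by (auto simp: splittings_def)
        then show "\<kappa> / step N * ((\<kappa> / step N) ^ (i - 1) * prod_list (map (majorant N) ks)) * reach N ^ ?j
            = weights N ks"
          using word_weight[OF N, of ks] sp[OF ks i] \<delta> by (simp add: field_simps)
      qed simp
      also have "\<dots> \<le> (\<Sum>ks\<in>words_to d n i \<alpha>. weights N ks)"
        using sp i nonneg by (intro sum_mono2) auto
      finally show ?thesis .
    qed
    then have "(\<Sum>i=2..?j. \<kappa> / step N * B i * reach N ^ ?j / fact i)
     \<le> (\<Sum>i=2..?j. (\<Sum>ks\<in>words_to d n i \<alpha>. weights N ks) / fact i)"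
      by (intro sum_mono divide_right_mono) auto
    also have "\<dots> \<le> (\<Sum>i=2..Suc n. (\<Sum>ks\<in>words_to d n i \<alpha>. weights N ks) / fact i)"
      using \<alpha>'(3) nonneg by (intro sum_mono2) (auto intro!: divide_nonneg_nonneg sum_nonneg)
    finally show ?thesis .
  qed
  finally show ?thesis by simp
qed

text \<open>Summing the recursion over all \<open>\<alpha>\<close> turns the sum over splittings into powers of the sum \<open>S\<close> for the
  previous order. So the sum is at most \<open>1/4 + (exp S - 1 - S)\<close>, which keeps it below \<open>1/2\<close>.\<close>

lemma weight_sum_le:
  assumes N: "N \<ge> 1"
  shows "n \<le> N \<Longrightarrow> (\<Sum>\<alpha>\<in>mi_upto d n. weight N \<alpha>) \<le> 1/2"
proof (induction n)
  case 0
  have "mi_upto d 0 = {}" by (auto simp: mi_upto_def)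
  then show ?case by simp
next
  case (Suc n)
  define q where "q = ratio / real N"
  let ?S = "\<Sum>\<alpha>\<in>mi_upto d n. weight N \<alpha>"
  have S: "0 \<le> ?S" "?S \<le> 1/2"
    using Suc by (auto intro!: sum_nonneg weight_nonneg[OF N] simp: mi_upto_def)
  have q: "0 < q" "q \<le> 1/2"
  proof -
    have "q \<le> ratio / 1" unfolding q_def using N ratio_pos by (intro frac_le) auto
    then show "0 < q" "q \<le> 1/2" using ratio_pos N by (auto simp: q_def)
  qed
  have "(\<Sum>\<alpha>\<in>mi_upto d (Suc n). weight N \<alpha>) \<le>
      (\<Sum>\<alpha>\<in>mi_upto d (Suc n). \<kappa> / step N * K0 * q ^ mi_order d \<alpha>) +
      (\<Sum>\<alpha>\<in>mi_upto d (Suc n). \<Sum>i=2..Suc n.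
        (\<Sum>ks\<in>words_to d n i \<alpha>. weights N ks) / fact i)"
    unfolding sum.distrib[symmetric] q_def by (intro sum_mono weight_recursion[OF N Suc.prems])
  also have "(\<Sum>\<alpha>\<in>mi_upto d (Suc n). \<kappa> / step N * K0 * q ^ mi_order d \<alpha>) \<le> 1/4"
  proof -
    have "q ^ mi_order d \<alpha> \<le> 2 * q * (1/2) ^ mi_order d \<alpha>" if \<alpha>: "\<alpha> \<in> mi_upto d (Suc n)" for \<alpha>
    proof -
      obtain j where j: "mi_order d \<alpha> = Suc j" using \<alpha> by (cases "mi_order d \<alpha>") (auto simp: mi_upto_def)
      \<comment> \<open>One factor \<open>q\<close> is kept to compensate \<open>1 / step N\<close>; the others are traded for \<open>1/2\<close>.\<close>
      have "(2 * q) ^ j \<le> 1" using q by (intro power_le_one) auto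
      then have "2 * q * (2 * q) ^ j * (1/2) ^ Suc j \<le> 2 * q * 1 * (1/2) ^ Suc j"
        using q by (intro mult_right_mono mult_left_mono) auto
      moreover have "q ^ Suc j = 2 * q * (2 * q) ^ j * (1/2) ^ Suc j"
        by (simp add: power_mult_distrib power_divide)
      ultimately show ?thesis unfolding j by (simp only: mult_1_right)
    qed
    then have "(\<Sum>\<alpha>\<in>mi_upto d (Suc n). q ^ mi_order d \<alpha>) \<le>
        (\<Sum>\<alpha>\<in>mi_upto d (Suc n). 2 * q * (1/2) ^ mi_order d \<alpha>)"
      by (rule sum_mono)
    also have "\<dots> = 2 * q * (\<Sum>\<alpha>\<in>mi_upto d (Suc n). (1/2) ^ mi_order d \<alpha>)"
      by (simp add: sum_distrib_left)
    also have "\<dots> \<le> 2 * q * 2 ^ Suc d"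
      using q by (intro mult_left_mono sum_geometric_mi_upto finite_mi_upto mi_upto_subset) auto
    finally have "(\<Sum>\<alpha>\<in>mi_upto d (Suc n). q ^ mi_order d \<alpha>) \<le> 2 * q * 2 ^ Suc d" .
    then have "\<kappa> / step N * K0 * (\<Sum>\<alpha>\<in>mi_upto d (Suc n). q ^ mi_order d \<alpha>)
        \<le> \<kappa> / step N * K0 * (2 * q * 2 ^ Suc d)"
      using K0 step_pos[OF N] by (intro mult_left_mono) auto
    also have "\<dots> = ratio * (4 * \<kappa> * K0 * 2 ^ (d + 4)) / R / 4"
      using N R by (simp add: step_def q_def field_simps power_add)
    also have "\<dots> \<le> 1/4"
    proof -
      have p: "4 * \<kappa> * K0 * 2 ^ (d + 4) > 0" using K0 by simp
      have "ratio * (4 * \<kappa> * K0 * 2 ^ (d + 4)) \<le>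
          R / (4 * \<kappa> * K0 * 2 ^ (d + 4)) * (4 * \<kappa> * K0 * 2 ^ (d + 4))"
        using p by (intro mult_right_mono) (auto simp: ratio_def)
      also have "\<dots> = R" using K0 by simp
      finally show ?thesis using R by (simp add: field_simps)
    qed
    finally show ?thesis by (simp add: sum_distrib_left)
  qed
  also have "(\<Sum>\<alpha>\<in>mi_upto d (Suc n). \<Sum>i=2..Suc n.
        (\<Sum>ks\<in>words_to d n i \<alpha>. weights N ks) / fact i)
      \<le> (\<Sum>i=2..Suc n. ?S ^ i / fact i)"
  proof -
    have "(\<Sum>\<alpha>\<in>mi_upto d (Suc n). \<Sum>ks\<in>words_to d n i \<alpha>. weights N ks)
        \<le> ?S ^ i" for i
    proof -
      have "(\<Sum>\<alpha>\<in>mi_upto d (Suc n). \<Sum>ks\<in>words_to d n i \<alpha>. weights N ks)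
        = (\<Sum>ks\<in>(\<Union>\<alpha>\<in>mi_upto d (Suc n). words_to d n i \<alpha>). weights N ks)"
        by (rule sum.UNION_disjoint[symmetric]) auto
      also have "\<dots> \<le> (\<Sum>ks\<in>lists_upto d n i. weights N ks)"
        using prod_weight_nonneg[OF N, of n] Suc.prems by (intro sum_mono2) auto
      also have "\<dots> = ?S ^ i" by (rule sum_prod_lists_upto)
      finally show ?thesis .
    qed
    then have "(\<Sum>i=2..Suc n. (\<Sum>\<alpha>\<in>mi_upto d (Suc n).
        \<Sum>ks\<in>words_to d n i \<alpha>. weights N ks) / fact i)
        \<le> (\<Sum>i=2..Suc n. ?S ^ i / fact i)"
      by (intro sum_mono divide_right_mono) auto
    then show ?thesis by (subst sum.swap) (simp add: sum_divide_distrib)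
  qed
  also have "(\<Sum>i=2..Suc n. ?S ^ i / fact i) \<le> 1/4"
    by (rule sum_power_fact_le[OF S])
  finally show ?case by simp
qed

end

section \<open>Solutions of autonomous equations\<close>

text \<open>Picard iteration on the whole interval at once: since \<open>T * L \<le> 1/2\<close> the iterates converge geometrically in
  the supremum norm.\<close>

lemma picard_existence:
  fixes F :: "'a::euclidean_space \<Rightarrow> 'a"
  assumes T: "T > 0" and \<rho>: "\<rho> \<ge> 0" and L: "L \<ge> 0"
    and lip: "\<And>x y. x \<in> cball c \<rho> \<Longrightarrow> y \<in> cball c \<rho> \<Longrightarrow> norm (F x - F y) \<le> L * norm (x - y)"
    and bound: "\<And>x. x \<in> cball c \<rho> \<Longrightarrow> norm (F x) \<le> B"
    and TB: "T * B \<le> \<rho>" and TL: "T * L \<le> 1/2"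
  shows "\<exists>y. y 0 = c \<and> (\<forall>t\<in>{0..T}. y t \<in> cball c \<rho> \<and>
    (y has_vector_derivative F (y t)) (at t within {0..T}))"
proof -
  define u :: "nat \<Rightarrow> real \<Rightarrow> 'a" where "u = rec_nat (\<lambda>t. c) (\<lambda>n v t. c + integral {0..t} (\<lambda>s. F (v s)))"
  have u0: "u 0 t = c" and uS: "u (Suc n) t = c + integral {0..t} (\<lambda>s. F (u n s))" for n t
    by (simp_all add: u_def)
  have B: "B \<ge> 0" using order_trans[OF norm_ge_zero bound[of c]] \<rho> by simp
  have F_cont: "continuous_on (cball c \<rho>) F"
    by (rule lipschitz_on_continuous_on[of L]) (use lip L in \<open>auto simp: lipschitz_on_def dist_norm\<close>)
  have comp_cont: "continuous_on {0..t} (\<lambda>s. F (v s))"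
    if v: "continuous_on {0..T} v" "\<forall>s\<in>{0..T}. v s \<in> cball c \<rho>" and t: "t \<in> {0..T}" for v t
  proof -
    have "{0..t} \<subseteq> {0..T}" using t by auto
    with v show ?thesis
      by (intro continuous_on_compose2[OF F_cont]) (auto intro: continuous_on_subset)
  qed
  have int_bound: "norm (integral {0..t} (\<lambda>s. F (v s))) \<le> \<rho>"
    if v: "continuous_on {0..T} v" "\<forall>s\<in>{0..T}. v s \<in> cball c \<rho>" and t: "t \<in> {0..T}" for v t
  proof -
    have "norm (integral {0..t} (\<lambda>s. F (v s))) \<le> B * (t - 0)"
      using t v by (intro integral_bound comp_cont[OF v] bound) auto
    also have "\<dots> \<le> B * T" using t B by (intro mult_left_mono) auto
    finally show ?thesis using TB by (simp add: mult.commute)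
  qed
  have inv: "continuous_on {0..T} (u n) \<and> (\<forall>t\<in>{0..T}. u n t \<in> cball c \<rho>)" for n
  proof (induction n)
    case 0
    show ?case using \<rho> by (simp add: u0[abs_def] continuous_on_const)
  next
    case (Suc n)
    have "(\<lambda>s. F (u n s)) integrable_on {0..T}"
      using Suc T by (intro integrable_continuous_real comp_cont) auto
    then have "continuous_on {0..T} (\<lambda>t. c + integral {0..t} (\<lambda>s. F (u n s)))"
      by (intro continuous_on_add continuous_on_const indefinite_integral_continuous_1)
    moreover have "u (Suc n) t \<in> cball c \<rho>" if "t \<in> {0..T}" for t
      using int_bound[of "u n" t] Suc that by (simp add: uS dist_norm)
    ultimately show ?case by (simp add: uS[abs_def])
  qed
  have int_diff: "norm (integral {0..t} (\<lambda>s. F (v s)) - integral {0..t} (\<lambda>s. F (w s))) \<le> e / 2"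
    if v: "continuous_on {0..T} v" "\<forall>s\<in>{0..T}. v s \<in> cball c \<rho>"
      and w: "continuous_on {0..T} w" "\<forall>s\<in>{0..T}. w s \<in> cball c \<rho>"
      and e: "\<forall>s\<in>{0..T}. norm (v s - w s) \<le> e" and t: "t \<in> {0..T}" for v w t e
  proof -
    have e0: "e \<ge> 0" using order_trans[OF norm_ge_zero] e t by blast
    note cv = comp_cont[OF v t] and cw = comp_cont[OF w t]
    have "integral {0..t} (\<lambda>s. F (v s)) - integral {0..t} (\<lambda>s. F (w s))
        = integral {0..t} (\<lambda>s. F (v s) - F (w s))"
      by (rule integral_diff[symmetric]) (intro integrable_continuous_real cv cw)+
    also have "norm \<dots> \<le> (L * e) * (t - 0)"
    proof (rule integral_bound)
      show "norm (F (v s) - F (w s)) \<le> L * e" if "s \<in> {0..t}" for s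
      proof -
        have s: "s \<in> {0..T}" using that t by auto
        have "norm (F (v s) - F (w s)) \<le> L * norm (v s - w s)"
          using v(2) w(2) s by (intro lip) auto
        also have "\<dots> \<le> L * e" using e s L by (intro mult_left_mono) auto
        finally show ?thesis .
      qed
    qed (use t in \<open>auto intro: continuous_on_diff cv cw\<close>)
    also have "\<dots> \<le> (L * e) * T" using t L e0 by (intro mult_left_mono) auto
    also have "\<dots> = (T * L) * e" by simp
    also have "\<dots> \<le> 1/2 * e" using TL e0 by (rule mult_right_mono)
    finally show ?thesis by simp
  qed
  have step: "\<forall>t\<in>{0..T}. norm (u (Suc n) t - u n t) \<le> \<rho> * (1/2) ^ n" for n
  proof (induction n)
    case 0
    show ?case using int_bound[of "u 0"] inv[of 0] by (simp add: uS u0)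
  next
    case (Suc n)
    show ?case
    proof
      fix t assume t: "t \<in> {0..T}"
      have "norm (u (Suc (Suc n)) t - u (Suc n) t) \<le> (\<rho> * (1/2) ^ n) / 2"
        unfolding uS[of "Suc n"] uS[of n t] add_diff_cancel_left
        using inv Suc t by (intro int_diff) auto
      then show "norm (u (Suc (Suc n)) t - u (Suc n) t) \<le> \<rho> * (1/2) ^ Suc n" by simp
    qed
  qed
  have far: "norm (u (n + p) t - u n t) \<le> 2 * \<rho> * ((1/2) ^ n - (1/2) ^ (n + p))" if "t \<in> {0..T}" for n p t
  proof (induction p)
    case (Suc p)
    have "norm (u (n + Suc p) t - u n t) \<le> norm (u (Suc (n + p)) t - u (n + p) t) + norm (u (n + p) t - u n t)"
      using norm_triangle_ineq[of "u (Suc (n + p)) t - u (n + p) t" "u (n + p) t - u n t"] by simp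
    also have "\<dots> \<le> \<rho> * (1/2) ^ (n + p) + 2 * \<rho> * ((1/2) ^ n - (1/2) ^ (n + p))"
      using step[of "n + p"] that Suc by (intro add_mono) auto
    finally show ?case by (simp add: algebra_simps)
  qed simp
  have far': "norm (u m t - u n t) \<le> 2 * \<rho> * (1/2) ^ n" if t: "t \<in> {0..T}" and "m \<ge> n" for m n t
  proof -
    obtain p where "m = n + p" using \<open>m \<ge> n\<close> le_Suc_ex by blast
    then have "norm (u m t - u n t) \<le> 2 * \<rho> * ((1/2) ^ n - (1/2) ^ (n + p))" using far[OF t] by simp
    also have "\<dots> \<le> 2 * \<rho> * (1/2) ^ n" using \<rho> by (intro mult_left_mono) auto
    finally show ?thesis .
  qed
  have rate0: "(\<lambda>n. 2 * \<rho> * (1/2) ^ n) \<longlonglongrightarrow> 0"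
    by (intro tendsto_mult_right_zero LIMSEQ_power_zero) auto
  define U where "U t = lim (\<lambda>n. u n t)" for t
  have lim: "(\<lambda>n. u n t) \<longlonglongrightarrow> U t" if t: "t \<in> {0..T}" for t
    unfolding U_def by (rule geometric_steps_tendsto[where K = \<rho>]) (use step t in blast)
  have rate: "norm (u n t - U t) \<le> 2 * \<rho> * (1/2) ^ n" if t: "t \<in> {0..T}" for n t
  proof (rule LIMSEQ_le_const2)
    show "(\<lambda>m. norm (u n t - u m t)) \<longlonglongrightarrow> norm (u n t - U t)"
      by (intro tendsto_intros lim t)
    show "\<exists>N. \<forall>m\<ge>N. norm (u n t - u m t) \<le> 2 * \<rho> * (1/2) ^ n"
      by (intro exI[of _ n] allI impI, subst norm_minus_commute, rule far'[OF t])
  qed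
  have unif: "uniform_limit {0..T} u U sequentially"
  proof (rule uniform_limitI)
    fix e :: real assume "e > 0"
    from order_tendstoD(2)[OF rate0 this]
    show "\<forall>\<^sub>F n in sequentially. \<forall>t\<in>{0..T}. dist (u n t) (U t) < e"
    proof eventually_elim
      case (elim n)
      then show ?case using le_less_trans[OF rate] by (simp add: dist_norm)
    qed
  qed
  have Ucont: "continuous_on {0..T} U"
    by (rule uniform_limit_theorem[OF _ unif]) (use inv in auto)
  have Uin: "\<forall>t\<in>{0..T}. U t \<in> cball c \<rho>"
    using closed_sequentially[OF closed_cball _ lim] inv by blast
  have fixpt: "U t = c + integral {0..t} (\<lambda>s. F (U s))" if t: "t \<in> {0..T}" for t
  proof (rule LIMSEQ_unique)
    show "(\<lambda>n. u (Suc n) t) \<longlonglongrightarrow> U t" by (rule LIMSEQ_Suc[OF lim[OF t]])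
    have half: "norm (u (Suc n) t - (c + integral {0..t} (\<lambda>s. F (U s)))) \<le> 2 * \<rho> * (1/2) ^ n / 2" for n
      unfolding uS add_diff_cancel_left using inv Ucont Uin rate t by (intro int_diff) auto
    have "norm (u (Suc n) t - (c + integral {0..t} (\<lambda>s. F (U s)))) \<le> 2 * \<rho> * (1/2) ^ n" for n
      by (rule order_trans[OF half]) (use \<rho> in simp)
    then have "(\<lambda>n. u (Suc n) t - (c + integral {0..t} (\<lambda>s. F (U s)))) \<longlonglongrightarrow> 0"
      by (intro Lim_null_comparison[OF _ rate0]) auto
    then show "(\<lambda>n. u (Suc n) t) \<longlonglongrightarrow> c + integral {0..t} (\<lambda>s. F (U s))"
      by (simp only: LIM_zero_iff)
  qed
  have "(U has_vector_derivative F (U t)) (at t within {0..T})" if t: "t \<in> {0..T}" for t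
  proof -
    have "((\<lambda>v. c + integral {0..v} (\<lambda>s. F (U s))) has_vector_derivative 0 + F (U t)) (at t within {0..T})"
      using comp_cont[OF Ucont Uin, of T] T t
      by (intro has_vector_derivative_add has_vector_derivative_const integral_has_vector_derivative) auto
    then have "((\<lambda>v. c + integral {0..v} (\<lambda>s. F (U s))) has_vector_derivative F (U t)) (at t within {0..T})"
      by simp
    then show ?thesis
      by (rule has_vector_derivative_transform[OF t fixpt, rotated])
  qed
  moreover have "U 0 = c" using fixpt[of 0] T by simp
  ultimately show ?thesis using Uin by blast
qed

text \<open>At the first time of leaving the ball the solution would have travelled a distance \<open>\<rho>\<close> with speed at
  most \<open>B\<close> in time at most \<open>T\<close>.\<close>

lemma solution_stays:
  fixes F :: "'a::euclidean_space \<Rightarrow> 'a"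
  assumes T: "T > 0" and y0: "y 0 = c"
    and ode: "\<And>t. t \<in> {0..T} \<Longrightarrow> (y has_vector_derivative F (y t)) (at t within {0..T})"
    and bound: "\<And>x. x \<in> ball c \<rho> \<Longrightarrow> norm (F x) \<le> B" and TB: "T * B < \<rho>" and \<rho>: "\<rho> > 0"
    and t: "t \<in> {0..T}"
  shows "y t \<in> ball c \<rho>"
proof (rule ccontr)
  assume "y t \<notin> ball c \<rho>"
  have ycont: "continuous_on {0..T} y"
    using ode by (meson continuous_on_eq_continuous_within has_vector_derivative_continuous)
  have B: "B \<ge> 0" using order_trans[OF norm_ge_zero bound[of c]] \<rho> by simp
  define S where "S = {0..T} \<inter> (\<lambda>t. dist c (y t)) -` {\<rho>..}"
  have "closed S"
    unfolding S_def by (intro continuous_closed_preimage continuous_intros ycont closed_atLeast)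
  moreover have "bounded S" by (rule bounded_subset[of "{0..T}"]) (auto simp: S_def)
  ultimately have "compact S" by (simp add: compact_eq_bounded_closed)
  moreover have "S \<noteq> {}" using \<open>y t \<notin> ball c \<rho>\<close> t by (auto simp: S_def)
  ultimately have "\<exists>t0\<in>S. \<forall>s\<in>S. t0 \<le> s" by (rule compact_attains_inf)
  then obtain t0 where t0: "t0 \<in> S" "\<And>s. s \<in> S \<Longrightarrow> t0 \<le> s" by blast
  have t0': "0 \<le> t0" "t0 \<le> T" "dist c (y t0) \<ge> \<rho>" using t0(1) by (auto simp: S_def)
  have "t0 \<noteq> 0" using t0'(3) y0 \<rho> by auto
  then have pos: "0 < t0" using t0'(1) by simp
  have "norm (y t0 - y 0) \<le> B * t0 - B * 0"
  proof (rule differentiable_bound_general[OF pos])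
    show "continuous_on {0..t0} y" using ycont t0' by (auto intro: continuous_on_subset)
    show "continuous_on {0..t0} (\<lambda>t. B * t)" by (intro continuous_intros)
    fix s assume s: "0 < s" "s < t0"
    have sT: "s \<in> {0..T}" using s t0' by auto
    have "at s within {0..T} = at s" using s t0' by (intro at_within_Icc_at) auto
    then show "(y has_vector_derivative F (y s)) (at s)" using ode[OF sT] by simp
    show "((\<lambda>t. B * t) has_vector_derivative B) (at s)"
      by (auto intro!: derivative_eq_intros simp: has_real_derivative_iff_has_vector_derivative[symmetric])
    have "s \<notin> S" using t0(2)[of s] s by auto
    then have "y s \<in> ball c \<rho>" using sT by (auto simp: S_def)
    then show "norm (F (y s)) \<le> B" by (rule bound)
  qed
  also have "\<dots> \<le> T * B" using t0' B by (simp add: mult.commute mult_left_mono)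
  finally have "norm (y t0 - y 0) < \<rho>" using TB by linarith
  then show False using t0'(3) y0 by (simp add: dist_norm norm_minus_commute)
qed

section \<open>Flow of the truncated modified equation\<close>

context coeff_family
begin

text \<open>On the ball of radius \<open>3 * R / 4\<close> all coefficients of order at most \<open>N\<close> are below their majorants, so words
  of length up to \<open>N + 1\<close> are controlled on half the original ball.\<close>

lemma word_bound:
  assumes N: "N \<ge> 1" and ks: "ks \<in> lists_upto d N i" and i: "1 \<le> i" "i \<le> Suc N"
    and y: "y \<in> ball c (R / 2)"
  shows "norm (lie_word ks y) * reach N ^ mi_order d (mi_list_sum ks) \<le> step N / \<kappa> * weights N ks"
proof -
  let ?\<delta> = "step N"
  have \<delta>: "?\<delta> > 0" by (rule step_pos[OF N])
  have len: "length ks = i" and k: "\<And>k. k \<in> set ks \<Longrightarrow> k \<in> mi_upto d N"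
    using ks by (auto simp: lists_upto_def)
  have ne: "ks \<noteq> []" using len i by auto
  have N\<delta>: "real N * ?\<delta> = R / 4" using N by (simp add: step_def)
  have "norm (lie_word ks y) \<le> (\<kappa> / ?\<delta>) ^ (length ks - 1) * prod_list (map (majorant N) ks)"
  \<comment> \<open>The extra \<open>?\<delta>\<close> in \<open>T\<close> makes \<open>T - wt k\<close> equal to \<open>3 * R / 4\<close>, the radius on which all letters are controlled.\<close>
  proof (rule lie_word_bound[where T = "3 * R / 4 + ?\<delta>" and \<delta> = ?\<delta> and wt = "\<lambda>_. ?\<delta>"])
    show "3 * R / 4 + ?\<delta> \<le> R + ?\<delta>" using R by simp
    show "k \<in> multi_indices d \<and> 1 \<le> mi_order d k \<and> ?\<delta> \<le> ?\<delta>" if "k \<in> set ks" for k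
      using k[OF that] by (auto simp: mi_upto_def)
    have "real i * ?\<delta> \<le> real (Suc N) * ?\<delta>" using i \<delta> by (intro mult_right_mono) auto
    also have "\<dots> = R / 4 + ?\<delta>" using N\<delta> by (simp add: distrib_right)
    finally have "R / 2 \<le> 3 * R / 4 + ?\<delta> - real i * ?\<delta>" by simp
    then show "y \<in> ball c (3 * R / 4 + ?\<delta> - (\<Sum>k\<leftarrow>ks. ?\<delta>))"
      using y len by (simp add: sum_list_triv)
    fix k v assume kk: "k \<in> set ks" and v: "v \<in> ball c (3 * R / 4 + ?\<delta> - ?\<delta>)"
    have "real (mi_order d k) * ?\<delta> \<le> R / 4"
      using k[OF kk] by (intro order_step_le N) (auto simp: mi_upto_def)
    then have "v \<in> ball c (R - real (mi_order d k) * ?\<delta>)" using v by simp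
    then show "norm (f k v) \<le> majorant N k" by (rule majorant_upper[OF N k[OF kk]])
  qed (use \<delta> ne in auto)
  then have "norm (lie_word ks y) * reach N ^ mi_order d (mi_list_sum ks) \<le>
      (\<kappa> / ?\<delta>) ^ (length ks - 1) * prod_list (map (majorant N) ks) * reach N ^ mi_order d (mi_list_sum ks)"
    using reach_pos[OF N] by (intro mult_right_mono) auto
  also have "\<dots> = ?\<delta> / \<kappa> * weights N ks" by (rule word_weight[OF N ne])
  finally show ?thesis .
qed

end

text \<open>The increments are \<open>e\<close> times smaller than \<open>reach N\<close>: every unit of order gains a factor \<open>exp (- 1)\<close> over the
  majorant series.\<close>

locale truncated_flow = coeff_family d g c R K0 r \<kappa>
  for d and g :: "multi_index \<Rightarrow> complex ^ 'm \<Rightarrow> complex ^ 'm" and c R K0 r \<kappa> +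
  fixes N :: nat and h :: real and \<Delta> :: "nat \<Rightarrow> real"
  assumes N: "N \<ge> 1" and h: "h > 0" "h \<le> reach N / exp 1"
    and \<Delta>: "\<forall>l\<in>{1..d}. \<bar>\<Delta> l\<bar> \<le> reach N / exp 1"
begin

abbreviation "field \<equiv> modified_field d g N h \<Delta>"
abbreviation "m \<equiv> mi_monomial d h \<Delta>"

abbreviation "word_term ks y \<equiv> m (mi_list_sum ks) *\<^sub>R lie_word ks y"
abbreviation "truncated_step y \<equiv> \<Sum>\<alpha>\<in>mi_upto d N. m \<alpha> *\<^sub>R g \<alpha> y"

lemma monomial_le: "\<bar>m \<alpha>\<bar> \<le> reach N ^ mi_order d \<alpha> * exp (- real (mi_order d \<alpha>))"
proof -
  have "\<bar>m \<alpha>\<bar> \<le> (reach N / exp 1) ^ mi_order d \<alpha>"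
    using h \<Delta> by (intro mi_monomial_bound) auto
  also have "\<dots> = reach N ^ mi_order d \<alpha> * exp (- real (mi_order d \<alpha>))"
    by (simp add: power_divide exp_of_nat_mult[symmetric] exp_minus field_simps)
  finally show ?thesis .
qed

lemma word_term_bound:
  assumes ks: "ks \<in> lists_upto d N i" and i: "1 \<le> i" "i \<le> Suc N" and y: "y \<in> ball c (R / 2)"
    and n: "n \<le> mi_order d (mi_list_sum ks)"
  shows "norm (word_term ks y) \<le> exp (- real n) * (step N / \<kappa>) * weights N ks"
proof -
  let ?j = "mi_order d (mi_list_sum ks)"
  have "norm (word_term ks y) \<le>
      (reach N ^ ?j * exp (- real ?j)) * norm (lie_word ks y)"
    unfolding norm_scaleR by (intro mult_right_mono monomial_le) simp
  also have "\<dots> = exp (- real ?j) * (norm (lie_word ks y) * reach N ^ ?j)" by simp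
  also have "\<dots> \<le> exp (- real ?j) * (step N / \<kappa> * weights N ks)"
    by (intro mult_left_mono word_bound[OF N ks i y]) simp
  also have "\<dots> \<le> exp (- real n) * (step N / \<kappa> * weights N ks)"
    using n step_pos[OF N] prod_weight_nonneg[OF N order_refl ks]
    by (intro mult_right_mono) auto
  finally show ?thesis by (simp add: mult.assoc)
qed

lemma field_eq: "h *\<^sub>R field y = (\<Sum>\<alpha>\<in>mi_upto d N. m \<alpha> *\<^sub>R f \<alpha> y)"
proof -
  have "h * (h powi (int (\<alpha> 0) - 1) * (\<Prod>l=1..d. \<Delta> l ^ \<alpha> l)) = m \<alpha>" for \<alpha> :: multi_index
  proof -
    have "h * h powi (int (\<alpha> 0) - 1) = h powi (1 + (int (\<alpha> 0) - 1))"
      using h by (subst power_int_add) auto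
    then show ?thesis by (simp add: mi_monomial_def)
  qed
  then show ?thesis
    unfolding modified_field_def scaleR_sum_right scaleR_scaleR mi_upto_def by simp
qed

lemma field_holo: "vholo (ball c R) field"
  unfolding vholo_def modified_field_def
proof (intro ballI cdiff_sum cdiff_scaleR)
  fix y \<alpha> assume "y \<in> ball c R" and "\<alpha> \<in> {\<alpha>. \<alpha> \<in> multi_indices d \<and> 1 \<le> mi_order d \<alpha> \<and> mi_order d \<alpha> \<le> N}"
  then show "cdiff (f \<alpha>) y"
    using vholoD[OF modified_coeff_holo] by blast
qed

text \<open>In time \<open>h\<close> the modified flow moves by at most half a unit \<open>step N / \<kappa>\<close>.\<close>

lemma field_bound:
  assumes y: "y \<in> ball c (3 * R / 4)"
  shows "h * norm (field y) \<le> step N / (2 * \<kappa>)"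
proof -
  have "h * norm (field y) = norm (h *\<^sub>R field y)" using h by simp
  also have "\<dots> \<le> (\<Sum>\<alpha>\<in>mi_upto d N. step N / \<kappa> * weight N \<alpha>)"
    unfolding field_eq
  proof (rule sum_norm_le)
    fix \<alpha> assume \<alpha>: "\<alpha> \<in> mi_upto d N"
    have "real (mi_order d \<alpha>) * step N \<le> R / 4"
      using \<alpha> by (intro order_step_le N) (auto simp: mi_upto_def)
    then have y': "y \<in> ball c (R - real (mi_order d \<alpha>) * step N)" using y by simp
    have "\<bar>m \<alpha>\<bar> \<le> reach N ^ mi_order d \<alpha> * exp (- real (mi_order d \<alpha>))" by (rule monomial_le)
    also have "\<dots> \<le> reach N ^ mi_order d \<alpha> * 1"
      using reach_pos[OF N] by (intro mult_left_mono) auto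
    finally have "norm (m \<alpha> *\<^sub>R f \<alpha> y) \<le> reach N ^ mi_order d \<alpha> * majorant N \<alpha>"
      unfolding norm_scaleR using majorant_upper[OF N \<alpha> y'] reach_pos[OF N] by (intro mult_mono) auto
    also have "\<dots> = step N / \<kappa> * weight N \<alpha>" using step_pos[OF N] by (simp add: weight_def)
    finally show "norm (m \<alpha> *\<^sub>R f \<alpha> y) \<le> step N / \<kappa> * weight N \<alpha>" .
  qed
  also have "\<dots> = step N / \<kappa> * (\<Sum>\<alpha>\<in>mi_upto d N. weight N \<alpha>)" by (simp add: sum_distrib_left)
  also have "\<dots> \<le> step N / \<kappa> * (1/2)"
    using step_pos[OF N] by (intro mult_left_mono weight_sum_le[OF N]) auto
  finally show ?thesis by simp
qed

lemma field_lipschitz: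
  assumes "x \<in> cball c (R / 2)" "y \<in> cball c (R / 2)"
  shows "norm (field x - field y) \<le> 1 / (2 * h) * norm (x - y)"
proof (rule differentiable_bound[where S = "cball c (R / 2)" and f' = "\<lambda>x. frechet_derivative field (at x)"])
  fix x assume x: "x \<in> cball c (R / 2)"
  have sub: "ball x (R / 4) \<subseteq> ball c (3 * R / 4)"
  proof
    fix v assume "v \<in> ball x (R / 4)"
    then show "v \<in> ball c (3 * R / 4)" using x dist_triangle[of c v x] by simp
  qed
  have sub': "ball x (R / 4) \<subseteq> ball c R" using sub subset_ball[of "3 * R / 4" R c] R by auto
  have "x \<in> ball c R" using x R by simp
  from cdiff_frechet(1)[OF vholoD[OF field_holo this]]
  show "(field has_derivative frechet_derivative field (at x)) (at x within cball c (R / 2))"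
    by (rule has_derivative_at_withinI)
  have "norm (frechet_derivative field (at x) v) \<le> 1 / (2 * h) * norm v" for v
  proof -
    have "norm (frechet_derivative field (at x) v) \<le> real CARD('m) * (step N / (2 * \<kappa>) / h) * norm v / (R / 4)"
    proof (rule frechet_derivative_bound)
      show "vholo (ball x (R / 4)) field" by (rule vholo_subset[OF field_holo sub'])
      fix v assume "v \<in> ball x (R / 4)"
      then have "h * norm (field v) \<le> step N / (2 * \<kappa>)" using sub by (intro field_bound) auto
      then show "norm (field v) \<le> step N / (2 * \<kappa>) / h" using h by (simp add: field_simps)
    qed (use R in auto)
    also have "\<dots> = (4 * step N / R) * (1 / (2 * h) * norm v)" using R h by (simp add: \<kappa> field_simps)
    also have "\<dots> \<le> 1 * (1 / (2 * h) * norm v)"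
      using N R h by (intro mult_right_mono) (auto simp: step_def)
    finally show ?thesis by simp
  qed
  then show "onorm (frechet_derivative field (at x)) \<le> 1 / (2 * h)" by (rule onorm_le)
qed (use assms in auto)

text \<open>The \<open>(i + 1)\<close>-st time derivative of a solution \<open>y\<close> is \<open>lie_power i (y t)\<close>.\<close>

primrec lie_power where
  "lie_power 0 = field"
| "lie_power (Suc i) = lie_deriv field (lie_power i)"

lemma lie_power_holo: "vholo (ball c R) (lie_power i)"
  by (induction i) (auto intro: field_holo vholo_lie_deriv)

text \<open>Multilinearity of iterated Lie derivatives, with the power of \<open>h\<close> absorbing the \<open>1 / h\<close> in the modified
  field.\<close>

lemma lie_power_eq:
  "y \<in> ball c R \<Longrightarrow> h ^ Suc i *\<^sub>R lie_power i y
    = (\<Sum>ks\<in>lists_upto d N (Suc i). word_term ks y)"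
proof (induction i arbitrary: y)
  case 0
  have "(\<Sum>ks\<in>lists_upto d N (Suc 0). word_term ks y)
      = (\<Sum>\<alpha>\<in>mi_upto d N. m \<alpha> *\<^sub>R f \<alpha> y)"
    by (simp add: sum_lists_upto_Suc lists_upto_0)
  then show ?case using field_eq[of y] by simp
next
  case (Suc i)
  let ?L = "lists_upto d N (Suc i)"
  let ?D = "\<lambda>ks. frechet_derivative (lie_word ks) (at y)"
  have ne: "ks \<noteq> []" if "ks \<in> ?L" for ks using that by (auto simp: lists_upto_def)
  have cd: "cdiff (lie_word ks) y" if ks: "ks \<in> ?L" for ks
  proof -
    have "vholo (ball c R) (lie_word ks)"
      using ks ne[OF ks] by (intro lie_word_holo modified_coeff_holo) (auto simp: lists_upto_def mi_upto_def)
    then show ?thesis using vholoD Suc.prems by blast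
  qed
  have D: "(lie_word ks has_derivative ?D ks) (at y)" if "ks \<in> ?L" for ks
    by (rule cdiff_frechet(1)[OF cd[OF that]])
  have lin: "linear (?D ks)" if "ks \<in> ?L" for ks using has_derivative_linear[OF D[OF that]] .
  have "((\<lambda>y. h ^ Suc i *\<^sub>R lie_power i y) has_derivative
      (\<lambda>v. h ^ Suc i *\<^sub>R frechet_derivative (lie_power i) (at y) v)) (at y)"
    by (intro has_derivative_scaleR_right cdiff_frechet(1) vholoD[OF lie_power_holo] Suc.prems)
  moreover have "((\<lambda>y. h ^ Suc i *\<^sub>R lie_power i y) has_derivative
      (\<lambda>v. \<Sum>ks\<in>?L. m (mi_list_sum ks) *\<^sub>R ?D ks v)) (at y)"
  proof (rule has_derivative_transform_within_open[OF _ open_ball Suc.prems])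
    show "((\<lambda>y. \<Sum>ks\<in>?L. word_term ks y) has_derivative
      (\<lambda>v. \<Sum>ks\<in>?L. m (mi_list_sum ks) *\<^sub>R ?D ks v)) (at y)"
      by (intro has_derivative_sum has_derivative_scaleR_right D)
  qed (use Suc.IH in simp)
  ultimately have eq: "(\<lambda>v. h ^ Suc i *\<^sub>R frechet_derivative (lie_power i) (at y) v)
      = (\<lambda>v. \<Sum>ks\<in>?L. m (mi_list_sum ks) *\<^sub>R ?D ks v)"
    by (rule has_derivative_unique)
  have linp: "linear (frechet_derivative (lie_power i) (at y))"
    by (intro has_derivative_linear[OF cdiff_frechet(1)] vholoD[OF lie_power_holo] Suc.prems)
  have "h ^ Suc (Suc i) *\<^sub>R lie_power (Suc i) y
      = h ^ Suc i *\<^sub>R frechet_derivative (lie_power i) (at y) (h *\<^sub>R field y)"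
    by (simp add: lie_deriv_def linear_scale[OF linp] mult_ac)
  also have "\<dots> = (\<Sum>ks\<in>?L. m (mi_list_sum ks) *\<^sub>R ?D ks (h *\<^sub>R field y))"
    using fun_cong[OF eq] .
  also have "\<dots> = (\<Sum>ks\<in>?L. \<Sum>k\<in>mi_upto d N. m (mi_list_sum (k # ks)) *\<^sub>R lie_word (k # ks) y)"
  proof (rule sum.cong)
    fix ks assume ks: "ks \<in> ?L"
    have "?D ks (h *\<^sub>R field y) = (\<Sum>k\<in>mi_upto d N. m k *\<^sub>R ?D ks (f k y))"
      unfolding field_eq by (simp add: linear_sum[OF lin[OF ks]] linear_scale[OF lin[OF ks]])
    then show "m (mi_list_sum ks) *\<^sub>R ?D ks (h *\<^sub>R field y)
        = (\<Sum>k\<in>mi_upto d N. m (mi_list_sum (k # ks)) *\<^sub>R lie_word (k # ks) y)"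
      unfolding mi_monomial_list_sum using ne[OF ks]
      by (simp add: scaleR_sum_right lie_deriv_def mult.commute)
  qed simp
  also have "\<dots> = (\<Sum>ks\<in>lists_upto d N (Suc (Suc i)). word_term ks y)"
    unfolding sum_lists_upto_Suc[of _ d N "Suc i"] by (rule sum.swap)
  finally show ?case .
qed

text \<open>The defining recursion solved for the step coefficient: the coefficient \<open>f\<^sub>\<alpha>\<close> itself is the one-letter word, and
  words longer than the order of \<open>\<alpha>\<close> do not occur.\<close>

lemma coeff_expansion:
  assumes \<alpha>: "\<alpha> \<in> mi_upto d N"
  shows "g \<alpha> y = (\<Sum>i=1..N. (1 / fact i) *\<^sub>R (\<Sum>ks\<in>words_to d N i \<alpha>. lie_word ks y))"
proof -
  have \<alpha>': "\<alpha> \<in> multi_indices d" "1 \<le> mi_order d \<alpha>" "mi_order d \<alpha> \<le> N"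
    using \<alpha> by (auto simp: mi_upto_def)
  let ?t = "\<lambda>i. (1 / fact i) *\<^sub>R (\<Sum>ks\<in>words_to d N i \<alpha>. lie_word ks y)"
  have one: "words_to d N 1 \<alpha> = {[\<alpha>]}"
    using \<alpha> by (auto simp: lists_upto_def length_Suc_conv)
  have "?t i = 0" if "i \<in> {1..N} - {1..mi_order d \<alpha>}" for i
  proof -
    have "words_to d N i \<alpha> = {}"
      using length_le_order[of _ d N] that by (auto simp: lists_upto_def)
    then show ?thesis by (simp only: sum.empty scaleR_zero_right)
  qed
  then have "(\<Sum>i=1..N. ?t i) = (\<Sum>i=1..mi_order d \<alpha>. ?t i)"
    using \<alpha>'(3) by (intro sum.mono_neutral_right) auto
  also have "\<dots> = ?t 1 + (\<Sum>i=2..mi_order d \<alpha>. ?t i)"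
    using \<alpha>'(2) by (simp add: sum.atLeast_Suc_atMost numeral_2_eq_2)
  also have "\<dots> = f \<alpha> y + (\<Sum>i=2..mi_order d \<alpha>. (1 / fact i) *\<^sub>R (\<Sum>ks\<in>splittings d \<alpha> i. lie_word ks y))"
    unfolding splittings_eq[OF \<alpha>'(1,3)] one by simp
  also have "\<dots> = g \<alpha> y" unfolding modified_coeff_eq by simp
  finally show ?thesis by simp
qed

text \<open>Group the words of order at most \<open>N\<close> by their sum: the flow reproduces the step expansion up to order
  \<open>N\<close>.\<close>

lemma low_order_terms:
  "(\<Sum>i=1..N. (1 / fact i) *\<^sub>R (\<Sum>ks | ks \<in> lists_upto d N i \<and> mi_order d (mi_list_sum ks) \<le> N.
      word_term ks y)) = truncated_step y"
proof -
  let ?F = "\<lambda>ks. word_term ks y"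
  have "truncated_step y
      = (\<Sum>\<alpha>\<in>mi_upto d N. \<Sum>i=1..N. (1 / fact i) *\<^sub>R (\<Sum>ks\<in>words_to d N i \<alpha>. ?F ks))"
  proof (rule sum.cong)
    fix \<alpha> assume \<alpha>: "\<alpha> \<in> mi_upto d N"
    show "m \<alpha> *\<^sub>R g \<alpha> y = (\<Sum>i=1..N. (1 / fact i) *\<^sub>R (\<Sum>ks\<in>words_to d N i \<alpha>. ?F ks))"
      by (subst coeff_expansion[OF \<alpha>]) (simp add: scaleR_sum_right mult.commute)
  qed simp
  also have "\<dots> = (\<Sum>i=1..N. (1 / fact i) *\<^sub>R (\<Sum>\<alpha>\<in>mi_upto d N. \<Sum>ks\<in>words_to d N i \<alpha>. ?F ks))"
    by (subst sum.swap) (simp add: scaleR_sum_right)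
  also have "\<dots> = (\<Sum>i=1..N. (1 / fact i) *\<^sub>R (\<Sum>ks | ks \<in> lists_upto d N i \<and> mi_order d (mi_list_sum ks) \<le> N. ?F ks))"
  proof (rule sum.cong)
    fix i assume i: "i \<in> {1..N}"
    let ?S = "{ks. ks \<in> lists_upto d N i \<and> mi_order d (mi_list_sum ks) \<le> N}"
    have sub: "mi_list_sum ` ?S \<subseteq> mi_upto d N"
    proof
      fix \<alpha> assume "\<alpha> \<in> mi_list_sum ` ?S"
      then obtain ks where ks: "ks \<in> lists_upto d N i" "mi_order d \<alpha> \<le> N" "\<alpha> = mi_list_sum ks" by auto
      have "set ks \<subseteq> mi_upto d N" "length ks = i" using ks(1) by (auto simp: lists_upto_def)
      moreover from this have "\<alpha> \<in> multi_indices d"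
        unfolding ks(3) using mi_upto_subset by (intro mi_list_sum_indices) blast
      ultimately show "\<alpha> \<in> mi_upto d N"
        using length_le_order[of ks d N] ks i by (auto simp: mi_upto_def)
    qed
    have "(\<Sum>\<alpha>\<in>mi_upto d N. \<Sum>ks\<in>words_to d N i \<alpha>. ?F ks)
        = (\<Sum>\<alpha>\<in>mi_upto d N. \<Sum>ks | ks \<in> ?S \<and> mi_list_sum ks = \<alpha>. ?F ks)"
      by (intro sum.cong) (auto simp: mi_upto_def)
    also have "\<dots> = (\<Sum>ks\<in>?S. ?F ks)"
      using sub by (intro sum.group) auto
    finally show "(1 / fact i) *\<^sub>R (\<Sum>\<alpha>\<in>mi_upto d N. \<Sum>ks\<in>words_to d N i \<alpha>. ?F ks)
        = (1 / fact i) *\<^sub>R (\<Sum>ks\<in>?S. ?F ks)" by simp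
  qed simp
  finally show ?thesis by simp
qed

text \<open>Summing over words gives the \<open>i\<close>-th power of the sum of weights, which is at most \<open>1/2\<close>.\<close>

lemma word_sum_bound:
  assumes i: "1 \<le> i" "i \<le> Suc N" and y: "y \<in> ball c (R / 2)" and L: "L \<subseteq> lists_upto d N i"
    and n: "\<And>ks. ks \<in> L \<Longrightarrow> n \<le> mi_order d (mi_list_sum ks)"
  shows "norm (\<Sum>ks\<in>L. word_term ks y) \<le> exp (- real n) * R * (1/2) ^ i"
proof -
  have "norm (\<Sum>ks\<in>L. word_term ks y)
      \<le> (\<Sum>ks\<in>L. exp (- real n) * (step N / \<kappa>) * weights N ks)"
    using L n by (intro sum_norm_le word_term_bound[OF _ i y]) auto
  also have "\<dots> \<le> (\<Sum>ks\<in>lists_upto d N i. exp (- real n) * (step N / \<kappa>) * weights N ks)"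
    using L step_pos[OF N] prod_weight_nonneg[OF N order_refl] by (intro sum_mono2) auto
  also have "\<dots> = exp (- real n) * (step N / \<kappa>) * (\<Sum>\<alpha>\<in>mi_upto d N. weight N \<alpha>) ^ i"
    unfolding sum_distrib_left[symmetric] sum_prod_lists_upto by (rule refl)
  also have "\<dots> \<le> exp (- real n) * R * (1/2) ^ i"
  proof (intro mult_mono power_mono mult_left_mono)
    have "step N / \<kappa> \<le> step N / 1" using step_pos[OF N] by (intro divide_left_mono) (auto simp: \<kappa>)
    also have "\<dots> \<le> R" using N R by (simp add: step_def field_simps)
    finally show "step N / \<kappa> \<le> R" .
    show "(\<Sum>\<alpha>\<in>mi_upto d N. weight N \<alpha>) \<le> 1/2" by (rule weight_sum_le[OF N order_refl])
  qed (use R less_imp_le[OF step_pos[OF N]] weight_nonneg[OF N] in \<open>auto intro!: sum_nonneg zero_le_power\<close>)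
  finally show ?thesis .
qed

text \<open>Taylor's formula of order \<open>N\<close> for the solution. The Taylor terms split into words of order at most \<open>N\<close>, which
  give the step expansion, and words of higher order; those and the remainder, whose words
  have \<open>N + 1\<close> letters, carry the factor \<open>exp (- N)\<close>.\<close>

lemma flow_expansion_error:
  assumes y0: "y 0 = c"
    and ode: "\<And>t. t \<in> {0..h} \<Longrightarrow> (y has_vector_derivative field (y t)) (at t within {0..h})"
    and stay: "\<And>t. t \<in> {0..h} \<Longrightarrow> y t \<in> ball c (R / 2)"
  shows "norm (y h - c - truncated_step c) \<le> 2 * R * exp (- real N)"
proof -
  define Df where "Df i = (case i of 0 \<Rightarrow> y | Suc j \<Rightarrow> \<lambda>t. lie_power j (y t))" for i
  have Df_simps: "Df 0 = y" "Df (Suc j) = (\<lambda>t. lie_power j (y t))" for j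
    by (simp_all add: Df_def)
  have deriv: "(Df i has_vector_derivative Df (Suc i) t) (at t within {0..h})" if t: "0 \<le> t" "t \<le> h" for i t
  proof (cases i)
    case 0
    then show ?thesis using ode[of t] t by (simp add: Df_simps)
  next
    case (Suc j)
    have yt: "y t \<in> ball c R" using stay[of t] t R by simp
    have "((lie_power j \<circ> y) has_vector_derivative frechet_derivative (lie_power j) (at (y t)) (field (y t)))
        (at t within {0..h})"
      using ode[of t] t has_derivative_at_withinI[OF cdiff_frechet(1)[OF vholoD[OF lie_power_holo yt]]]
      by (intro vector_derivative_diff_chain_within) auto
    then show ?thesis by (simp add: Suc Df_simps o_def lie_deriv_def)
  qed
  have "((\<lambda>x. ((h - x) ^ (Suc N - 1) / fact (Suc N - 1)) *\<^sub>R Df (Suc N) x) has_integral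
      y h - (\<Sum>i<Suc N. ((h - 0) ^ i / fact i) *\<^sub>R Df i 0)) {0..h}"
    by (rule Taylor_has_integral) (use deriv h in \<open>auto simp: Df_simps\<close>)
  then have int: "((\<lambda>x. ((h - x) ^ N / fact N) *\<^sub>R lie_power N (y x)) has_integral
      y h - (\<Sum>i<Suc N. (h ^ i / fact i) *\<^sub>R Df i 0)) (cbox 0 h)"
    by (simp add: Df_simps)
  have rem: "norm (y h - (\<Sum>i<Suc N. (h ^ i / fact i) *\<^sub>R Df i 0)) \<le> R * exp (- real N)"
  proof -
    have "norm (((h - x) ^ N / fact N) *\<^sub>R lie_power N (y x)) \<le> R * exp (- real N) / h" if x: "x \<in> cbox 0 h" for x
    proof -
      have yx: "y x \<in> ball c (R / 2)" using stay x by simp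
      then have yR: "y x \<in> ball c R" using R by simp
      have "h ^ Suc N * norm (lie_power N (y x)) = norm (h ^ Suc N *\<^sub>R lie_power N (y x))"
        using h by simp
      also have "\<dots> \<le> exp (- real N) * R * (1/2) ^ Suc N"
        unfolding lie_power_eq[OF yR]
      proof (rule word_sum_bound[OF _ _ yx subset_refl])
        fix ks assume "ks \<in> lists_upto d N (Suc N)"
        then show "N \<le> mi_order d (mi_list_sum ks)"
          using length_le_order[of ks d N] by (auto simp: lists_upto_def)
      qed auto
      also have "\<dots> \<le> exp (- real N) * R * 1"
        using R by (intro mult_left_mono power_le_one) auto
      finally have *: "h ^ N * norm (lie_power N (y x)) \<le> R * exp (- real N) / h"
        using h by (simp add: field_simps)
      have "(h - x) ^ N / fact N \<le> h ^ N / 1"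
        using x h by (intro frac_le power_mono) auto
      then have "\<bar>(h - x) ^ N / fact N\<bar> \<le> h ^ N" using x by simp
      then have "norm (((h - x) ^ N / fact N) *\<^sub>R lie_power N (y x)) \<le> h ^ N * norm (lie_power N (y x))"
        unfolding norm_scaleR by (rule mult_right_mono) simp
      with * show ?thesis by linarith
    qed
    from has_integral_bound[OF _ int this]
    show ?thesis using h R by simp
  qed
  have cR: "c \<in> ball c R" "c \<in> ball c (R / 2)" using R by auto
  let ?F = "\<lambda>ks. word_term ks c"
  let ?lo = "\<lambda>i. {ks. ks \<in> lists_upto d N i \<and> mi_order d (mi_list_sum ks) \<le> N}"
  let ?hi = "\<lambda>i. {ks. ks \<in> lists_upto d N i \<and> \<not> mi_order d (mi_list_sum ks) \<le> N}"
  have split_term: "(h ^ i / fact i) *\<^sub>R Df i 0 = (1 / fact i) *\<^sub>R (\<Sum>ks\<in>?lo i. ?F ks) + (1 / fact i) *\<^sub>R (\<Sum>ks\<in>?hi i. ?F ks)"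
    if i: "i \<in> {1..N}" for i
  proof -
    obtain j where j: "i = Suc j" using i by (cases i) auto
    have "h ^ i *\<^sub>R Df i 0 = (\<Sum>ks\<in>lists_upto d N i. ?F ks)"
      unfolding j Df_simps y0 by (rule lie_power_eq[OF cR(1)])
    also have "\<dots> = (\<Sum>ks\<in>?lo i \<union> ?hi i. ?F ks)" by (rule sum.cong) auto
    also have "\<dots> = (\<Sum>ks\<in>?lo i. ?F ks) + (\<Sum>ks\<in>?hi i. ?F ks)"
      by (rule sum.union_disjoint) auto
    finally have "(1 / fact i) *\<^sub>R (h ^ i *\<^sub>R Df i 0) = (1 / fact i) *\<^sub>R ((\<Sum>ks\<in>?lo i. ?F ks) + (\<Sum>ks\<in>?hi i. ?F ks))"
      by (rule arg_cong)
    then show ?thesis by (simp add: scaleR_add_right)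
  qed
  have "(\<Sum>i<Suc N. (h ^ i / fact i) *\<^sub>R Df i 0) = c + (\<Sum>i=1..N. (h ^ i / fact i) *\<^sub>R Df i 0)"
    unfolding sum.lessThan_Suc_shift One_nat_def sum.atLeast1_atMost_eq by (simp add: Df_simps y0)
  also have "(\<Sum>i=1..N. (h ^ i / fact i) *\<^sub>R Df i 0)
      = truncated_step c + (\<Sum>i=1..N. (1 / fact i) *\<^sub>R (\<Sum>ks\<in>?hi i. ?F ks))"
    unfolding low_order_terms[symmetric] sum.distrib[symmetric] by (rule sum.cong[OF refl split_term])
  finally have sum_eq: "(\<Sum>i<Suc N. (h ^ i / fact i) *\<^sub>R Df i 0)
      = c + (truncated_step c + (\<Sum>i=1..N. (1 / fact i) *\<^sub>R (\<Sum>ks\<in>?hi i. ?F ks)))" .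
  have hi: "norm (\<Sum>i=1..N. (1 / fact i) *\<^sub>R (\<Sum>ks\<in>?hi i. ?F ks)) \<le> R * exp (- real N)"
  proof -
    have "norm (\<Sum>i=1..N. (1 / fact i) *\<^sub>R (\<Sum>ks\<in>?hi i. ?F ks)) \<le> (\<Sum>i=1..N. exp (- real N) * R * (1/2) ^ i)"
    proof (rule sum_norm_le)
      fix i assume i: "i \<in> {1..N}"
      have "norm (\<Sum>ks\<in>?hi i. ?F ks) \<le> exp (- real N) * R * (1/2) ^ i"
        using i by (intro word_sum_bound cR) auto
      moreover have "(1 / fact i :: real) \<le> 1" by simp
      ultimately have "(1 / fact i) * norm (\<Sum>ks\<in>?hi i. ?F ks) \<le> 1 * (exp (- real N) * R * (1/2) ^ i)"
        by (intro mult_mono) auto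
      then show "norm ((1 / fact i) *\<^sub>R (\<Sum>ks\<in>?hi i. ?F ks)) \<le> exp (- real N) * R * (1/2) ^ i"
        by simp
    qed
    also have "\<dots> = exp (- real N) * R * (\<Sum>i=1..N. (1/2) ^ i)" by (simp add: sum_distrib_left)
    also have "\<dots> \<le> exp (- real N) * R * 1"
    proof (intro mult_left_mono)
      have "(\<Sum>i=1..n. (1/2::real) ^ i) = 1 - (1/2) ^ n" for n
        by (induction n) auto
      then show "(\<Sum>i=1..N. (1/2::real) ^ i) \<le> 1" by simp
    qed (use R in auto)
    finally show ?thesis by (simp add: mult.commute)
  qed
  have "y h - c - truncated_step c
      = (y h - (\<Sum>i<Suc N. (h ^ i / fact i) *\<^sub>R Df i 0)) + (\<Sum>i=1..N. (1 / fact i) *\<^sub>R (\<Sum>ks\<in>?hi i. ?F ks))"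
    unfolding sum_eq by simp
  also have "norm \<dots> \<le> R * exp (- real N) + R * exp (- real N)"
    by (intro order_trans[OF norm_triangle_ineq] add_mono rem hi)
  finally show ?thesis by simp
qed

text \<open>Beyond order \<open>N\<close> the actual increments gain \<open>exp (- N)\<close> over increments of size \<open>reach N\<close>, at which the
  expansion is dominated by a geometric series of ratio \<open>1/2\<close>.\<close>

lemma expansion_tail:
  assumes Y: "((\<lambda>\<alpha>. m \<alpha> *\<^sub>R g \<alpha> c) has_sum D) {\<alpha> \<in> multi_indices d. mi_order d \<alpha> \<ge> 1}"
  shows "norm (D - truncated_step c) \<le> K0 * 2 ^ Suc d * exp (- real N)"
proof -
  let ?A = "{\<alpha> \<in> multi_indices d. mi_order d \<alpha> \<ge> 1}"
  have "((\<lambda>\<alpha>. m \<alpha> *\<^sub>R g \<alpha> c) has_sum truncated_step c) (mi_upto d N)"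
    by (rule has_sum_finite) simp
  from has_sum_Diff[OF Y this]
  have tail: "((\<lambda>\<alpha>. m \<alpha> *\<^sub>R g \<alpha> c) has_sum (D - truncated_step c)) (?A - mi_upto d N)"
    by (auto simp: mi_upto_def)
  have fin: "norm (\<Sum>\<alpha>\<in>X. m \<alpha> *\<^sub>R g \<alpha> c) \<le> K0 * 2 ^ Suc d * exp (- real N)"
    if X: "finite X" "X \<subseteq> ?A - mi_upto d N" for X
  proof -
    have "norm (\<Sum>\<alpha>\<in>X. m \<alpha> *\<^sub>R g \<alpha> c) \<le> (\<Sum>\<alpha>\<in>X. K0 * exp (- real N) * (1/2) ^ mi_order d \<alpha>)"
    proof (rule sum_norm_le)
      fix \<alpha> assume "\<alpha> \<in> X"
      then have \<alpha>: "\<alpha> \<in> multi_indices d" "1 \<le> mi_order d \<alpha>" "N \<le> mi_order d \<alpha>"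
        using X by (auto simp: mi_upto_def)
      let ?j = "mi_order d \<alpha>"
      have "norm (m \<alpha> *\<^sub>R g \<alpha> c) \<le> (reach N ^ ?j * exp (- real ?j)) * (K0 / r ^ ?j)"
        unfolding norm_scaleR using R reach_pos[OF N]
        by (intro mult_mono monomial_le g_bound \<alpha>) auto
      also have "\<dots> = K0 * exp (- real ?j) * (ratio / real N) ^ ?j"
        using r unfolding reach_def power_mult_distrib by simp
      also have "\<dots> \<le> K0 * exp (- real N) * (1/2) ^ ?j"
      proof (intro mult_mono power_mono mult_left_mono)
        have "ratio / real N \<le> ratio / 1" using N ratio_pos by (intro divide_left_mono) auto
        then show "ratio / real N \<le> 1/2" using ratio_pos(2) by linarith
      qed (use \<alpha> K0 ratio_pos in auto)
      finally show "norm (m \<alpha> *\<^sub>R g \<alpha> c) \<le> K0 * exp (- real N) * (1/2) ^ ?j" .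
    qed
    also have "\<dots> = K0 * exp (- real N) * (\<Sum>\<alpha>\<in>X. (1/2) ^ mi_order d \<alpha>)" by (simp add: sum_distrib_left)
    also have "\<dots> \<le> K0 * exp (- real N) * 2 ^ Suc d"
      using X K0 by (intro mult_left_mono sum_geometric_mi_upto) auto
    finally show ?thesis by (simp add: mult_ac)
  qed
  show ?thesis
  proof (rule tendsto_upperbound)
    show "((\<lambda>X. norm (\<Sum>\<alpha>\<in>X. m \<alpha> *\<^sub>R g \<alpha> c)) \<longlongrightarrow> norm (D - truncated_step c))
        (finite_subsets_at_top (?A - mi_upto d N))"
      using tail unfolding has_sum_def by (rule tendsto_norm)
    show "\<forall>\<^sub>F X in finite_subsets_at_top (?A - mi_upto d N).
        norm (\<Sum>\<alpha>\<in>X. m \<alpha> *\<^sub>R g \<alpha> c) \<le> K0 * 2 ^ Suc d * exp (- real N)"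
      by (rule eventually_finite_subsets_at_top_weakI) (rule fin)
  qed simp
qed

lemma step_le: "step N / (2 * \<kappa>) \<le> R / 8"
proof -
  have "step N / (2 * \<kappa>) \<le> step N / 2" using step_pos[OF N] by (intro divide_left_mono) (auto simp: \<kappa>)
  also have "\<dots> \<le> R / 8" using N R by (simp add: step_def field_simps)
  finally show ?thesis .
qed

lemma field_speed:
  assumes "x \<in> ball c (3 * R / 4)"
  shows "norm (field x) \<le> R / 8 / h"
  using order_trans[OF field_bound[OF assms] step_le] h by (simp add: field_simps)

lemma flow_exists:
  "\<exists>y. y 0 = c \<and> (\<forall>t\<in>{0..h}. y t \<in> cball c (R / 2) \<and> (y has_vector_derivative field (y t)) (at t within {0..h}))"
proof (rule picard_existence[where L = "1 / (2 * h)" and B = "R / 8 / h"])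
  show "norm (field x) \<le> R / 8 / h" if "x \<in> cball c (R / 2)" for x
    using that R by (intro field_speed) simp
qed (use h R field_lipschitz in auto)

text \<open>Every solution, not only the one obtained by iteration, moves by less than \<open>R / 2\<close>, so the two expansions
  can be compared along it.\<close>

theorem truncation_error:
  assumes y0: "y 0 = c"
    and ode: "\<And>t. t \<in> {0..h} \<Longrightarrow> (y has_vector_derivative field (y t)) (at t within {0..h})"
    and Y: "((\<lambda>\<alpha>. m \<alpha> *\<^sub>R g \<alpha> c) has_sum (Y - c)) {\<alpha> \<in> multi_indices d. mi_order d \<alpha> \<ge> 1}"
  shows "norm (y h - Y) \<le> (2 * R + K0 * 2 ^ Suc d) * exp (- real N)"
proof -
  have stay: "y t \<in> ball c (R / 2)" if t: "t \<in> {0..h}" for t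
  proof (rule solution_stays[where B = "R / 8 / h", OF h(1) y0 ode])
    show "norm (field x) \<le> R / 8 / h" if "x \<in> ball c (R / 2)" for x
      using that R by (intro field_speed) simp
  qed (use h R t in auto)
  have "y h - Y = (y h - c - truncated_step c) - (Y - c - truncated_step c)"
    by simp
  also have "norm \<dots> \<le> 2 * R * exp (- real N) + K0 * 2 ^ Suc d * exp (- real N)"
    by (intro order_trans[OF norm_triangle_ineq4] add_mono flow_expansion_error[OF y0 ode stay] expansion_tail[OF Y])
  finally show ?thesis by (simp add: distrib_right)
qed

end

section \<open>Exponentially small error\<close>

lemma trunc_increment_bound:
  assumes "h > 0" "k \<ge> 0"
  shows "\<bar>trunc_increment k h x\<bar> \<le> trunc_level k h * sqrt h"
proof -
  have "trunc_level k h \<ge> 0" using assms by (simp add: trunc_level_def)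
  then have "\<bar>truncate_at (trunc_level k h) x\<bar> \<le> trunc_level k h" by (auto simp: truncate_at_def)
  then show ?thesis using assms by (simp add: trunc_increment_def abs_mult mult_right_mono)
qed

text \<open>The largest increment tends to \<open>0\<close> faster than \<open>h powr (1/2 - \<epsilon>)\<close> by a power of \<open>h\<close>, in spite of the logarithm; this
  surplus absorbs the constant \<open>w\<close> and the factor \<open>h\<close>.\<close>

lemma small_step_asymptotics:
  fixes k w \<epsilon> r :: real
  assumes "k \<ge> 1" "w > 0" "0 < \<epsilon>" "\<epsilon> < 1/2" "r > 0"
  shows "\<forall>\<^sub>F h in at_right 0. 0 < h \<and> h \<le> trunc_level k h * sqrt h \<and>
    trunc_level k h * sqrt h < min r w \<and>
    exp (- (w / (trunc_level k h * sqrt h))) \<le> h * exp (- 1 / h powr (1/2 - \<epsilon>))"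
proof -
  have k: "k > 0" using assms by simp
  have small: "\<forall>\<^sub>F h in at_right 0. h \<le> sqrt (k * \<bar>ln h\<bar>) * sqrt h"
    using k by real_asymp
  have decay: "\<forall>\<^sub>F h in at_right 0.
      exp (- (w / (sqrt (k * \<bar>ln h\<bar>) * sqrt h))) \<le> h * exp (- 1 / h powr (1/2 - \<epsilon>))"
    using k assms by real_asymp
  have "((\<lambda>h. sqrt (k * \<bar>ln h\<bar>) * sqrt h) \<longlongrightarrow> 0) (at_right 0)"
    using k by real_asymp
  moreover have "0 < min r w" using assms by simp
  ultimately have "\<forall>\<^sub>F h in at_right 0. sqrt (k * \<bar>ln h\<bar>) * sqrt h < min r w"
    by (rule order_tendstoD(2))
  with small decay eventually_at_right_less[of "0::real"] show ?thesis
    unfolding trunc_level_def by eventually_elim (intro conjI)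
qed

theorem theorem4p3:
  fixes P :: "'w measure"
    and \<xi> :: "real \<Rightarrow> nat \<Rightarrow> 'w \<Rightarrow> real"
    and V :: "nat \<Rightarrow> complex ^ 'm \<Rightarrow> complex ^ 'm"
    and z :: "real ^ 'm"
    and a :: "nat \<Rightarrow> nat \<Rightarrow> real" and b :: "nat \<Rightarrow> real"
    and d s :: nat
    and \<epsilon> R M k :: real
  assumes "prob_space P"
    and "\<And>h. h > 0 \<Longrightarrow> prob_space.indep_vars P (\<lambda>_. borel) (\<xi> h) {1..d}"
    and "\<And>h l. h > 0 \<Longrightarrow> l \<in> {1..d} \<Longrightarrow> distributed P lborel (\<xi> h l) std_normal_density"
    and "k \<ge> 1"
    and "0 < \<epsilon>" and "\<epsilon> < 1 / 2"
    and "R > 0" and "M > 0"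
    and "\<And>l. l \<le> d \<Longrightarrow> vec_analytic_on (V l) (cball (complexify z) (2 * R))"
    and "\<And>l y. l \<le> d \<Longrightarrow> y \<in> cball (complexify z) (2 * R) \<Longrightarrow> norm (V l y) \<le> M"
  shows "\<exists>C>0. \<exists>h\<^sub>0>0. \<forall>\<^sub>F h in at_right 0. \<exists>N\<ge>1. \<forall>\<omega>\<in>space P.
    (let \<Delta> = (\<lambda>l. trunc_increment k h (\<xi> h l \<omega>));
         B = cball (complexify z) (2 * R);
         F = modified_field d (rk_coeff d s a b V B) N h \<Delta>;
         is_step = rk_step d s a b V B h \<Delta> (complexify z);
         is_sol = ode_solution_on F (ball (complexify z) (2 * R)) h (complexify z)
     in (\<exists>Y. is_step Y) \<and> (\<exists>y. is_sol y) \<and>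
        (\<forall>Y y. is_step Y \<longrightarrow> is_sol y \<longrightarrow>
           norm (y h - Y) \<le> C * h * exp (- h\<^sub>0 / h powr (1 / 2 - \<epsilon>))))"
proof -
  define c where "c = complexify z"
  interpret rk: analytic_rk d s a b V c R M
  proof
    show "vholo (cball c (2 * R)) (V l)" if l: "l \<le> d" for l
      unfolding vholo_def
    proof
      fix y assume "y \<in> cball c (2 * R)"
      then obtain e where "e > 0" "\<forall>y'\<in>ball y e. cdiff (V l) y'"
        using assms(9)[OF l] unfolding vec_analytic_on_def c_def by blast
      then show "cdiff (V l) y" by simp
    qed
    show "norm (V l y) \<le> M" if "l \<le> d" "y \<in> cball c (2 * R)" for l y
      using assms(10)[OF that(1)] that(2) unfolding c_def by blast
  qed (use assms in auto)
  define K0 where "K0 = real CARD('m) * (R / 2)"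
  interpret cf: coeff_family d rk.step_coeff c R K0 rk.radius "real CARD('m)"
  proof
    show "norm (rk.step_coeff \<alpha> y) \<le> K0 / rk.radius ^ mi_order d \<alpha>"
      if "\<alpha> \<in> multi_indices d" "mi_order d \<alpha> \<ge> 1" "y \<in> ball c R" for \<alpha> y
      using rk.rk_coeff_analytic(2)[OF that] by (simp add: K0_def)
  qed (use assms rk.radius_pos rk.rk_coeff_analytic(1) in \<open>auto simp: K0_def\<close>)
  define w where "w = cf.reach 1 / exp 1"
  have w: "w > 0" using cf.reach_pos[of 1] by (simp add: w_def)
  \<comment> \<open>The factor \<open>exp 1\<close> pays for rounding \<open>w / \<delta>\<close> down to an integer.\<close>
  define C where "C = (2 * R + K0 * 2 ^ Suc d) * exp 1"
  have K0: "K0 > 0" using assms(7) by (simp add: K0_def)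
  have C: "C > 0" using assms(7) K0 by (simp add: C_def add_pos_pos)
  define good where "good N h \<Delta> E \<longleftrightarrow>
      (\<exists>Y. rk.one_step h \<Delta> c Y) \<and>
      (\<exists>y. ode_solution_on (modified_field d rk.step_coeff N h \<Delta>) (ball c (2 * R)) h c y) \<and>
      (\<forall>Y y. rk.one_step h \<Delta> c Y \<longrightarrow>
         ode_solution_on (modified_field d rk.step_coeff N h \<Delta>) (ball c (2 * R)) h c y \<longrightarrow>
         norm (y h - Y) \<le> E)" for N h \<Delta> and E :: real
  have main: "\<exists>N\<ge>1. \<forall>\<Delta>. (\<forall>l\<in>{1..d}. \<bar>\<Delta> l\<bar> \<le> \<delta>) \<longrightarrow> good N h \<Delta> (C * exp (- (w / \<delta>)))"
    if h: "0 < h" "h \<le> \<delta>" and \<delta>: "\<delta> < min rk.radius w" for h \<delta>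
  proof -
    \<comment> \<open>The largest \<open>N\<close> for which increments of size \<open>\<delta>\<close> are within \<open>reach N / exp 1 = w / N\<close>.\<close>
    define N where "N = nat \<lfloor>w / \<delta>\<rfloor>"
    have \<delta>pos: "\<delta> > 0" using h by simp
    have "w / \<delta> \<ge> 1" using \<delta> \<delta>pos by simp
    then have fl: "\<lfloor>w / \<delta>\<rfloor> \<ge> 1" by (simp add: le_floor_iff)
    then have iN: "int N = \<lfloor>w / \<delta>\<rfloor>" unfolding N_def by (intro nat_0_le) linarith
    have N: "N \<ge> 1" using iN fl by linarith
    have rN: "real N = of_int \<lfloor>w / \<delta>\<rfloor>" unfolding iN[symmetric] by simp
    have Nle: "real N \<le> w / \<delta>" and Nge: "w / \<delta> - 1 \<le> real N" unfolding rN by linarith+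
    have \<delta>reach: "\<delta> \<le> cf.reach N / exp 1"
    proof -
      have "\<delta> * real N \<le> w" using Nle \<delta>pos by (simp add: field_simps)
      moreover have "cf.reach N / exp 1 = w / real N" by (simp add: w_def cf.reach_def)
      ultimately show ?thesis using N by (simp only: pos_le_divide_eq[of "real N" \<delta> w])
    qed
    show ?thesis
    proof (intro exI[of _ N] conjI N allI impI)
      fix \<Delta> :: "nat \<Rightarrow> real" assume \<Delta>: "\<forall>l\<in>{1..d}. \<bar>\<Delta> l\<bar> \<le> \<delta>"
      interpret tf: truncated_flow d rk.step_coeff c R K0 rk.radius "real CARD('m)" N h \<Delta>
        by unfold_locales (use N h \<delta>reach \<Delta> in \<open>auto intro: order_trans\<close>)
      have hr: "\<bar>h\<bar> < rk.radius" and \<Delta>r: "\<forall>l\<in>{1..d}. \<bar>\<Delta> l\<bar> < rk.radius"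
        using h \<delta> \<Delta> by (auto intro: le_less_trans)
      have cR: "c \<in> ball c R" using assms(7) by simp
      have step: "\<exists>Y. rk.one_step h \<Delta> c Y"
        using rk.rk_coeff_analytic(3)[OF hr \<Delta>r cR] by blast
      obtain y where "y 0 = c" "\<forall>t\<in>{0..h}. y t \<in> cball c (R / 2) \<and>
          (y has_vector_derivative tf.field (y t)) (at t within {0..h})"
        using tf.flow_exists by blast
      then have sol: "ode_solution_on tf.field (ball c (2 * R)) h c y"
        using assms(7) by (auto simp: ode_solution_on_def)
      have err: "norm (y h - Y) \<le> C * exp (- (w / \<delta>))"
        if Y: "rk.one_step h \<Delta> c Y"
          and y: "ode_solution_on tf.field (ball c (2 * R)) h c y" for Y y
      proof -
        have "norm (y h - Y) \<le> (2 * R + K0 * 2 ^ Suc d) * exp (- real N)"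
          using y rk.rk_coeff_analytic(4)[OF hr \<Delta>r cR Y]
          by (intro tf.truncation_error) (auto simp: ode_solution_on_def mi_monomial_def)
        also have "\<dots> \<le> (2 * R + K0 * 2 ^ Suc d) * exp (1 - w / \<delta>)"
          using Nge assms(7) K0 by (intro mult_left_mono) auto
        also have "\<dots> = C * exp (- (w / \<delta>))"
          by (simp add: C_def exp_add[symmetric] mult.assoc)
        finally show ?thesis .
      qed
      show "good N h \<Delta> (C * exp (- (w / \<delta>)))"
        unfolding good_def using step sol err by blast
    qed
  qed
  show ?thesis
    unfolding c_def[symmetric]
  proof (rule exI[of _ C], rule conjI[OF C], rule exI[of _ 1], rule conjI[OF zero_less_one])
    show "\<forall>\<^sub>F h in at_right 0. \<exists>N\<ge>1. \<forall>\<omega>\<in>space P.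
      (let \<Delta> = (\<lambda>l. trunc_increment k h (\<xi> h l \<omega>));
         B = cball c (2 * R);
         F = modified_field d (rk_coeff d s a b V B) N h \<Delta>;
         is_step = rk_step d s a b V B h \<Delta> c;
         is_sol = ode_solution_on F (ball c (2 * R)) h c
       in (\<exists>Y. is_step Y) \<and> (\<exists>y. is_sol y) \<and>
        (\<forall>Y y. is_step Y \<longrightarrow> is_sol y \<longrightarrow>
           norm (y h - Y) \<le> C * h * exp (- 1 / h powr (1 / 2 - \<epsilon>))))"
      using small_step_asymptotics[OF assms(4) w assms(5,6) rk.radius_pos]
    proof eventually_elim
      case (elim h)
      let ?\<delta> = "trunc_level k h * sqrt h"
      have "0 < h" "h \<le> ?\<delta>" "?\<delta> < min rk.radius w"
        and decay: "exp (- (w / ?\<delta>)) \<le> h * exp (- 1 / h powr (1/2 - \<epsilon>))" using elim by blast+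
      from main[OF this(1-3)] obtain N where N: "N \<ge> 1" and
        all: "\<And>\<Delta>. (\<forall>l\<in>{1..d}. \<bar>\<Delta> l\<bar> \<le> ?\<delta>) \<Longrightarrow> good N h \<Delta> (C * exp (- (w / ?\<delta>)))"
        by blast
      have le: "C * exp (- (w / ?\<delta>)) \<le> C * h * exp (- 1 / h powr (1/2 - \<epsilon>))"
        using mult_left_mono[OF decay, of C] C by (simp add: mult.assoc)
      show ?case
      proof (intro exI[of _ N] conjI N ballI)
        fix \<omega>
        have "\<forall>l\<in>{1..d}. \<bar>trunc_increment k h (\<xi> h l \<omega>)\<bar> \<le> ?\<delta>"
          using trunc_increment_bound[OF \<open>0 < h\<close>] assms(4) by simp
        from all[OF this, unfolded good_def] order_trans[OF _ le]
        show "let \<Delta> = (\<lambda>l. trunc_increment k h (\<xi> h l \<omega>));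
           B = cball c (2 * R);
           F = modified_field d (rk_coeff d s a b V B) N h \<Delta>;
           is_step = rk_step d s a b V B h \<Delta> c;
           is_sol = ode_solution_on F (ball c (2 * R)) h c
         in (\<exists>Y. is_step Y) \<and> (\<exists>y. is_sol y) \<and>
          (\<forall>Y y. is_step Y \<longrightarrow> is_sol y \<longrightarrow>
             norm (y h - Y) \<le> C * h * exp (- 1 / h powr (1 / 2 - \<epsilon>)))"
          unfolding Let_def by blast
      qed
    qed
  qed
qed

end
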